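(* Let $\lambda:[0,1]\to\mathbb{R}$ be a continuous driving function which is weakly Hölder-$1/2$ with subpower function $\varphi$, that is, $$\sup\{|\lambda(t)-\lambda(s)|: s,t\in[0,1],\ |t-s|\le\delta\}\le\sqrt{\delta}\,\varphi(1/\delta)\quad\text{for all }\delta>0 .$$ Let $(g_t)_{0\le t\le1}$ be the Loewner chain driven by $\lambda$, let $\hat f_t(z)=g_t^{-1}(\lambda(t)+z)$, and suppose there exist $c_0>0$, $y_0>0$ and $0<\beta<1$ such that $$|\hat f_t'(iy)|\le c_0\,y^{-\beta}\quad\text{for all } 0<y\le y_0,\ t\in[0,1].$$ Let $\gamma:[0,1]\to\overline{\mathbb{H}}$ be the curve generated by the Loewner equation with driving function $\lambda$, and for $n\ge 1$ let $\gamma^n$ be the curve produced from $\lambda$ by the square-root interpolation algorithm with step $1/n$. Then there exists a subpower function $\widetilde\varphi$, depending on $\varphi$, $c_0$ and $\beta$, such that for all integers $n\ge \frac{1}{y_0^2}$ and all $t\in[0,1]$, $$|\gamma^n(t)-\gamma(t)|\le\frac{\widetilde\varphi(n)}{n^{\frac12\left(1-\sqrt{\frac{1+\beta}{2}}\right)}} .$$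
   Context: A subpower function is a non-decreasing function $\phi:[0,\infty)\to[0,\infty)$ with $\lim_{x\to\infty}x^{-\nu}\phi(x)=0$ for all $\nu>0$. $\mathbb{H}$ is the open upper half-plane. For a continuous $\lambda:[0,1]\to\mathbb{R}$, the chordal Loewner chain $(g_t)$ driven by $\lambda$ is the solution of $\partial_t g_t(z)=\frac{2}{g_t(z)-\lambda(t)}$, $g_0(z)=z$, $z\in\mathbb{H}$, which exists up to $T_z=\inf\{t\ge 0: g_t(z)=\lambda(t)\}$. With $K_t=\{z\in\mathbb{H}:T_z\le t\}$ and $H_t=\mathbb{H}\setminus K_t$, $g_t$ is the conformal map of $H_t$ onto $\mathbb{H}$ with $g_t(z)-z\to0$ as $z\to\infty$. The chain is generated by a curve $\gamma$ if $\gamma$ is continuous and $H_t$ is the unbounded component of $\mathbb{H}\setminus\gamma([0,t])$ for each $t$; equivalently $\gamma(t)=\lim_{y\to0^+}g_t^{-1}(\lambda(t)+iy)$ exists and is continuous. It is known that under the two hypotheses on $\lambda$ in the claim the chain is generated by a curve. Algorithm: for $n\ge1$ put $t_k=k/n$, $0\le k\le n$, and define $\lambda^n:[0,1]\to\mathbb{R}$ by $$\lambda^n(t)=\sqrt{n}\,(\lambda(t_{k+1})-\lambda(t_k))\sqrt{t-t_k}+\lambda(t_k),\qquad t\in[t_k,t_{k+1}],\ 0\le k\le n-1 .$$ The Loewner chain driven by $\lambda^n$ is generated by a simple curve $\gamma^n:[0,1]\to\mathbb{H}\cup\{\lambda(0)\}$; this is the curve produced by the algorithm with step $1/n$. *)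

theory Defs
  imports "HOL-Analysis.Analysis"
begin

definition subpower :: "(real \<Rightarrow> real) \<Rightarrow> bool" where
  "subpower \<phi> \<longleftrightarrow>
     (\<forall>x\<ge>0. 0 \<le> \<phi> x) \<and> mono_on {0..} \<phi> \<and>
     (\<forall>\<nu>>0. ((\<lambda>x. x powr (- \<nu>) * \<phi> x) \<longlongrightarrow> 0) at_top)"

definition weakly_holder_half :: "(real \<Rightarrow> real) \<Rightarrow> (real \<Rightarrow> real) \<Rightarrow> bool" where
  "weakly_holder_half \<phi> lam \<longleftrightarrow>
     (\<forall>\<delta>>0. Sup {\<bar>lam t - lam s\<bar> | s t. s \<in> {0..1} \<and> t \<in> {0..1} \<and> \<bar>t - s\<bar> \<le> \<delta>}
              \<le> sqrt \<delta> * \<phi> (1 / \<delta>))"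

abbreviation upper_half_plane :: "complex set" where
  "upper_half_plane \<equiv> {z. 0 < Im z}"

text \<open>The trajectory of \<open>z\<close> on \<open>[0,T]\<close>. The equation is required on \<open>[0,T)\<close> only, so that
  the trajectory may end on the driving function at time \<open>T\<close>; otherwise the equation at time
  \<open>T\<close> follows by continuity.\<close>

definition loewner_flow ::
    "(real \<Rightarrow> real) \<Rightarrow> complex \<Rightarrow> real \<Rightarrow> (real \<Rightarrow> complex) \<Rightarrow> bool" where
  "loewner_flow lam z T u \<longleftrightarrow>
     u 0 = z \<and> continuous_on {0..T} u \<and>
     (\<forall>t\<in>{0..<T}. u t \<noteq> of_real (lam t) \<and>
        (u has_vector_derivative 2 / (u t - of_real (lam t))) (at t within {0..T}))"

text \<open>Trajectories in the upper half-plane are unique. The value is only meaningful up to the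
  swallowing time of \<open>z\<close>.\<close>

definition loewner_map :: "(real \<Rightarrow> real) \<Rightarrow> real \<Rightarrow> complex \<Rightarrow> complex" where
  "loewner_map lam t z = (THE w. \<exists>u. loewner_flow lam z t u \<and> w = u t)"

text \<open>The infimum is \<open>\<infinity>\<close> if \<open>z\<close> is not swallowed during \<open>[0,1]\<close>.\<close>

definition swallowing_time :: "(real \<Rightarrow> real) \<Rightarrow> complex \<Rightarrow> ereal" where
  "swallowing_time lam z =
     Inf {ereal t | t. t \<in> {0..1} \<and> (\<exists>u. loewner_flow lam z t u \<and> u t = of_real (lam t))}"

definition loewner_hull :: "(real \<Rightarrow> real) \<Rightarrow> real \<Rightarrow> complex set" where
  "loewner_hull lam t = {z \<in> upper_half_plane. swallowing_time lam z \<le> ereal t}"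

definition loewner_domain :: "(real \<Rightarrow> real) \<Rightarrow> real \<Rightarrow> complex set" where
  "loewner_domain lam t = upper_half_plane - loewner_hull lam t"

text \<open>The map \<open>z \<mapsto> g\<^sub>t\<^sup>-\<^sup>1(lam(t) + z)\<close>.\<close>

definition loewner_fhat :: "(real \<Rightarrow> real) \<Rightarrow> real \<Rightarrow> complex \<Rightarrow> complex" where
  "loewner_fhat lam t z =
     inv_into (loewner_domain lam t) (loewner_map lam t) (of_real (lam t) + z)"

definition generated_by_curve :: "(real \<Rightarrow> real) \<Rightarrow> (real \<Rightarrow> complex) \<Rightarrow> bool" where
  "generated_by_curve lam \<gamma> \<longleftrightarrow>
     continuous_on {0..1} \<gamma> \<and> \<gamma> ` {0..1} \<subseteq> {z. 0 \<le> Im z} \<and>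
     (\<forall>t\<in>{0..1}. loewner_domain lam t \<in> components (upper_half_plane - \<gamma> ` {0..t}) \<and>
                  \<not> bounded (loewner_domain lam t))"

definition sqrt_interp :: "(real \<Rightarrow> real) \<Rightarrow> nat \<Rightarrow> real \<Rightarrow> real" where
  "sqrt_interp lam n t =
     (let k = real_of_int \<lfloor>real n * t\<rfloor> in
        sqrt (real n) * (lam ((k + 1) / real n) - lam (k / real n)) * sqrt (t - k / real n)
          + lam (k / real n))"

text \<open>The floor selects the interval; neighbouring pieces agree at the common node, and at
  \<open>t = 1\<close> the coefficient of the value of \<open>lam\<close> outside \<open>[0,1]\<close> vanishes.\<close>

lemma sqrt_interp_piece:
  assumes "k < n" and "t \<in> {real k / real n..real (k + 1) / real n}"
  shows "sqrt_interp lam n t =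
    sqrt (real n) * (lam (real (k + 1) / real n) - lam (real k / real n)) * sqrt (t - real k / real n)
      + lam (real k / real n)"
proof (cases "t = real (k + 1) / real n")
  case True
  have n: "0 < real n" using assms(1) by simp
  have "real n * t = real (k + 1)" using True n by simp
  hence fl: "\<lfloor>real n * t\<rfloor> = int (k + 1)" by (metis floor_of_nat)
  have "t - real k / real n = 1 / real n" using True by (simp add: diff_divide_distrib [symmetric])
  hence "sqrt (real n) * sqrt (t - real k / real n) = 1"
    using n by (simp add: real_sqrt_mult [symmetric])
  hence "sqrt (real n) * (lam t - lam (real k / real n)) * sqrt (t - real k / real n)
      = lam t - lam (real k / real n)"
    by (simp add: mult.commute mult.left_commute)
  moreover have "sqrt_interp lam n t = lam t"
    unfolding sqrt_interp_def fl Let_def using True by simp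
  ultimately show ?thesis unfolding True [symmetric] by linarith
next
  case False
  have n: "0 < real n" using assms(1) by simp
  have "real k \<le> real n * t" "real n * t < real k + 1"
    using assms(2) False n by (auto simp: field_simps)
  hence fl: "\<lfloor>real n * t\<rfloor> = int k" by (simp add: floor_eq_iff)
  show ?thesis unfolding sqrt_interp_def fl Let_def by (simp add: add.commute)
qed

end

theory Submission
  imports Defs "HOL-Complex_Analysis.Complex_Analysis"
begin

text \<open>
  Write \<open>y = n\<^sup>-\<^sup>1\<^sup>/\<^sup>2\<close>, let \<open>f\<^sub>t = g\<^sub>t\<^sup>-\<^sup>1\<close> and \<open>f\<^sup>n\<^sub>t\<close> be the inverse maps of the two chains, and let \<open>s\<close> be the
  node preceding the one before \<open>t\<close>. Then \<open>\<gamma>\<^sup>n(t)\<close> is compared with \<open>\<gamma>(t)\<close> through \<open>f\<^sup>n\<^sub>s(w)\<close>, \<open>f\<^sub>s(w)\<close> and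
  \<open>f\<^sub>t(lam(t) + \<i>y)\<close>, where \<open>w = lam(s) + \<i>y\<close>.
  The middle step uses that two backward flows driven by functions at distance \<open>\<epsilon>\<close> differ by at most
  \<open>\<epsilon> exp (\<integral> Re (2 / z\<^sub>1 z\<^sub>2))\<close> up to a logarithm, and the integral is bounded through the derivatives of the
  two maps; this yields the exponent. The outer steps are distortion estimates at the scale \<open>y\<close>: two
  square-root pieces push the tip to a height of order \<open>y\<close> up to subpower factors, and
  the integrated derivative bound gives \<open>|\<gamma>(t) - f\<^sub>t(lam(t) + \<i>y)| = O(y\<^sup>1\<^sup>-\<^sup>\<beta>)\<close>.
\<close>

section \<open>Distortion of univalent functions\<close>

text \<open>The hypothesis \<open>generated_by_curve\<close> describes only the topology of the
  hulls and says nothing about radial limits. Estimates at \<gamma>(t) are therefore obtained from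
  points \<gamma>(r) with r slightly beyond t, whose images under g_t lie in the open half-plane
  near lam(t), and are passed on to \<gamma>(t) by continuity. Since t = 1 has no later times, it is
  reached by continuity at the very end. No derivative bound is given for the interpolated chain.
  The one needed at the node s comes from Cauchy's inequality for the difference of the two inverse
  maps, which is why these are compared on a whole disc of radius y/2. Two pieces are needed because
  just after a node the current piece has hardly lifted the tip, and then the full piece before it
  has to supply the height.\<close>

lemma open_upper_half_plane: "open upper_half_plane"
  using open_halfspace_Im_gt[of 0] by simp

text \<open>If the image contained the closed disc of radius 2, the rescaled inverse
  \<open>F\<close> would map the unit disc into itself, fix 0 and have derivative 2 there, against
  the Schwarz lemma.\<close>

lemma univalent_omits_small_value:
  assumes hol: "f holomorphic_on ball 0 1" and inj: "inj_on f (ball 0 1)"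
    and f0: "f 0 = 0" and f1: "deriv f 0 = 1"
  obtains a where "a \<notin> f ` ball 0 1" "cmod a \<le> 2"
proof -
  have "\<not> cball 0 2 \<subseteq> f ` ball 0 1"
  proof
    assume sub: "cball 0 2 \<subseteq> f ` ball 0 1"
    obtain g where g: "g holomorphic_on (f ` ball 0 1)"
      "\<And>z. z \<in> ball 0 1 \<Longrightarrow> deriv f z * deriv g (f z) = 1"
      "\<And>z. z \<in> ball 0 1 \<Longrightarrow> g (f z) = z"
      using holomorphic_has_inverse[OF hol open_ball inj] by blast
    have g0: "g 0 = 0" "deriv g 0 = 1" using g(2)[of 0] g(3)[of 0] f0 f1 by auto
    define F where "F = (\<lambda>w. g (2 * w))"
    have holF: "F holomorphic_on ball 0 1" unfolding F_def
      by (rule holomorphic_on_compose_gen[unfolded o_def, OF _ holomorphic_on_subset[OF g(1) sub]])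
        (auto intro!: holomorphic_intros simp: norm_mult)
    have bd: "cmod (F z) < 1" if "cmod z < 1" for z
    proof -
      have "2 * z \<in> f ` ball 0 1" using sub that by (auto simp: norm_mult subset_iff)
      then show ?thesis using g(3) by (auto simp: F_def)
    qed
    have "g field_differentiable at 0"
      using g(1) open_mapping_thm3[OF hol open_ball inj] f0
      by (metis centre_in_ball holomorphic_on_imp_differentiable_at image_eqI zero_less_one)
    then have "(g has_field_derivative 1) (at (2 * 0))"
      using g0(2) by (metis DERIV_deriv_iff_field_differentiable mult_zero_right)
    then have "(F has_field_derivative 1 * 2) (at 0)"
      unfolding F_def by (rule DERIV_chain2) (auto intro!: derivative_eq_intros)
    then have "deriv F 0 = 2" using DERIV_imp_deriv by force
    moreover have "cmod (deriv F 0) \<le> 1"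
      by (rule Schwarz_Lemma(2)[OF holF _ bd, of 0]) (auto simp: F_def g0)
    ultimately show False by simp
  qed
  then show ?thesis using that by (auto simp: subset_iff)
qed

text \<open>If \<open>f\<close> omits \<open>a\<close> and \<open>f - a = g\<^sup>2\<close> with \<open>g 0 = c\<close>, then \<open>J = g / (g + c)\<close> is
  well defined by injectivity and omits \<open>0\<close> and \<open>1\<close>, so Schottky's theorem bounds it.\<close>

lemma weak_Bieberbach:
  obtains K where "0 < K"
    "\<And>f. \<lbrakk>f holomorphic_on ball 0 1; inj_on f (ball 0 1); f 0 = 0; deriv f 0 = 1\<rbrakk>
       \<Longrightarrow> cmod (deriv (deriv f) 0) \<le> K"
proof -
  \<comment> \<open>Schottky's bound for functions of modulus at most 1/2 at the origin, on the disc
    of radius 1/2. It is applied to \<open>J (z/2)\<close> and hence bounds \<open>J\<close> on the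
    disc of radius 1/4.\<close>
  define S where "S = exp(pi * exp(pi * (2 + 2 * (1/2) + 12 * (1/2) / (1 - 1/2))))"
  have S: "S > 0" by (simp add: S_def)
  show ?thesis
  proof (rule that[of "1000 * S"])
    fix f assume hol: "f holomorphic_on ball 0 1" and inj: "inj_on f (ball 0 1)"
      and f0: "f 0 = 0" and f1: "deriv f 0 = 1"
    obtain a where a: "a \<notin> f ` ball 0 1" "cmod a \<le> 2"
      using univalent_omits_small_value[OF hol inj f0 f1] by blast
    have "(\<lambda>z. f z - a) holomorphic_on ball 0 1" by (intro holomorphic_intros hol)
    then obtain g where g: "g holomorphic_on ball 0 1" "\<And>z. z \<in> ball 0 1 \<Longrightarrow> f z - a = g z ^ 2"
      using a contractible_imp_holomorphic_sqrt[of "\<lambda>z. f z - a" "ball 0 1"]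
      by (metis (no_types, lifting) convex_ball convex_imp_contractible eq_iff_diff_eq_0 image_eqI)
    define c where "c = g 0"
    have c2: "c^2 = - a" using g(2)[of 0] f0 by (simp add: c_def)
    have "a \<noteq> 0" using a f0 by force
    then have c0: "c \<noteq> 0" using c2 by auto
    have gc: "g z + c \<noteq> 0" if "z \<in> ball 0 1" for z
    proof
      assume "g z + c = 0"
      then have gz: "g z = - c" by (simp add: eq_neg_iff_add_eq_0)
      then have "f z - a = f 0 - a" using g(2)[OF that] g(2)[of 0] by (simp add: c_def)
      then have "f z = f 0" by simp
      then have "z = 0" using inj that by (auto simp: inj_on_def)
      then show False using gz c0 by (simp add: c_def)
    qed
    have g0: "g z \<noteq> 0" if "z \<in> ball 0 1" for z using g(2)[OF that] a that by force
    define J where "J = (\<lambda>z. g z / (g z + c))"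
    have holJ: "J holomorphic_on ball 0 1" unfolding J_def using gc
      by (intro holomorphic_intros g) auto
    have J0: "J 0 = 1/2" unfolding J_def using c0 by (simp add: c_def[symmetric])
    have J01: "J z \<noteq> 0 \<and> J z \<noteq> 1" if "z \<in> ball 0 1" for z
      unfolding J_def using gc[OF that] g0[OF that] c0 by auto
    have bJ: "cmod (J z) \<le> S" if "cmod z \<le> 1/4" for z
    proof -
      have h: "(\<lambda>z. J (z/2)) holomorphic_on cball 0 1"
        by (rule holomorphic_on_compose_gen[unfolded o_def, OF _ holJ])
          (auto intro!: holomorphic_intros simp: norm_divide)
      have n: "\<not> (J (z/2) = 0 \<or> J (z/2) = 1)" if "z \<in> cball 0 1" for z
        using J01[of "z/2"] that by (auto simp: norm_divide)
      have "cmod (J (0/2)) \<le> 1/2" "cmod (2 * z) \<le> 1/2" using that by (auto simp: J0 norm_mult)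
      from Schottky[OF h this(1) n _ _ this(2)] show ?thesis by (simp add: S_def)
    qed
    have J1: "cmod ((deriv ^^ n) J 0) \<le> fact n * S / (1/4)^n" for n
      by (rule Cauchy_inequality)
        (use bJ in \<open>auto intro!: holomorphic_on_subset[OF holJ] holomorphic_on_imp_continuous_on\<close>)
    \<comment> \<open>Elimination of \<open>g\<close> leaves an identity between \<open>f\<close>
      and \<open>J\<close> alone. Differentiated twice at 0, where \<open>J\<close> equals 1/2, it
      expresses f''(0) through J'(0) and J''(0), which Cauchy's inequality controls.\<close>
    have key: "f z * (1 - J z)^2 = a * (1 - 2 * J z)" if "z \<in> ball 0 1" for z
    proof -
      have "1 - J z = c / (g z + c)" "1 - 2 * J z = (c - g z) / (g z + c)"
        unfolding J_def using gc[OF that] by (auto simp: field_simps)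
      moreover have "f z = (g z)\<^sup>2 - c\<^sup>2" using g(2)[OF that] c2 by (simp add: algebra_simps)
      moreover have "a = - (c\<^sup>2)" using c2 by simp
      moreover have "((g z)\<^sup>2 - c\<^sup>2) * (c / (g z + c))\<^sup>2 = - (c\<^sup>2) * ((c - g z) / (g z + c))"
        using gc[OF that] by (simp add: divide_simps power2_eq_square) (simp add: algebra_simps)
      ultimately show ?thesis by simp
    qed
    have df: "(f has_field_derivative deriv f z) (at z)" if "z \<in> ball 0 1" for z
      using hol holomorphic_derivI that open_ball by blast
    have dJ: "(J has_field_derivative deriv J z) (at z)" if "z \<in> ball 0 1" for z
      using holJ holomorphic_derivI that open_ball by blast
    have ddf: "(deriv f has_field_derivative deriv (deriv f) z) (at z)" if "z \<in> ball 0 1" for z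
      using hol holomorphic_derivI holomorphic_deriv that open_ball by blast
    have ddJ: "(deriv J has_field_derivative deriv (deriv J) z) (at z)" if "z \<in> ball 0 1" for z
      using holJ holomorphic_derivI holomorphic_deriv that open_ball by blast
    have vanish: "(Q has_field_derivative 0) (at z)" if "\<And>w. w \<in> ball 0 1 \<Longrightarrow> Q w = 0" "z \<in> ball 0 1"
      for Q :: "complex \<Rightarrow> complex" and z
      by (rule has_field_derivative_transform_within_open[of "\<lambda>_. 0" _ _ "ball 0 1"])
        (use that in auto)
    have key1: "deriv f z * (1 - J z)^2 - 2 * f z * (1 - J z) * deriv J z + 2 * a * deriv J z = 0"
      if z: "z \<in> ball 0 1" for z
    proof -
      have "((\<lambda>z. f z * (1 - J z)^2 - a * (1 - 2 * J z)) has_field_derivative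
         deriv f z * (1 - J z)^2 - 2 * f z * (1 - J z) * deriv J z + 2 * a * deriv J z) (at z)"
        by (rule derivative_eq_intros df[OF z] dJ[OF z] refl)+ (simp add: algebra_simps)
      moreover have "((\<lambda>z. f z * (1 - J z)^2 - a * (1 - 2 * J z)) has_field_derivative 0) (at z)"
        by (rule vanish) (use key z in auto)
      ultimately show ?thesis by (rule DERIV_unique)
    qed
    have z0: "(0::complex) \<in> ball 0 1" by simp
    have "((\<lambda>z. deriv f z * (1 - J z)^2 - 2 * f z * (1 - J z) * deriv J z + 2 * a * deriv J z)
       has_field_derivative deriv (deriv f) 0 * (1 - J 0)^2 - 4 * deriv f 0 * (1 - J 0) * deriv J 0
         - 2 * f 0 * ((1 - J 0) * deriv (deriv J) 0 - deriv J 0 ^ 2) + 2 * a * deriv (deriv J) 0) (at 0)"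
      by (rule derivative_eq_intros df[OF z0] dJ[OF z0] ddf[OF z0] ddJ[OF z0] refl)+
         (simp add: algebra_simps power2_eq_square)
    moreover have "((\<lambda>z. deriv f z * (1 - J z)^2 - 2 * f z * (1 - J z) * deriv J z + 2 * a * deriv J z)
       has_field_derivative 0) (at 0)"
      by (rule vanish) (use key1 in auto)
    ultimately have "deriv (deriv f) 0 * (1 - J 0)^2 - 4 * deriv f 0 * (1 - J 0) * deriv J 0
         - 2 * f 0 * ((1 - J 0) * deriv (deriv J) 0 - deriv J 0 ^ 2) + 2 * a * deriv (deriv J) 0 = 0"
      by (rule DERIV_unique)
    then have "deriv (deriv f) 0 = 8 * deriv J 0 - 8 * a * deriv (deriv J) 0"
      unfolding J0 f0 f1 by (simp add: field_simps power2_eq_square)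
    then have "cmod (deriv (deriv f) 0) \<le> 8 * cmod (deriv J 0) + 8 * cmod a * cmod (deriv (deriv J) 0)"
      by (metis (no_types, lifting) norm_mult norm_numeral norm_triangle_ineq4)
    also have "\<dots> \<le> 8 * (4 * S) + 8 * 2 * (32 * S)"
      using J1[of 1] J1[of 2] a(2) S
      by (intro add_mono mult_mono) (auto simp: numeral_2_eq_2 power2_eq_square)
    also have "\<dots> \<le> 1000 * S" using S by simp
    finally show "cmod (deriv (deriv f) 0) \<le> 1000 * S" .
  qed (use S in simp)
qed

lemma univalent_deriv_nonzero:
  assumes "f holomorphic_on upper_half_plane" "inj_on f upper_half_plane" "0 < Im z"
  shows "deriv f z \<noteq> 0"
proof -
  note open_upper_half_plane
  with assms show ?thesis by (intro holomorphic_injective_imp_regular) auto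
qed

text \<open>Koebe transform: the disc of radius \<open>Im z\<close> about \<open>z\<close> stays in
  the half-plane, so \<open>weak_Bieberbach\<close> covers the normalised restriction of
  \<open>f\<close> to it. Undoing the scaling produces the factor \<open>1 / Im z\<close>.\<close>

lemma univalent_second_deriv_bound:
  obtains K where "0 < K"
    "\<And>f z. \<lbrakk>f holomorphic_on upper_half_plane; inj_on f upper_half_plane; 0 < Im z\<rbrakk>
       \<Longrightarrow> cmod (deriv (deriv f) z) \<le> K / Im z * cmod (deriv f z)"
proof -
  obtain K where K: "0 < K"
    "\<And>f. \<lbrakk>f holomorphic_on ball 0 1; inj_on f (ball 0 1); f 0 = 0; deriv f 0 = 1\<rbrakk>
       \<Longrightarrow> cmod (deriv (deriv f) 0) \<le> K" using weak_Bieberbach by blast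
  show ?thesis
  proof (rule that[OF K(1)])
    fix f z assume hol: "f holomorphic_on upper_half_plane" and inj: "inj_on f upper_half_plane"
      and z: "0 < Im z"
    define r where "r = complex_of_real (Im z)"
    define d where "d = deriv f z"
    have d0: "d \<noteq> 0" unfolding d_def by (rule univalent_deriv_nonzero[OF hol inj z])
    have r0: "r \<noteq> 0" using z by (simp add: r_def)
    have inH: "z + r * w \<in> upper_half_plane" if "w \<in> ball 0 1" for w
    proof -
      have "\<bar>Im w\<bar> < 1" using that abs_Im_le_cmod[of w] by (simp)
      then have "Im z * (1 + Im w) > 0" using z by (intro mult_pos_pos) auto
      then show ?thesis by (simp add: r_def algebra_simps)
    qed
    define F where "F = (\<lambda>w. (f (z + r * w) - f z) / (r * d))"
    have holF: "F holomorphic_on ball 0 1" unfolding F_def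
      using inH d0 r0 by (intro holomorphic_intros holomorphic_on_compose_gen[unfolded o_def, OF _ hol]) auto
    have injF: "inj_on F (ball 0 1)"
    proof (rule inj_onI)
      fix x y assume xy: "x \<in> ball 0 1" "y \<in> ball 0 1" "F x = F y"
      then have "f (z + r * x) = f (z + r * y)" using d0 r0 by (simp add: F_def)
      then have "z + r * x = z + r * y" using inj inH xy by (meson inj_onD)
      then show "x = y" using r0 by simp
    qed
    have dF: "(F has_field_derivative deriv f (z + r * w) / d) (at w)" if "w \<in> ball 0 1" for w
    proof -
      have "(f has_field_derivative deriv f (z + r * w)) (at (z + r * w))"
        using hol inH[OF that] open_upper_half_plane holomorphic_derivI by blast
      then have "((\<lambda>w. f (z + r * w)) has_field_derivative deriv f (z + r * w) * r) (at w)"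
        by (rule DERIV_chain2) (auto intro!: derivative_eq_intros)
      then show ?thesis unfolding F_def
        by - (rule derivative_eq_intros refl | assumption | use d0 r0 in \<open>simp add: field_simps\<close>)+
    qed
    have dF': "deriv F w = deriv f (z + r * w) / d" if "w \<in> ball 0 1" for w
      using dF[OF that] by (rule DERIV_imp_deriv)
    have "(deriv f has_field_derivative deriv (deriv f) (z + r * 0)) (at (z + r * 0))"
      using holomorphic_derivI[OF holomorphic_deriv[OF hol open_upper_half_plane] open_upper_half_plane] z by simp
    then have "((\<lambda>w. deriv f (z + r * w)) has_field_derivative deriv (deriv f) (z + r * 0) * r) (at 0)"
      by (rule DERIV_chain2) (auto intro!: derivative_eq_intros)
    then have "((\<lambda>w. deriv f (z + r * w) / d) has_field_derivative deriv (deriv f) (z + r * 0) * r / d) (at 0)"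
      by (rule DERIV_cdivide)
    then have "((\<lambda>w. deriv f (z + r * w) / d) has_field_derivative deriv (deriv f) z * r / d) (at 0)" by simp
    then have "(deriv F has_field_derivative deriv (deriv f) z * r / d) (at 0)"
      by (rule has_field_derivative_transform_within_open[of _ _ _ "ball 0 1"]) (use dF' in auto)
    then have "deriv (deriv F) 0 = deriv (deriv f) z * r / d" by (rule DERIV_imp_deriv)
    moreover have "cmod (deriv (deriv F) 0) \<le> K"
      by (rule K(2)[OF holF injF]) (use dF'[of 0] d0 in \<open>auto simp: F_def d_def\<close>)
    ultimately show "cmod (deriv (deriv f) z) \<le> K / Im z * cmod (deriv f z)"
      using d0 z by (simp add: norm_mult norm_divide r_def field_simps d_def)
  qed
qed

text \<open>The points \<open>v\<close> below have hyperbolic distance \<open>O(log R)\<close> from \<open>a + \<i>y\<close>.\<close>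

definition distortion_bound :: "real \<Rightarrow> nat \<Rightarrow> bool" where
  "distortion_bound C N \<longleftrightarrow> 1 \<le> C \<and>
    (\<forall>f a y R v. f holomorphic_on upper_half_plane \<longrightarrow> inj_on f upper_half_plane \<longrightarrow> 0 < y \<longrightarrow> 1 \<le> R \<longrightarrow>
       \<bar>Re v - a\<bar> \<le> R * y \<longrightarrow> y / R \<le> Im v \<longrightarrow> Im v \<le> R * y \<longrightarrow>
       cmod (deriv f v) \<le> C * R ^ N * cmod (deriv f (Complex a y)) \<and>
       cmod (f v - f (Complex a y)) \<le> C * R ^ N * y * cmod (deriv f (Complex a y)))"

text \<open>The logarithm \<open>L\<close> of f' has derivative at most \<open>K / Im z\<close>. It
  is followed from a + iy up to height R y, across, and down to \<open>v\<close>. The vertical legs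
  cost at most K ln R and 2 K ln R, hence a power of R; the horizontal leg has length at most R y at
  height R y and costs only K.\<close>

lemma distortion_bound_ex: "\<exists>C N. distortion_bound C N"
proof -
  obtain K where K: "0 < K"
    "\<And>f z. \<lbrakk>f holomorphic_on upper_half_plane; inj_on f upper_half_plane; 0 < Im z\<rbrakk>
       \<Longrightarrow> cmod (deriv (deriv f) z) \<le> K / Im z * cmod (deriv f z)"
    using univalent_second_deriv_bound by blast
  obtain N :: nat where N: "K \<le> real N" using real_arch_simple by blast
  have cv: "convex upper_half_plane" using convex_halfspace_Im_gt[of 0] by simp
  have key: "cmod (deriv f v) \<le> 2 * exp K * R ^ (3 * N + 1) * cmod (deriv f (Complex a y)) \<and>
      cmod (f v - f (Complex a y)) \<le> 2 * exp K * R ^ (3 * N + 1) * y * cmod (deriv f (Complex a y))"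
    if hol: "f holomorphic_on upper_half_plane" and inj: "inj_on f upper_half_plane"
      and y: "0 < y" and R: "1 \<le> R" and v: "\<bar>Re v - a\<bar> \<le> R * y" "y / R \<le> Im v" "Im v \<le> R * y"
    for f :: "complex \<Rightarrow> complex" and a y R :: real and v :: complex
  proof -
    have nz: "deriv f z \<noteq> 0" if "z \<in> upper_half_plane" for z
      using univalent_deriv_nonzero[OF hol inj] that by simp
    obtain L where L: "L holomorphic_on upper_half_plane" "\<And>z. z \<in> upper_half_plane \<Longrightarrow> deriv f z = exp (L z)"
      using contractible_imp_holomorphic_log[OF holomorphic_deriv[OF hol open_upper_half_plane] convex_imp_contractible[OF cv] nz]
      by blast
    have dL: "(L has_field_derivative deriv L z) (at z)" if "0 < Im z" for z
      using holomorphic_derivI[OF L(1) open_upper_half_plane] that by simp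
    have bL: "cmod (deriv L z) \<le> K / Im z" if z: "0 < Im z" for z
    proof -
      have "((\<lambda>z. exp (L z)) has_field_derivative exp (L z) * deriv L z) (at z)"
        by (rule DERIV_chain2[OF DERIV_exp dL[OF z]])
      then have "(deriv f has_field_derivative exp (L z) * deriv L z) (at z)"
        by (rule has_field_derivative_transform_within_open[OF _ open_upper_half_plane]) (use z L in auto)
      then have "deriv (deriv f) z = deriv f z * deriv L z" using DERIV_imp_deriv L(2) z by force
      then have "cmod (deriv f z) * cmod (deriv L z) \<le> cmod (deriv f z) * (K / Im z)"
        using K(2)[OF hol inj z] by (simp add: norm_mult mult.commute)
      then show ?thesis by (rule mult_left_le_imp_le) (use nz[of z] z in simp)
    qed
    have vert: "cmod (L (Complex x q) - L (Complex x p)) \<le> K * ln (q / p)" if pq: "0 < p" "p \<le> q" for x p q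
    proof (cases "p = q")
      case False
      have der: "((\<lambda>s. L (Complex x s)) has_vector_derivative \<i> * deriv L (Complex x s)) (at s)" if "0 < s" for s
      proof -
        have "((\<lambda>s. Complex x s) has_vector_derivative \<i>) (at s)"
          unfolding Complex_eq by (auto intro!: derivative_eq_intros)
        from field_vector_diff_chain_at[OF this, of L] dL[of "Complex x s"] that
        show ?thesis by (simp add: o_def)
      qed
      have "cmod (L (Complex x q) - L (Complex x p)) \<le> K * ln q - K * ln p"
      proof (rule differentiable_bound_general[of p q "\<lambda>s. L (Complex x s)" "\<lambda>s. K * ln s"
            "\<lambda>s. \<i> * deriv L (Complex x s)" "\<lambda>s. K / s"])
        show "continuous_on {p..q} (\<lambda>s. L (Complex x s))"
        proof (rule continuous_on_vector_derivative[OF has_vector_derivative_at_within])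
          fix s assume "s \<in> {p..q}"
          then show "((\<lambda>s. L (Complex x s)) has_vector_derivative \<i> * deriv L (Complex x s)) (at s)"
            by (intro der) (use pq in simp)
        qed
        show "continuous_on {p..q} (\<lambda>s. K * ln s)" using pq by (intro continuous_intros) auto
        fix s assume s: "p < s" "s < q"
        show "((\<lambda>s. L (Complex x s)) has_vector_derivative \<i> * deriv L (Complex x s)) (at s)"
          using der s pq by simp
        show "((\<lambda>s. K * ln s) has_vector_derivative K / s) (at s)"
          unfolding has_real_derivative_iff_has_vector_derivative[symmetric]
          using s pq by (auto intro!: derivative_eq_intros)
        show "cmod (\<i> * deriv L (Complex x s)) \<le> K / s"
          using bL[of "Complex x s"] s pq by (simp add: norm_mult)
      qed (use False pq in auto)
      then show ?thesis using pq by (simp add: ln_div algebra_simps)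
    qed simp
    have horiz: "cmod (L (Complex x Y) - L (Complex x' Y)) \<le> K / Y * \<bar>x - x'\<bar>" if Y: "0 < Y" for x x' Y
    proof -
      have im: "Im z = Y" if "z \<in> closed_segment (Complex x Y) (Complex x' Y)" for z
      proof -
        obtain r where "z = (1 - r) *\<^sub>R Complex x Y + r *\<^sub>R Complex x' Y"
          using \<open>z \<in> _\<close> by (auto simp: closed_segment_def)
        then show ?thesis by (simp add: left_diff_distrib)
      qed
      have "cmod (L (Complex x Y) - L (Complex x' Y)) \<le> K / Y * cmod (Complex x Y - Complex x' Y)"
        by (rule field_differentiable_bound[where S = "closed_segment (Complex x Y) (Complex x' Y)" and f' = "deriv L"])
          (use dL bL im Y has_field_derivative_at_within in \<open>fastforce+\<close>)
      moreover have "Complex x Y - Complex x' Y = of_real (x - x')" by (simp add: complex_eq_iff)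
      ultimately show ?thesis by (metis norm_of_real)
    qed
    have dist: "cmod (deriv f v) \<le> exp K * R ^ (3 * N) * cmod (deriv f (Complex a y))"
      if v: "\<bar>Re v - a\<bar> \<le> R * y" "y / R \<le> Im v" "Im v \<le> R * y" for v
    proof -
      have Ry: "0 < R * y" "y \<le> R * y" using R y by auto
      have iv: "0 < Im v" using v(2) y R by (smt (verit) divide_pos_pos)
      have 1: "cmod (L (Complex a (R * y)) - L (Complex a y)) \<le> K * ln R"
        using vert[of y "R * y" a] Ry y by simp
      have "K / (R * y) * \<bar>Re v - a\<bar> \<le> K / (R * y) * (R * y)"
        using K(1) Ry v by (intro mult_left_mono) auto
      moreover have "K / (R * y) * (R * y) = K" using R y by simp
      ultimately have 2: "cmod (L (Complex (Re v) (R * y)) - L (Complex a (R * y))) \<le> K"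
        using horiz[OF Ry(1), of "Re v" a] by linarith
      have "R * y / Im v \<le> R * y / (y / R)" using iv y R v by (intro divide_left_mono) auto
      then have "R * y / Im v \<le> R\<^sup>2" using y R by (simp add: power2_eq_square)
      then have "ln (R * y / Im v) \<le> ln (R\<^sup>2)" using iv Ry by (subst ln_le_cancel_iff) auto
      then have "ln (R * y / Im v) \<le> 2 * ln R" using R by (simp add: ln_realpow)
      then have "K * ln (R * y / Im v) \<le> K * (2 * ln R)" using K(1) by (intro mult_left_mono) auto
      then have 3: "cmod (L (Complex (Re v) (R * y)) - L v) \<le> 2 * K * ln R"
        using vert[OF iv v(3), of "Re v"] by simp
      have "Re (L v) - Re (L (Complex a y)) \<le> cmod (L v - L (Complex a y))"
        using complex_Re_le_cmod[of "L v - L (Complex a y)"] by simp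
      also have "\<dots> \<le> cmod (L (Complex (Re v) (R * y)) - L v)
          + cmod (L (Complex (Re v) (R * y)) - L (Complex a (R * y)))
          + cmod (L (Complex a (R * y)) - L (Complex a y))"
        using norm_triangle_ineq4[of "L (Complex (Re v) (R * y)) - L (Complex a y)" "L (Complex (Re v) (R * y)) - L v"]
          norm_triangle_ineq[of "L (Complex (Re v) (R * y)) - L (Complex a (R * y))" "L (Complex a (R * y)) - L (Complex a y)"]
        by (simp add: norm_minus_commute)
      also have "\<dots> \<le> 3 * K * ln R + K" using 1 2 3 by simp
      also have "\<dots> \<le> real (3 * N) * ln R + K"
        using N R by (simp add: mult_right_mono)
      finally have "Re (L v) \<le> K + real (3 * N) * ln R + Re (L (Complex a y))" by simp
      then have "exp (Re (L v)) \<le> exp (K + real (3 * N) * ln R + Re (L (Complex a y)))" by simp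
      also have "\<dots> = exp K * R ^ (3 * N) * exp (Re (L (Complex a y)))"
        using R by (simp only: exp_add exp_of_nat_mult exp_ln)
      finally show ?thesis using L(2)[of v] L(2)[of "Complex a y"] iv y by (simp add: norm_exp_eq_Re)
    qed
    \<comment> \<open>A convex box that contains both points and on which the derivative bound just
      proved holds throughout, as the mean value inequality requires.\<close>
    define B where "B = cbox (Complex (a - R * y) (y / R)) (Complex (a + R * y) (R * y))"
    have B: "z \<in> B \<longleftrightarrow> \<bar>Re z - a\<bar> \<le> R * y \<and> y / R \<le> Im z \<and> Im z \<le> R * y" for z
      unfolding B_def in_cbox_complex_iff by (auto simp: abs_le_iff)
    have pos: "0 < Im z" if "z \<in> B" for z using that B y R by (smt (verit) divide_pos_pos)
    have wB: "Complex a y \<in> B" and vB: "v \<in> B" using v y R unfolding B by (auto simp: field_simps)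
    have "cmod (f v - f (Complex a y)) \<le> exp K * R ^ (3 * N) * cmod (deriv f (Complex a y)) * cmod (v - Complex a y)"
    proof (rule field_differentiable_bound[of B f "deriv f"])
      show "convex B" unfolding B_def by (rule convex_box)
      show "(f has_field_derivative deriv f z) (at z within B)" if "z \<in> B" for z
        using holomorphic_derivI[OF hol open_upper_half_plane] pos[OF that] by (simp add: has_field_derivative_at_within)
      show "cmod (deriv f z) \<le> exp K * R ^ (3 * N) * cmod (deriv f (Complex a y))" if "z \<in> B" for z
        using that dist unfolding B by blast
    qed (use wB vB in auto)
    also have "\<dots> \<le> exp K * R ^ (3 * N) * cmod (deriv f (Complex a y)) * (2 * (R * y))"
    proof (intro mult_left_mono)
      have "y \<le> R * y" using R y by simp
      then have "\<bar>Im v - y\<bar> \<le> R * y" using v(3) pos[OF vB] y by linarith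
      then show "cmod (v - Complex a y) \<le> 2 * (R * y)"
        using cmod_le[of "v - Complex a y"] v(1) by simp
    qed (use R in auto)
    finally have f: "cmod (f v - f (Complex a y)) \<le> 2 * exp K * R ^ (3 * N + 1) * y * cmod (deriv f (Complex a y))"
      by (simp add: mult_ac)
    have "exp K * R ^ (3 * N) \<le> 2 * exp K * R ^ (3 * N + 1)"
      using R by (intro mult_mono power_increasing) auto
    then have "cmod (deriv f v) \<le> 2 * exp K * R ^ (3 * N + 1) * cmod (deriv f (Complex a y))"
      using order_trans[OF dist[OF v] mult_right_mono[OF _ norm_ge_zero]] by simp
    with f show ?thesis by blast
  qed
  have "1 \<le> 2 * exp K" using K(1) one_le_exp_iff[of K] by linarith
  then have "distortion_bound (2 * exp K) (3 * N + 1)" unfolding distortion_bound_def using key by blast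
  then show ?thesis by blast
qed

section \<open>The Loewner flow\<close>

lemma integral_exp_le:
  fixes L :: real
  assumes "0 < L" "0 \<le> t"
  shows "integral {0..t} (\<lambda>s. exp (L * s)) \<le> exp (L * t) / L"
proof -
  have "((\<lambda>s. exp (L * s)) has_integral exp (L * t) / L - exp (L * 0) / L) {0..t}"
    using assms by (intro fundamental_theorem_of_calculus)
      (auto intro!: derivative_eq_intros simp flip: has_real_derivative_iff_has_vector_derivative)
  then show ?thesis using assms by (simp add: integral_unique)
qed

text \<open>Picard--Lindelof on a whole interval at once: the unknown is weighted by
  \<open>exp (-2Lt)\<close>, which makes the integral operator a contraction whatever the length.\<close>

lemma global_Picard:
  fixes f :: "real \<Rightarrow> 'a::euclidean_space \<Rightarrow> 'a"
  assumes T: "0 \<le> T" and L: "0 < L"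
    and cont: "\<And>u. continuous_on {0..T} u \<Longrightarrow> continuous_on {0..T} (\<lambda>t. f t (u t))"
    and lip: "\<And>t x y. t \<in> {0..T} \<Longrightarrow> norm (f t x - f t y) \<le> L * norm (x - y)"
  obtains u where "u 0 = x0"
    "\<And>t. t \<in> {0..T} \<Longrightarrow> (u has_vector_derivative f t (u t)) (at t within {0..T})"
proof -
  \<comment> \<open>The Banach space \<open>bcontfun\<close> is formed over the whole line.
    Retracting time to [0,T] makes continuous functions on that interval globally defined and
    bounded.\<close>
  define cl where "cl = (\<lambda>t. max 0 (min T t))"
  have cl: "cl t \<in> {0..T}" for t using T by (auto simp: cl_def)
  have cl_id: "cl t = t" if "t \<in> {0..T}" for t using that by (auto simp: cl_def)
  have clc: "continuous_on S cl" for S unfolding cl_def by (intro continuous_intros)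
  define h where "h = (\<lambda>U r. f r (exp (2 * L * r) *\<^sub>R U r))"
  define G where "G = (\<lambda>U t. exp (- (2 * L * t)) *\<^sub>R
      (x0 + integral {0..t} (h U)))"
  have fc: "continuous_on {0..T} (h (apply_bcontfun U))" for U unfolding h_def
    by (intro cont continuous_intros continuous_on_apply_bcontfun)
  have Gc: "continuous_on {0..T} (G (apply_bcontfun U))" for U unfolding G_def
    by (intro continuous_intros indefinite_integral_continuous_1 integrable_continuous_interval fc)
  have Gb: "(\<lambda>t. G (apply_bcontfun U) (cl t)) \<in> bcontfun" for U
  proof -
    have "continuous_on UNIV (\<lambda>t. G (apply_bcontfun U) (cl t))"
      by (rule continuous_on_compose2[OF Gc clc]) (use cl in auto)
    moreover have "compact (G (apply_bcontfun U) ` {0..T})"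
      by (intro compact_continuous_image Gc) auto
    then have "bounded (range (\<lambda>t. G (apply_bcontfun U) (cl t)))"
      by (rule bounded_subset[OF compact_imp_bounded]) (use cl in auto)
    ultimately show ?thesis by (simp add: bcontfun_def)
  qed
  define \<Phi> where "\<Phi> = (\<lambda>U. Bcontfun (\<lambda>t. G (apply_bcontfun U) (cl t)))"
  have \<Phi>: "apply_bcontfun (\<Phi> U) t = G (apply_bcontfun U) (cl t)" for U t
    unfolding \<Phi>_def using Gb by (simp add: Bcontfun_inverse)
  have "dist (\<Phi> U) (\<Phi> V) \<le> 1/2 * dist U V" for U V
  proof (rule dist_bound)
    fix t
    define s where "s = cl t"
    have s: "s \<in> {0..T}" using cl s_def by simp
    define D where "D = dist U V"
    have int: "(h (apply_bcontfun U)) integrable_on {0..s}" for U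
      using s by (intro integrable_continuous_interval continuous_on_subset[OF fc]) auto
    have "norm (integral {0..s} (h (apply_bcontfun U)) - integral {0..s} (h (apply_bcontfun V)))
      = norm (integral {0..s} (\<lambda>r. h (apply_bcontfun U) r - h (apply_bcontfun V) r))"
      using int by (simp add: integral_diff)
    also have "\<dots> \<le> integral {0..s} (\<lambda>r. L * D * exp (2 * L * r))"
    proof (rule integral_norm_bound_integral)
      show "(\<lambda>r. L * D * exp (2 * L * r)) integrable_on {0..s}"
        by (intro integrable_continuous_interval continuous_intros)
      show "norm (h (apply_bcontfun U) r - h (apply_bcontfun V) r)
         \<le> L * D * exp (2 * L * r)" if "r \<in> {0..s}" for r
      proof -
        have "norm (h (apply_bcontfun U) r - h (apply_bcontfun V) r)
          \<le> L * norm (exp (2 * L * r) *\<^sub>R apply_bcontfun U r - exp (2 * L * r) *\<^sub>R apply_bcontfun V r)"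
          unfolding h_def using lip that s by auto
        also have "\<dots> = L * (exp (2 * L * r) * dist (apply_bcontfun U r) (apply_bcontfun V r))"
          by (simp add: dist_norm flip: scaleR_right_diff_distrib)
        also have "\<dots> \<le> L * (exp (2 * L * r) * D)"
          using L unfolding D_def by (intro mult_left_mono dist_bounded) auto
        finally show ?thesis by (simp add: mult_ac)
      qed
    qed (intro integrable_diff int)
    also have "\<dots> = L * D * integral {0..s} (\<lambda>r. exp (2 * L * r))" by simp
    also have "\<dots> \<le> L * D * (exp (2 * L * s) / (2 * L))"
      using L s by (intro mult_left_mono integral_exp_le) (auto simp: D_def)
    also have "\<dots> = 1/2 * D * exp (2 * L * s)" using L by simp
    finally have *: "norm (integral {0..s} (h (apply_bcontfun U)) - integral {0..s} (h (apply_bcontfun V))) \<le> 1/2 * D * exp (2 * L * s)" .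
    have "dist (apply_bcontfun (\<Phi> U) t) (apply_bcontfun (\<Phi> V) t) = exp (- (2 * L * s)) *
        norm (integral {0..s} (h (apply_bcontfun U)) - integral {0..s} (h (apply_bcontfun V)))"
      unfolding \<Phi> G_def s_def[symmetric] dist_norm by (simp flip: scaleR_right_diff_distrib)
    also have "\<dots> \<le> exp (- (2 * L * s)) * (1/2 * D * exp (2 * L * s))"
      using * by (intro mult_left_mono) auto
    also have "\<dots> = 1/2 * D" by (simp add: exp_minus)
    finally show "dist (apply_bcontfun (\<Phi> U) t) (apply_bcontfun (\<Phi> V) t) \<le> 1/2 * dist U V"
      by (simp add: D_def)
  qed
  then obtain U where U: "\<Phi> U = U" using banach_fix_type[of "1/2" \<Phi>] by auto
  define u where "u = (\<lambda>t. exp (2 * L * t) *\<^sub>R apply_bcontfun U t)"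
  have u: "u t = x0 + integral {0..t} (\<lambda>s. f s (u s))" if "t \<in> {0..T}" for t
    using \<Phi>[of U t] that unfolding U G_def u_def h_def by (simp add: cl_id flip: exp_add)
  have uc: "continuous_on {0..T} u" unfolding u_def
    by (intro continuous_intros continuous_on_apply_bcontfun)
  show thesis
  proof (rule that[of u])
    show "u 0 = x0" using u[of 0] T by simp
    fix t assume t: "t \<in> {0..T}"
    have "((\<lambda>t. x0 + integral {0..t} (\<lambda>s. f s (u s))) has_vector_derivative 0 + f t (u t)) (at t within {0..T})"
      by (intro has_vector_derivative_add has_vector_derivative_const integral_has_vector_derivative cont uc t)
    then show "(u has_vector_derivative f t (u t)) (at t within {0..T})"
      using t u by (auto intro: has_vector_derivative_transform[rotated 2])
  qed
qed

section \<open>Calculus on compact intervals\<close>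

lemma has_vector_derivative_bound:
  fixes u :: "real \<Rightarrow> 'a::real_normed_vector"
  assumes "\<And>s. s \<in> {a..b} \<Longrightarrow> (u has_vector_derivative u' s) (at s within {a..b})"
    and "\<And>s. s \<in> {a..b} \<Longrightarrow> norm (u' s) \<le> B" and "x \<in> {a..b}" "y \<in> {a..b}"
  shows "norm (u x - u y) \<le> B * \<bar>x - y\<bar>"
proof -
  have "norm (u x - u y) \<le> B * norm (x - y)"
  proof (rule differentiable_bound[of "{a..b}" u "\<lambda>s h. h *\<^sub>R u' s"])
    fix s assume s: "s \<in> {a..b}"
    show "(u has_derivative (\<lambda>h. h *\<^sub>R u' s)) (at s within {a..b})"
      using assms(1)[OF s] by (simp add: has_vector_derivative_def)
    have "0 \<le> B" using assms(2)[OF s] norm_ge_zero order_trans by blast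
    then show "onorm (\<lambda>h. h *\<^sub>R u' s) \<le> B" using assms(2)[OF s]
      by (intro onorm_bound) (auto simp: mult.commute[of B] intro!: mult_left_mono)
  qed (use assms in auto)
  then show ?thesis by simp
qed

lemma has_vector_derivative_nonneg_mono:
  fixes g :: "real \<Rightarrow> real"
  assumes "\<And>s. s \<in> {a..b} \<Longrightarrow> (g has_vector_derivative g' s) (at s within {a..b})"
    and "\<And>s. s \<in> {a..b} \<Longrightarrow> 0 \<le> g' s" and "a \<le> b"
  shows "g a \<le> g b"
proof -
  have "(g' has_integral (g b - g a)) {a..b}"
    by (rule fundamental_theorem_of_calculus) (use assms in auto)
  then have "0 \<le> g b - g a" by (rule has_integral_nonneg) (use assms in auto)
  then show ?thesis by simp
qed

lemma has_vector_derivative_Im: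
  "(u has_vector_derivative d) F \<Longrightarrow> ((\<lambda>s. Im (u s)) has_vector_derivative Im d) F"
  by (rule bounded_linear.has_vector_derivative[OF bounded_linear_Im])

lemma has_vector_derivative_exp_integral:
  fixes \<psi> :: "real \<Rightarrow> complex"
  assumes "continuous_on {a..b} \<psi>" "s \<in> {a..b}"
  shows "((\<lambda>s. exp (integral {a..s} \<psi>)) has_vector_derivative \<psi> s * exp (integral {a..s} \<psi>))
    (at s within {a..b})"
  using field_vector_diff_chain_within[OF integral_has_vector_derivative[OF assms]
      has_field_derivative_at_within[OF DERIV_exp]]
  by (simp add: o_def)

lemma Im_two_divide: "Im (2 / z) = - 2 * Im z / (cmod z)\<^sup>2"
  by (simp add: Im_divide cmod_power2)

lemma Im_two_divide_nonpos: "0 \<le> Im z \<Longrightarrow> Im (2 / z) \<le> 0"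
  unfolding Im_two_divide by (simp add: divide_nonpos_nonneg)

lemma two_divide_diff:
  fixes A B :: complex
  assumes "A \<noteq> 0" "B \<noteq> 0" shows "2 / A - 2 / B = - (2 / (A * B)) * (A - B)"
  using assms by (simp add: field_simps)

lemma DERIV_minus_ln:
  fixes Y :: "real \<Rightarrow> real"
  assumes "(Y has_real_derivative D) (at s within S)" "0 < Y s"
  shows "((\<lambda>s. - ln (Y s)) has_real_derivative - (D / Y s)) (at s within S)"
  using assms by (auto intro!: derivative_eq_intros simp: field_simps)

lemma DERIV_sq_linear:
  fixes Y :: "real \<Rightarrow> real"
  assumes "(Y has_real_derivative D) (at s within S)"
  shows "((\<lambda>s. (Y s)\<^sup>2 + c * s) has_real_derivative 2 * Y s * D + c) (at s within S)"
  using assms by (auto intro!: derivative_eq_intros)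

section \<open>The Loewner equation with a truncated vector field\<close>

definition clamp_Im :: "real \<Rightarrow> complex \<Rightarrow> complex" where
  "clamp_Im \<eta> z = Complex (Re z) (max \<eta> (Im z))"

lemma clamp_Im_id: "\<eta> \<le> Im z \<Longrightarrow> clamp_Im \<eta> z = z"
  by (simp add: clamp_Im_def complex_eq_iff max_def)

lemma clamp_Im_lipschitz: "cmod (clamp_Im \<eta> z - clamp_Im \<eta> w) \<le> cmod (z - w)"
proof -
  have "(max \<eta> (Im z) - max \<eta> (Im w))\<^sup>2 \<le> (Im z - Im w)\<^sup>2"
    unfolding abs_le_square_iff[symmetric] by (auto simp: max_def)
  then show ?thesis by (simp add: cmod_def clamp_Im_def)
qed

lemma clamp_Im_norm: "\<eta> \<le> cmod (clamp_Im \<eta> z - of_real r)"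
  using abs_Im_le_cmod[of "clamp_Im \<eta> z - of_real r"] by (simp add: clamp_Im_def)

text \<open>With the imaginary part cut off at \<eta> the denominator has modulus at least \<eta>,
  so the vector field is globally Lipschitz and \<open>global_Picard\<close> applies. The factor
  \<kappa> will be 2 for the Loewner equation and -2 for its time reversal.\<close>

lemma clamped_ode:
  assumes T: "0 \<le> T" and \<eta>: "0 < \<eta>" and cont: "continuous_on {0..T} \<xi>"
  obtains v where "v 0 = w" "\<And>t. t \<in> {0..T} \<Longrightarrow>
    (v has_vector_derivative of_real \<kappa> / (clamp_Im \<eta> (v t) - of_real (\<xi> t))) (at t within {0..T})"
proof -
  have nz: "clamp_Im \<eta> x - of_real r \<noteq> 0" for x r using clamp_Im_norm[of \<eta> x r] \<eta> by auto
  have clc: "continuous_on UNIV (clamp_Im \<eta>)"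
    unfolding clamp_Im_def Complex_eq by (intro continuous_intros)
  show thesis
  proof (rule global_Picard[of T "\<bar>\<kappa>\<bar> / \<eta>\<^sup>2 + 1" "\<lambda>t x. of_real \<kappa> / (clamp_Im \<eta> x - of_real (\<xi> t))" w])
    show "0 < \<bar>\<kappa>\<bar> / \<eta>\<^sup>2 + 1" by (intro add_nonneg_pos) auto
    show "continuous_on {0..T} (\<lambda>t. of_real \<kappa> / (clamp_Im \<eta> (u t) - of_real (\<xi> t)))"
      if "continuous_on {0..T} u" for u :: "real \<Rightarrow> complex"
      using nz by (intro continuous_intros continuous_on_compose2[OF clc that] cont) auto
    show "cmod (of_real \<kappa> / (clamp_Im \<eta> x - of_real (\<xi> t)) - of_real \<kappa> / (clamp_Im \<eta> y - of_real (\<xi> t)))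
      \<le> (\<bar>\<kappa>\<bar> / \<eta>\<^sup>2 + 1) * cmod (x - y)" for t x y
    proof -
      let ?A = "clamp_Im \<eta> x - of_real (\<xi> t)" and ?B = "clamp_Im \<eta> y - of_real (\<xi> t)"
      have "of_real \<kappa> / ?A - of_real \<kappa> / ?B = of_real \<kappa> * (clamp_Im \<eta> y - clamp_Im \<eta> x) / (?A * ?B)"
        using nz[of x "\<xi> t"] nz[of y "\<xi> t"] by (simp add: field_simps)
      then have "cmod (of_real \<kappa> / ?A - of_real \<kappa> / ?B)
          = \<bar>\<kappa>\<bar> * cmod (clamp_Im \<eta> y - clamp_Im \<eta> x) / (cmod ?A * cmod ?B)"
        by (simp add: norm_mult norm_divide)
      also have "\<dots> \<le> \<bar>\<kappa>\<bar> * cmod (x - y) / (\<eta> * \<eta>)"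
        using clamp_Im_lipschitz[of \<eta> y x] clamp_Im_norm[of \<eta> x "\<xi> t"] clamp_Im_norm[of \<eta> y "\<xi> t"] \<eta>
        by (intro frac_le mult_left_mono mult_mono) (auto simp: norm_minus_commute[of x y])
      also have "\<dots> \<le> (\<bar>\<kappa>\<bar> / \<eta>\<^sup>2 + 1) * cmod (x - y)"
        by (simp add: field_simps power2_eq_square)
      finally show ?thesis .
    qed
  qed (use T that in auto)
qed

text \<open>In contrast to \<open>loewner_flow\<close>, the equation holds up to and including the
  right end, the initial time is arbitrary, and positive height is demanded, which keeps the
  denominator away from zero.\<close>

definition traj :: "(real \<Rightarrow> real) \<Rightarrow> real \<Rightarrow> real \<Rightarrow> (real \<Rightarrow> complex) \<Rightarrow> bool" where
  "traj lam a b u \<longleftrightarrow> (\<forall>s\<in>{a..b}. 0 < Im (u s) \<and>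
     (u has_vector_derivative 2 / (u s - lam s)) (at s within {a..b}))"

lemma trajD:
  assumes "traj lam a b u" "s \<in> {a..b}"
  shows "0 < Im (u s)" "(u has_vector_derivative 2 / (u s - lam s)) (at s within {a..b})"
    "u s - lam s \<noteq> 0" "Im (u s) \<le> cmod (u s - lam s)"
proof -
  show *: "0 < Im (u s)" "(u has_vector_derivative 2 / (u s - lam s)) (at s within {a..b})"
    using assms by (auto simp: traj_def)
  show "Im (u s) \<le> cmod (u s - lam s)"
    using abs_Im_le_cmod[of "u s - lam s"] by simp
  then show "u s - lam s \<noteq> 0" using *(1) by auto
qed

lemma traj_subset:
  assumes "traj lam a b u" "a \<le> c" "d \<le> b" shows "traj lam c d u"
  using assms unfolding traj_def
  by (auto intro!: has_vector_derivative_within_subset[of u _ _ "{a..b}" "{c..d}"])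

lemma traj_cont: "traj lam a b u \<Longrightarrow> continuous_on {a..b} u"
  by (rule continuous_on_vector_derivative[OF trajD(2)])

lemma traj_Im_antimono:
  assumes "traj lam a b u" "a \<le> b" shows "Im (u b) \<le> Im (u a)"
proof -
  have "- Im (u a) \<le> - Im (u b)"
  proof (rule has_vector_derivative_nonneg_mono[where g = "\<lambda>s. - Im (u s)"])
    fix s assume s: "s \<in> {a..b}"
    show "((\<lambda>s. - Im (u s)) has_vector_derivative - Im (2 / (u s - lam s))) (at s within {a..b})"
      by (intro has_vector_derivative_minus has_vector_derivative_Im trajD[OF assms(1) s])
    show "0 \<le> - Im (2 / (u s - lam s))"
      using trajD(1)[OF assms(1) s] unfolding Im_two_divide by simp
  qed fact
  then show ?thesis by simp
qed

text \<open>Backwards in time heights increase, so the cut-off at \<open>Im w\<close> never acts and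
  the truncated solution solves the true equation on an interval of any length.\<close>

lemma traj_ex_backward:
  assumes "a \<le> b" "continuous_on {a..b} lam" "0 < Im w"
  obtains u where "traj lam a b u" "u b = w"
proof -
  have c: "continuous_on {0..b - a} (\<lambda>t. lam (b - t))"
    by (rule continuous_on_compose2[OF assms(2)]) (auto intro!: continuous_intros)
  obtain v where v: "v 0 = w" "\<And>t. t \<in> {0..b - a} \<Longrightarrow> (v has_vector_derivative
      of_real (-2) / (clamp_Im (Im w) (v t) - of_real (lam (b - t)))) (at t within {0..b - a})"
    using clamped_ode[OF _ assms(3) c, of w "-2"] assms(1) by auto
  have vIm: "Im w \<le> Im (v t)" if t: "t \<in> {0..b - a}" for t
  proof -
    have "Im (v 0) \<le> Im (v t)"
    proof (rule has_vector_derivative_nonneg_mono[where g = "\<lambda>s. Im (v s)"])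
      fix s assume s: "s \<in> {0..t}"
      let ?d = "of_real (-2) / (clamp_Im (Im w) (v s) - of_real (lam (b - s)))"
      have "(v has_vector_derivative ?d) (at s within {0..t})"
        by (rule has_vector_derivative_within_subset[OF v(2)]) (use s t in auto)
      then show "((\<lambda>s. Im (v s)) has_vector_derivative Im ?d) (at s within {0..t})"
        by (rule has_vector_derivative_Im)
      have "?d = - (2 / (clamp_Im (Im w) (v s) - of_real (lam (b - s))))" by simp
      moreover have "Im (2 / (clamp_Im (Im w) (v s) - of_real (lam (b - s)))) \<le> 0"
        by (rule Im_two_divide_nonpos) (use assms(3) in \<open>simp add: clamp_Im_def\<close>)
      ultimately show "0 \<le> Im ?d" unfolding uminus_complex.sel by simp
    qed (use t in auto)
    then show ?thesis using v(1) by simp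
  qed
  have "traj lam a b (\<lambda>s. v (b - s))" unfolding traj_def
  proof (intro ballI conjI)
    fix s assume s: "s \<in> {a..b}"
    then have bs: "b - s \<in> {0..b - a}" by auto
    show "0 < Im (v (b - s))" using vIm[OF bs] assms(3) by simp
    have im: "(\<lambda>s. b - s) ` {a..b} = {0..b - a}" by (auto simp: image_iff intro!: bexI[of _ "b - _"])
    have "((\<lambda>s. b - s) has_vector_derivative -1) (at s within {a..b})"
      by (auto intro!: derivative_eq_intros)
    from vector_diff_chain_within[OF this, of v, unfolded im, OF v(2)[OF bs]]
    show "((\<lambda>s. v (b - s)) has_vector_derivative 2 / (v (b - s) - lam s)) (at s within {a..b})"
      unfolding o_def clamp_Im_id[OF vIm[OF bs]] by simp
  qed
  then show thesis using that v(1) by auto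
qed

text \<open>The truncated solution has speed at most 2/\<eta>, so in time \<eta>^2/4 it loses at
  most \<eta>/2 of height and the cut-off never acts. Forward existence is only local, because a
  trajectory may run into the driver.\<close>

lemma traj_ex_forward:
  assumes "a \<le> b" "continuous_on {a..b} lam" "0 < \<eta>" "2 * \<eta> \<le> Im w" "b - a \<le> \<eta>\<^sup>2 / 4"
  obtains u where "traj lam a b u" "u a = w"
proof -
  have c: "continuous_on {0..b - a} (\<lambda>t. lam (a + t))"
    by (rule continuous_on_compose2[OF assms(2)]) (auto intro!: continuous_intros)
  obtain v where v: "v 0 = w" "\<And>t. t \<in> {0..b - a} \<Longrightarrow> (v has_vector_derivative
      of_real 2 / (clamp_Im \<eta> (v t) - of_real (lam (a + t)))) (at t within {0..b - a})"
    using clamped_ode[OF _ assms(3) c, of w 2] assms(1) by auto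
  have vIm: "\<eta> \<le> Im (v t)" if t: "t \<in> {0..b - a}" for t
  proof -
    have "cmod (v t - v 0) \<le> 2 / \<eta> * \<bar>t - 0\<bar>"
    proof (rule has_vector_derivative_bound[OF v(2)])
      fix s
      show "cmod (of_real 2 / (clamp_Im \<eta> (v s) - of_real (lam (a + s)))) \<le> 2 / \<eta>"
        unfolding norm_divide using clamp_Im_norm assms(3) by (intro frac_le) auto
    qed (use t in auto)
    also have "\<dots> \<le> 2 / \<eta> * (\<eta>\<^sup>2 / 4)" using t assms by (intro mult_left_mono) auto
    also have "\<dots> = \<eta> / 2" using assms(3) by (simp add: power2_eq_square)
    finally have "\<bar>Im (v t - v 0)\<bar> \<le> \<eta> / 2" using abs_Im_le_cmod order_trans by blast
    then show ?thesis using assms(3,4) unfolding minus_complex.sel v(1) by linarith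
  qed
  have "traj lam a b (\<lambda>s. v (s - a))" unfolding traj_def
  proof (intro ballI conjI)
    fix s assume s: "s \<in> {a..b}"
    then have bs: "s - a \<in> {0..b - a}" by auto
    show "0 < Im (v (s - a))" using vIm[OF bs] assms(3) by simp
    have im: "(\<lambda>s. s - a) ` {a..b} = {0..b - a}" by (auto simp: image_iff intro!: bexI[of _ "a + _"])
    have "((\<lambda>s. s - a) has_vector_derivative 1) (at s within {a..b})"
      by (auto intro!: derivative_eq_intros)
    from vector_diff_chain_within[OF this, of v, unfolded im, OF v(2)[OF bs]]
    show "((\<lambda>s. v (s - a)) has_vector_derivative 2 / (v (s - a) - lam s)) (at s within {a..b})"
      unfolding o_def clamp_Im_id[OF vIm[OF bs]] by simp
  qed
  then show thesis using that v(1) by auto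
qed

lemma traj_quotient_cont:
  assumes "traj lam a b u" "continuous_on {a..b} lam"
  shows "continuous_on {a..b} (\<lambda>s. u s - lam s)"
  by (intro continuous_intros traj_cont[OF assms(1)] assms(2))

text \<open>The logarithmic derivative of \<open>Im u\<close> is -2/|u - lam|^2. Integrals of this
  kernel thereby become logarithms of ratios of heights.\<close>

lemma traj_ln_Im:
  assumes "traj lam a b u" "a \<le> b"
  shows "((\<lambda>s. 2 / (cmod (u s - lam s))\<^sup>2) has_integral ln (Im (u a)) - ln (Im (u b))) {a..b}"
proof -
  have "((\<lambda>s. 2 / (cmod (u s - lam s))\<^sup>2) has_integral (- ln (Im (u b))) - (- ln (Im (u a)))) {a..b}"
  proof (rule fundamental_theorem_of_calculus)
    fix s assume s: "s \<in> {a..b}"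
    note d = trajD[OF assms(1) s]
    have "((\<lambda>s. Im (u s)) has_real_derivative Im (2 / (u s - lam s))) (at s within {a..b})"
      unfolding has_real_derivative_iff_has_vector_derivative by (rule has_vector_derivative_Im[OF d(2)])
    note DERIV_minus_ln[OF this d(1)]
    moreover have "- (Im (2 / (u s - lam s)) / Im (u s)) = 2 / (cmod (u s - lam s))\<^sup>2"
      unfolding Im_two_divide using d(1) by simp
    ultimately show "((\<lambda>s. - ln (Im (u s))) has_vector_derivative 2 / (cmod (u s - lam s))\<^sup>2)
        (at s within {a..b})"
      unfolding has_real_derivative_iff_has_vector_derivative by simp
  qed fact
  then show ?thesis by simp
qed

text \<open>The derivative of (Im u)^2 is -4 (Im u)^2 / |u - lam|^2, which is at least -4. This caps
  the height that the backward flow can reach.\<close>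

lemma traj_Im_sq:
  assumes "traj lam a b u" "a \<le> b"
  shows "(Im (u a))\<^sup>2 \<le> (Im (u b))\<^sup>2 + 4 * (b - a)"
proof -
  have "(Im (u a))\<^sup>2 + 4 * a \<le> (Im (u b))\<^sup>2 + 4 * b"
  proof (rule has_vector_derivative_nonneg_mono[where g = "\<lambda>s. (Im (u s))\<^sup>2 + 4 * s"])
    fix s assume s: "s \<in> {a..b}"
    note d = trajD[OF assms(1) s]
    have "((\<lambda>s. Im (u s)) has_real_derivative Im (2 / (u s - lam s))) (at s within {a..b})"
      unfolding has_real_derivative_iff_has_vector_derivative by (rule has_vector_derivative_Im[OF d(2)])
    then have "((\<lambda>s. (Im (u s))\<^sup>2 + 4 * s) has_real_derivative
        2 * Im (u s) * Im (2 / (u s - lam s)) + 4) (at s within {a..b})"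
      by (rule DERIV_sq_linear)
    then show "((\<lambda>s. (Im (u s))\<^sup>2 + 4 * s) has_vector_derivative
        2 * Im (u s) * Im (2 / (u s - lam s)) + 4) (at s within {a..b})"
      unfolding has_real_derivative_iff_has_vector_derivative .
    have "(Im (u s))\<^sup>2 \<le> (cmod (u s - lam s))\<^sup>2" using d(1,4) by (intro power_mono) auto
    then show "0 \<le> 2 * Im (u s) * Im (2 / (u s - lam s)) + 4"
      unfolding Im_two_divide using d(3) by (simp add: field_simps power2_eq_square)
  qed fact
  then show ?thesis by simp
qed

text \<open>Both the uniqueness and the holomorphy of the flow come from this formula.\<close>

lemma traj_diff:
  assumes u: "traj lam a b u" and v: "traj lam a b v" and ab: "a \<le> b"
    and cont: "continuous_on {a..b} lam"
  shows "u a - v a = (u b - v b) *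
    exp (integral {a..b} (\<lambda>s. 2 / ((u s - lam s) * (v s - lam s))))"
proof -
  define \<psi> where "\<psi> = (\<lambda>s. 2 / ((u s - lam s) * (v s - lam s)))"
  have \<psi>c: "continuous_on {a..b} \<psi>" unfolding \<psi>_def
    using trajD(3)[OF u] trajD(3)[OF v]
    by (intro continuous_intros traj_quotient_cont u v cont) auto
  define Q where "Q = (\<lambda>s. (u s - v s) * exp (integral {a..s} \<psi>))"
  have "\<exists>c. \<forall>x\<in>{a..b}. Q x = c"
  proof (rule has_vector_derivative_zero_constant)
    fix s assume s: "s \<in> {a..b}"
    note e = has_vector_derivative_exp_integral[OF \<psi>c s]
    have "(Q has_vector_derivative (u s - v s) * (\<psi> s * exp (integral {a..s} \<psi>)) +
       (2 / (u s - lam s) - 2 / (v s - lam s)) * exp (integral {a..s} \<psi>))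
       (at s within {a..b})"
      unfolding Q_def
      by (intro has_vector_derivative_mult has_vector_derivative_diff e trajD(2)[OF u s] trajD(2)[OF v s])
    moreover have "2 / (u s - lam s) - 2 / (v s - lam s) = - \<psi> s * (u s - v s)"
      unfolding \<psi>_def using two_divide_diff[OF trajD(3)[OF u s] trajD(3)[OF v s]] by simp
    ultimately show "(Q has_vector_derivative 0) (at s within {a..b})" by simp
  qed (simp, blast)
  then have "Q a = Q b" using ab by auto
  then show ?thesis unfolding Q_def \<psi>_def by simp
qed

lemma traj_unique_backward:
  assumes "traj lam a b u" "traj lam a b v" "continuous_on {a..b} lam" "u b = v b" "s \<in> {a..b}"
  shows "u s = v s"
  using traj_diff[of lam s b u v] traj_subset[of lam a b _ s b] assms
    continuous_on_subset[OF assms(3), of "{s..b}"] by auto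

lemma traj_unique_forward:
  assumes "traj lam a b u" "traj lam a b v" "continuous_on {a..b} lam" "u a = v a" "s \<in> {a..b}"
  shows "u s = v s"
  using traj_diff[of lam a s u v] traj_subset[of lam a b _ a s] assms
    continuous_on_subset[OF assms(3), of "{a..s}"] by auto

text \<open>Bootstrap: at the first time with \<open>D \<le> c\<close>, continuity leaves only
  equality, so the weak inequality holds up to that time and \<open>step\<close> makes it strict
  there, a contradiction.\<close>

lemma continuous_barrier:
  fixes D :: "real \<Rightarrow> real"
  assumes cont: "continuous_on {a..b} D" and a: "c < D a"
    and step: "\<And>s. s \<in> {a..b} \<Longrightarrow> (\<And>r. r \<in> {a..s} \<Longrightarrow> c \<le> D r) \<Longrightarrow> c < D s"
    and s: "s \<in> {a..b}"
  shows "c < D s"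
proof (rule ccontr)
  assume "\<not> c < D s"
  define S where "S = {r \<in> {a..s}. D r \<le> c}"
  have cS: "continuous_on {a..s} D" by (rule continuous_on_subset[OF cont]) (use s in auto)
  have "closed S" unfolding S_def
    by (intro continuous_on_closed_Collect_le cS) auto
  have ne: "S \<noteq> {}" using \<open>\<not> c < D s\<close> s by (auto simp: S_def)
  have bb: "bdd_below S" by (auto simp: S_def intro: bdd_belowI[of _ a])
  define s0 where "s0 = Inf S"
  have s0: "s0 \<in> S" unfolding s0_def by (rule closed_contains_Inf) fact+
  have before: "c < D r" if "a \<le> r" "r < s0" for r
    using that s0 cInf_lower[OF _ bb, of r] by (force simp: S_def s0_def)
  have "c \<le> D s0"
  proof (rule ccontr)
    assume "\<not> c \<le> D s0"
    moreover have "continuous_on {a..s0} D"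
      by (rule continuous_on_subset[OF cS]) (use s0 in \<open>auto simp: S_def\<close>)
    ultimately obtain r where "a \<le> r" "r \<le> s0" "D r = c"
      using IVT2'[of D s0 c a] a s0 by (auto simp: S_def)
    then show False using before[of r] \<open>\<not> c \<le> D s0\<close> by (cases "r = s0") auto
  qed
  then have "c < D s0" using s0 s before
    by (intro step) (auto simp: S_def le_less)
  then show False using s0 by (auto simp: S_def)
qed

lemma traj_kernel_cont:
  assumes "traj lam a b u" "traj lam' a b v" "continuous_on {a..b} lam" "continuous_on {a..b} lam'"
  shows "continuous_on {a..b} (\<lambda>s. 2 / ((u s - lam s) * (v s - lam' s)))"
  using trajD(3)[OF assms(1)] trajD(3)[OF assms(2)]
  by (intro continuous_intros traj_quotient_cont assms) auto

lemma traj_kernel_bound: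
  assumes "traj lam a b u" "traj lam' a b v" "0 < m" "m \<le> Im (u b)" "m \<le> Im (v b)" "s \<in> {a..b}"
  shows "cmod (2 / ((u s - lam s) * (v s - lam' s))) \<le> 2 / m\<^sup>2"
proof -
  have "Im (u b) \<le> Im (u s)" "Im (v b) \<le> Im (v s)"
    using traj_Im_antimono[of _ s b] traj_subset[OF assms(1), of s b] traj_subset[OF assms(2), of s b] assms(6)
    by auto
  then have "m \<le> cmod (u s - lam s)" "m \<le> cmod (v s - lam' s)"
    using trajD(4)[OF assms(1,6)] trajD(4)[OF assms(2,6)] assms(4,5) by linarith+
  then have "m * m \<le> cmod (u s - lam s) * cmod (v s - lam' s)"
    using assms(3) by (intro mult_mono) auto
  then show ?thesis using assms(3) unfolding norm_divide norm_mult power2_eq_square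
    by (intro frac_le) auto
qed

text \<open>The bound 2/m^2 for the kernel in \<open>traj_diff\<close> gives a crude continuous
  dependence on the end point. It degenerates for small m and serves the limit of difference
  quotients in \<open>bflow_has_field_derivative\<close>.\<close>

lemma traj_close:
  assumes "traj lam a b u" "traj lam a b v" "continuous_on {a..b} lam"
    "0 < m" "m \<le> Im (u b)" "m \<le> Im (v b)" "s \<in> {a..b}"
  shows "cmod (u s - v s) \<le> cmod (u b - v b) * exp (2 / m\<^sup>2 * (b - a))"
proof -
  have t: "traj lam s b u" "traj lam s b v" using assms traj_subset[of lam a b _ s b] by auto
  have c: "continuous_on {s..b} lam" by (rule continuous_on_subset[OF assms(3)]) (use assms in auto)
  have sb: "s \<le> b" using assms(7) by simp
  let ?I = "integral {s..b} (\<lambda>s. 2 / ((u s - lam s) * (v s - lam s)))"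
  have "cmod ?I \<le> 2 / m\<^sup>2 * (b - s)"
  proof (rule integral_bound[OF sb traj_kernel_cont[OF t c c]])
    show "cmod (2 / ((u r - lam r) * (v r - lam r))) \<le> 2 / m\<^sup>2" if "r \<in> {s..b}" for r
      by (rule traj_kernel_bound[OF t assms(4-6) that])
  qed
  also have "\<dots> \<le> 2 / m\<^sup>2 * (b - a)" using assms(7) by (intro mult_left_mono) auto
  finally have "Re ?I \<le> 2 / m\<^sup>2 * (b - a)" using complex_Re_le_cmod order_trans by blast
  then have "cmod (u b - v b) * exp (Re ?I) \<le> cmod (u b - v b) * exp (2 / m\<^sup>2 * (b - a))"
    by (intro mult_left_mono) simp_all
  moreover have "cmod (u s - v s) = cmod (u b - v b) * exp (Re ?I)"
    unfolding traj_diff[OF t sb c] by (simp only: norm_mult norm_exp_eq_Re)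
  ultimately show ?thesis by (simp only:)
qed

text \<open>While the distance to the driver is at least 2M, the speed is at most 1/M, so within
  time M^2 the point moves by at most M, and the driver does the same. A distance above 4M thus
  stays above 2M, which closes the bootstrap.\<close>

lemma traj_escape:
  assumes u: "traj lam a b u" and cont: "continuous_on {a..b} lam" and M: "0 < M"
    and far: "4 * M < cmod (u a - lam a)"
    and osc: "\<And>s. s \<in> {a..b} \<Longrightarrow> \<bar>lam s - lam a\<bar> \<le> M" and short: "b - a \<le> M\<^sup>2"
    and s: "s \<in> {a..b}"
  shows "2 * M < cmod (u s - lam s)" "cmod (u s - u a) \<le> (s - a) / M"
proof -
  have move: "cmod (u s - u a) \<le> (s - a) / M"
    if "s \<in> {a..b}" "\<And>r. r \<in> {a..s} \<Longrightarrow> 2 * M \<le> cmod (u r - lam r)" for s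
  proof -
    have "cmod (u s - u a) \<le> 1 / M * \<bar>s - a\<bar>"
    proof (rule has_vector_derivative_bound)
      fix r assume r: "r \<in> {a..s}"
      show "(u has_vector_derivative 2 / (u r - lam r)) (at r within {a..s})"
        by (rule trajD(2)[OF traj_subset[OF u] r]) (use that in auto)
      show "cmod (2 / (u r - lam r)) \<le> 1 / M"
        unfolding norm_divide using frac_le[of 2 2 "2 * M" "cmod (u r - lam r)"] that(2)[OF r] M by simp
    qed (use that in auto)
    then show ?thesis using that by simp
  qed
  have *: "2 * M < cmod (u s - lam s)" if "s \<in> {a..b}" for s
  proof (rule continuous_barrier[where D = "\<lambda>s. cmod (u s - lam s)"])
    show "continuous_on {a..b} (\<lambda>s. cmod (u s - lam s))"
      by (intro continuous_intros traj_quotient_cont u cont)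
    show "2 * M < cmod (u a - lam a)" using far M by simp
    fix s assume s: "s \<in> {a..b}" and ge: "\<And>r. r \<in> {a..s} \<Longrightarrow> 2 * M \<le> cmod (u r - lam r)"
    have "(s - a) / M \<le> M" using short s M by (simp add: field_simps power2_eq_square)
    then have "cmod (u s - u a) \<le> M" using move[OF s ge] by simp
    moreover have "cmod (of_real (lam s) - of_real (lam a) :: complex) \<le> M"
      using osc[OF s] by (metis norm_of_real of_real_diff)
    moreover have "cmod (u a - lam a) \<le> cmod (u s - lam s) + cmod (u s - u a)
        + cmod (of_real (lam s) - of_real (lam a) :: complex)"
      using norm_triangle_ineq4[of "u s - lam s + (of_real (lam s) - of_real (lam a))" "u s - u a"]
        norm_triangle_ineq[of "u s - lam s" "of_real (lam s) - of_real (lam a)"] by simp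
    ultimately show "2 * M < cmod (u s - lam s)" using far by linarith
  qed fact
  show "2 * M < cmod (u s - lam s)" by (rule *[OF s])
  show "cmod (u s - u a) \<le> (s - a) / M" using s * by (intro move) (auto simp: less_imp_le)
qed

text \<open>If the point is farther than 4M from the driver at time \<open>a\<close>, then by
  \<open>traj_escape\<close> it moves by at most M, as does the driver; otherwise there is nothing
  to show. Read backwards, a short flow cannot carry a point far from the driver.\<close>

lemma traj_displacement:
  assumes u: "traj lam a b u" and cont: "continuous_on {a..b} lam" and M: "0 < M"
    and osc: "\<And>s. s \<in> {a..b} \<Longrightarrow> \<bar>lam s - lam a\<bar> \<le> M" and short: "b - a \<le> M\<^sup>2" and "a \<le> b"
  shows "cmod (u a - lam a) \<le> cmod (u b - lam b) + 4 * M"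
proof (cases "4 * M < cmod (u a - lam a)")
  case True
  have "(b - a) / M \<le> M" using short M by (simp add: field_simps power2_eq_square)
  then have "cmod (u b - u a) \<le> M"
    using traj_escape(2)[OF u cont M True osc short, of b] \<open>a \<le> b\<close> by force
  moreover have "cmod (of_real (lam b) - of_real (lam a) :: complex) \<le> M"
    using osc[of b] \<open>a \<le> b\<close> by (metis atLeastAtMost_iff norm_of_real of_real_diff order_refl)
  moreover have "cmod (u a - lam a) \<le> cmod (u b - lam b) + cmod (u b - u a)
        + cmod (of_real (lam b) - of_real (lam a) :: complex)"
    using norm_triangle_ineq4[of "u b - lam b + (of_real (lam b) - of_real (lam a))" "u b - u a"]
      norm_triangle_ineq[of "u b - lam b" "of_real (lam b) - of_real (lam a)"] by simp
  ultimately show ?thesis using M by linarith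
next
  case False
  then show ?thesis using norm_ge_zero[of "u b - lam b"] by linarith
qed

section \<open>The backward flow as a semigroup of univalent maps\<close>

text \<open>The inverse of g_b \<circ> g_a^{-1}, hence g_b^{-1} for \<open>a = 0\<close>. It is
  taken from the backward equation, which never breaks down, so that no knowledge of the hulls is
  required.\<close>

definition bflow :: "(real \<Rightarrow> real) \<Rightarrow> real \<Rightarrow> real \<Rightarrow> complex \<Rightarrow> complex" where
  "bflow lam a b w = (THE z. \<exists>u. traj lam a b u \<and> u b = w \<and> z = u a)"

locale loewner_driver =
  fixes lam :: "real \<Rightarrow> real"
  assumes cont: "continuous_on {0..1} lam"
begin

lemma cont_sub: "0 \<le> a \<Longrightarrow> b \<le> 1 \<Longrightarrow> continuous_on {a..b} lam"
  by (rule continuous_on_subset[OF cont]) auto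

lemma bflow_eq:
  assumes "traj lam a b u" "0 \<le> a" "a \<le> b" "b \<le> 1"
  shows "bflow lam a b (u b) = u a"
  unfolding bflow_def
proof (rule the_equality)
  show "\<exists>v. traj lam a b v \<and> v b = u b \<and> u a = v a" using assms(1) by blast
  fix z assume "\<exists>v. traj lam a b v \<and> v b = u b \<and> z = v a"
  then obtain v where v: "traj lam a b v" "v b = u b" "z = v a" by blast
  show "z = u a" unfolding v(3)
    by (rule traj_unique_backward[OF v(1) assms(1) cont_sub v(2)]) (use assms in auto)
qed

lemma bflow_ex:
  assumes "0 \<le> a" "a \<le> b" "b \<le> 1" "0 < Im w"
  obtains u where "traj lam a b u" "u b = w" "u a = bflow lam a b w"
proof -
  obtain u where u: "traj lam a b u" "u b = w"
    by (rule traj_ex_backward[OF assms(2) cont_sub[OF assms(1,3)] assms(4)])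
  show thesis by (rule that[OF u]) (use bflow_eq[OF u(1) assms(1-3)] in \<open>simp only: u(2)\<close>)
qed

lemma bflow_Im_ge:
  assumes "0 \<le> a" "a \<le> b" "b \<le> 1" "0 < Im w" shows "Im w \<le> Im (bflow lam a b w)"
proof -
  obtain u where "traj lam a b u" "u b = w" "u a = bflow lam a b w" using bflow_ex[OF assms] by blast
  then show ?thesis using traj_Im_antimono[OF _ assms(2), of lam u] by simp
qed

lemma bflow_Im_pos:
  assumes "0 \<le> a" "a \<le> b" "b \<le> 1" "0 < Im w" shows "0 < Im (bflow lam a b w)"
  using bflow_Im_ge[OF assms] assms(4) by simp

lemma bflow_comp:
  assumes "0 \<le> a" "a \<le> b" "b \<le> c" "c \<le> 1" "0 < Im w"
  shows "bflow lam a b (bflow lam b c w) = bflow lam a c w"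
proof -
  obtain u where u: "traj lam a c u" "u c = w" "u a = bflow lam a c w"
    using bflow_ex[of a c w] assms by auto
  have "bflow lam b c (u c) = u b" "bflow lam a b (u b) = u a"
    using assms by (auto intro!: bflow_eq traj_subset[OF u(1)])
  then show ?thesis using u by simp
qed

lemma bflow_inj:
  assumes "0 \<le> a" "a \<le> b" "b \<le> 1" shows "inj_on (bflow lam a b) upper_half_plane"
proof (rule inj_onI)
  fix w w' assume "w \<in> upper_half_plane" "w' \<in> upper_half_plane" and eq: "bflow lam a b w = bflow lam a b w'"
  then have w: "0 < Im w" "0 < Im w'" by auto
  obtain u where u: "traj lam a b u" "u b = w" "u a = bflow lam a b w"
    by (rule bflow_ex[OF assms w(1)])
  obtain v where v: "traj lam a b v" "v b = w'" "v a = bflow lam a b w'"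
    by (rule bflow_ex[OF assms w(2)])
  have "u b = v b"
    by (rule traj_unique_forward[OF u(1) v(1) cont_sub]) (use assms eq u v in auto)
  then show "w = w'" using u v by simp
qed

text \<open>By \<open>traj_diff\<close> the difference quotient is exactly \<open>exp (I z)\<close>,
  so differentiability amounts to continuity of \<open>I\<close>. The resulting formula is what
  links the hypothesis on the derivative to the integral of 2/(u - lam)^2 in the comparison of
  flows.\<close>

lemma bflow_has_field_derivative:
  assumes ab: "0 \<le> a" "a \<le> b" "b \<le> 1" and u: "traj lam a b u"
  shows "(bflow lam a b has_field_derivative
    exp (integral {a..b} (\<lambda>s. 2 / ((u s - lam s) * (u s - lam s))))) (at (u b))"
proof -
  note c = cont_sub[OF ab(1,3)]
  define w where "w = u b"
  have w: "0 < Im w" using trajD(1)[OF u, of b] ab by (simp add: w_def)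
  define m where "m = Im w / 2"
  have m: "0 < m" "m \<le> Im w" using w by (auto simp: m_def)
  have "\<forall>z. 0 < Im z \<longrightarrow> (\<exists>v. traj lam a b v \<and> v b = z \<and> v a = bflow lam a b z)"
    by (meson bflow_ex[OF ab])
  then obtain V where V: "\<And>z. 0 < Im z \<Longrightarrow> traj lam a b (V z)" "\<And>z. 0 < Im z \<Longrightarrow> V z b = z"
    "\<And>z. 0 < Im z \<Longrightarrow> V z a = bflow lam a b z" by metis
  define I where "I = (\<lambda>z. integral {a..b} (\<lambda>s. 2 / ((V z s - lam s) * (u s - lam s))))"
  define J where "J = integral {a..b} (\<lambda>s. 2 / ((u s - lam s) * (u s - lam s)))"
  have evm: "\<forall>\<^sub>F z in at w. m \<le> Im z \<and> z \<noteq> w"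
  proof -
    have "((\<lambda>z. Im z) \<longlongrightarrow> Im w) (at w)" by (intro tendsto_intros)
    then have "\<forall>\<^sub>F z in at w. m < Im z" by (rule order_tendstoD) (use w m_def in auto)
    then show ?thesis using eventually_neq_at_within[of w w UNIV] by eventually_elim auto
  qed
  define C where "C = 2 * exp (2 / m\<^sup>2 * (b - a)) / m ^ 3"
  have IJ: "cmod (I z - J) \<le> C * cmod (z - w) * (b - a)" if z: "m \<le> Im z" for z
  proof -
    have z0: "0 < Im z" using z m by simp
    note Vt = V(1)[OF z0] and Vb = V(2)[OF z0]
    have mu: "m \<le> Im (u b)" and mv: "m \<le> Im (V z b)" using m z Vb by (auto simp: w_def)
    have "I z - J = integral {a..b} (\<lambda>s. 2 / ((V z s - lam s) * (u s - lam s))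
        - 2 / ((u s - lam s) * (u s - lam s)))"
      unfolding I_def J_def
      by (intro integral_diff[symmetric] integrable_continuous_interval traj_kernel_cont u Vt c)
    also have "cmod \<dots> \<le> C * cmod (z - w) * (b - a)"
    proof (intro integral_bound ballI continuous_on_diff traj_kernel_cont u Vt c)
      fix s assume s: "s \<in> {a..b}"
      let ?A = "V z s - lam s" and ?B = "u s - lam s"
      note nz = trajD(3)[OF Vt s] trajD(3)[OF u s]
      have "2 / (?A * ?B) - 2 / (?B * ?B) = (2 / (?B * ?B)) * (u s - V z s) / ?A"
        using nz by (simp add: divide_simps)
      then have "cmod (2 / (?A * ?B) - 2 / (?B * ?B)) = cmod (2 / (?B * ?B)) * cmod (V z s - u s) / cmod ?A"
        by (simp only: norm_mult norm_divide norm_minus_commute[of "V z s" "u s"])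
      also have "\<dots> \<le> (2 / m\<^sup>2) * (cmod (z - w) * exp (2 / m\<^sup>2 * (b - a))) / m"
      proof (intro frac_le mult_mono)
        show "cmod (2 / (?B * ?B)) \<le> 2 / m\<^sup>2" by (rule traj_kernel_bound[OF u u m(1) mu mu s])
        show "cmod (V z s - u s) \<le> cmod (z - w) * exp (2 / m\<^sup>2 * (b - a))"
          using traj_close[OF Vt u c m(1) mv mu s] Vb by (simp add: w_def)
        have "Im z \<le> Im (V z s)"
          using traj_Im_antimono[OF traj_subset[OF Vt, of s b]] s Vb by auto
        then show "m \<le> cmod ?A" using trajD(4)[OF Vt s] z by linarith
      qed (use m in auto)
      also have "\<dots> = C * cmod (z - w)" unfolding C_def by (simp add: power2_eq_square power3_eq_cube)
      finally show "cmod (2 / (?A * ?B) - 2 / (?B * ?B)) \<le> C * cmod (z - w)" .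
    qed (use ab in auto)
    finally show ?thesis .
  qed
  have "(I \<longlongrightarrow> J) (at w)"
  proof (rule Lim_transform)
    show "((\<lambda>z. J) \<longlongrightarrow> J) (at w)" by simp
    have "((\<lambda>z. C * cmod (z - w) * (b - a)) \<longlongrightarrow> C * cmod (w - w) * (b - a)) (at w)"
      by (intro tendsto_intros)
    then have "((\<lambda>z. C * cmod (z - w) * (b - a)) \<longlongrightarrow> 0) (at w)" by simp
    moreover have "\<forall>\<^sub>F z in at w. norm (I z - J) \<le> C * cmod (z - w) * (b - a)"
      using evm by eventually_elim (use IJ in auto)
    ultimately show "((\<lambda>z. I z - J) \<longlongrightarrow> 0) (at w)" by (rule Lim_null_comparison[rotated])
  qed
  then have "((\<lambda>z. exp (I z)) \<longlongrightarrow> exp J) (at w)" by (rule tendsto_exp)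
  moreover have "\<forall>\<^sub>F z in at w. exp (I z) = (bflow lam a b z - bflow lam a b w) / (z - w)"
    using evm
  proof eventually_elim
    case (elim z)
    then have z0: "0 < Im z" using m by auto
    have "bflow lam a b z - bflow lam a b w = (z - w) * exp (I z)"
      using traj_diff[OF V(1)[OF z0] u ab(2) c] V(2,3)[OF z0] bflow_eq[OF u ab]
      by (simp add: I_def w_def)
    then show ?case using elim by simp
  qed
  ultimately have "((\<lambda>z. (bflow lam a b z - bflow lam a b w) / (z - w)) \<longlongrightarrow> exp J) (at w)"
    by (rule Lim_transform_eventually)
  then show ?thesis unfolding has_field_derivative_iff w_def J_def .
qed

lemma bflow_holomorphic:
  assumes "0 \<le> a" "a \<le> b" "b \<le> 1" shows "bflow lam a b holomorphic_on upper_half_plane"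
proof -
  note open_upper_half_plane
  moreover have "bflow lam a b field_differentiable at w" if w: "0 < Im w" for w
  proof -
    obtain u where u: "traj lam a b u" "u b = w" using bflow_ex[OF assms w] by blast
    show ?thesis using bflow_has_field_derivative[OF assms u(1)]
      unfolding u(2) field_differentiable_def by blast
  qed
  ultimately show ?thesis by (simp add: holomorphic_on_open field_differentiable_def)
qed

lemma bflow_deriv:
  assumes "0 \<le> a" "a \<le> b" "b \<le> 1" and "traj lam a b u"
  shows "deriv (bflow lam a b) (u b) =
    exp (integral {a..b} (\<lambda>s. 2 / ((u s - lam s) * (u s - lam s))))"
  using bflow_has_field_derivative[OF assms] by (rule DERIV_imp_deriv)

text \<open>Differentiability of a glued function at \<open>b\<close> is avoided: the joined
  trajectory is the backward solution from \<open>v c\<close>, and the semigroup property identifies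
  its value at \<open>a\<close>.\<close>

lemma traj_join:
  assumes "traj lam a b u" "traj lam b c v" "v b = u b" "0 \<le> a" "a \<le> b" "b \<le> c" "c \<le> 1"
  obtains u' where "traj lam a c u'" "u' a = u a" "u' c = v c"
proof -
  have "0 < Im (v c)" using trajD(1)[OF assms(2), of c] assms by auto
  then obtain u' where u': "traj lam a c u'" "u' c = v c" "u' a = bflow lam a c (v c)"
    using bflow_ex[of a c "v c"] assms by auto
  have "bflow lam a c (v c) = bflow lam a b (bflow lam b c (v c))"
    using bflow_comp[of a b c "v c"] assms \<open>0 < Im (v c)\<close> by simp
  also have "\<dots> = u a" using bflow_eq[OF assms(2)] bflow_eq[OF assms(1)] assms by simp
  finally show thesis using that u' by simp
qed

text \<open>A point that starts far from the driver keeps distance 2M by \<open>traj_escape\<close>,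
  so by \<open>traj_ln_Im\<close> the logarithm of its height drops by at most 1/2. Hence every
  continuation by \<open>traj_ex_forward\<close> gains a fixed time \<tau>, up to
  \<open>b\<close>.\<close>

lemma traj_ex_escape:
  assumes ab: "0 \<le> a" "a \<le> b" "b \<le> 1" and w: "0 < Im w" and M: "0 < M"
    and far: "4 * M < cmod (w - lam a)"
    and osc: "\<And>s. s \<in> {a..b} \<Longrightarrow> \<bar>lam s - lam a\<bar> \<le> M" and short: "b - a \<le> M\<^sup>2"
  obtains u where "traj lam a b u" "u a = w"
proof -
  define S where "S = {r \<in> {a..b}. \<exists>u. traj lam a r u \<and> u a = w}"
  \<comment> \<open>Half of the lower bound \<open>Im w * exp (-1/2)\<close> for the height, since
    \<open>traj_ex_forward\<close> asks for twice the cut-off.\<close>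
  define \<eta> where "\<eta> = Im w * exp (-1/2) / 2"
  have \<eta>: "0 < \<eta>" using w by (simp add: \<eta>_def)
  have high: "2 * \<eta> \<le> Im (u r)" if u: "traj lam a r u" "u a = w" and r: "r \<in> {a..b}" for u r
  proof -
    have c: "continuous_on {a..r} lam" using ab r by (intro cont_sub) auto
    have esc: "2 * M < cmod (u s - lam s)" if "s \<in> {a..r}" for s
      using that r far osc short by (intro traj_escape(1)[OF u(1) c M]) (auto simp: u)
    have int: "((\<lambda>s. 2 / (cmod (u s - lam s))\<^sup>2) has_integral ln (Im w) - ln (Im (u r))) {a..r}"
      using traj_ln_Im[OF u(1)] r u(2) by simp
    have "norm (ln (Im w) - ln (Im (u r))) \<le> 1 / (2 * M\<^sup>2) * measure lborel (cbox a r)"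
    proof (rule has_integral_bound)
      fix s assume "s \<in> cbox a r"
      then have "(2 * M)\<^sup>2 \<le> (cmod (u s - lam s))\<^sup>2" using esc[of s] M by (intro power_mono) auto
      then show "norm (2 / (cmod (u s - lam s))\<^sup>2) \<le> 1 / (2 * M\<^sup>2)"
        using frac_le[of 2 2 "4 * M\<^sup>2" "(cmod (u s - lam s))\<^sup>2"] M
        by (simp add: power_mult_distrib)
    qed (use int in auto)
    also have "\<dots> = (r - a) / (2 * M\<^sup>2)" using r by simp
    also have "\<dots> \<le> M\<^sup>2 / (2 * M\<^sup>2)" using short r by (intro divide_right_mono) auto
    also have "\<dots> = 1/2" using M by simp
    finally have "ln (Im w) - 1/2 \<le> ln (Im (u r))"
      unfolding real_norm_def by linarith
    moreover have "0 < Im (u r)" using trajD(1)[OF u(1), of r] r by auto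
    ultimately have "exp (ln (Im w) - 1/2) \<le> Im (u r)" by (metis exp_le_cancel_iff exp_ln)
    moreover have "exp (ln (Im w) - 1/2) = Im w * exp (-1/2)"
      using exp_add[of "ln (Im w)" "-1/2"] w by simp
    ultimately show ?thesis unfolding \<eta>_def by simp
  qed
  define \<tau> where "\<tau> = \<eta>\<^sup>2 / 4"
  have \<tau>: "0 < \<tau>" using \<eta> by (simp add: \<tau>_def)
  have "traj lam a a (\<lambda>_. w)" using w by (auto simp: traj_def has_vector_derivative_def has_derivative_within_singleton_iff bounded_linear_scaleR_left)
  then have aS: "a \<in> S" using ab by (auto simp: S_def)
  have bdd: "bdd_above S" by (auto simp: S_def intro: bdd_aboveI[of _ b])
  have "Sup S - \<tau> < Sup S" using \<tau> by simp
  then obtain r where r: "r \<in> S" "Sup S - \<tau> < r" using less_cSupD[of S] aS by blast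
  then obtain u where u: "traj lam a r u" "u a = w" and rab: "r \<in> {a..b}" by (auto simp: S_def)
  define r' where "r' = min b (r + \<tau>)"
  have r': "r \<le> r'" "r' \<le> b" "r' - r \<le> \<tau>" using rab \<tau> by (auto simp: r'_def)
  obtain v where v: "traj lam r r' v" "v r = u r"
  proof (rule traj_ex_forward[of r r' lam \<eta> "u r"])
    show "continuous_on {r..r'} lam" using ab rab r' by (intro cont_sub) auto
    show "2 * \<eta> \<le> Im (u r)" by (rule high[OF u rab])
  qed (use r' \<eta> \<tau>_def in auto)
  obtain u' where u': "traj lam a r' u'" "u' a = u a"
    using traj_join[OF u(1) v] ab rab r' by auto
  then have "r' \<in> S" using u(2) r' rab by (auto simp: S_def)
  then have "r' \<le> Sup S" using cSup_upper[OF _ bdd] by blast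
  then have "r' = b" using r(2) by (auto simp: r'_def min_def split: if_splits)
  then show thesis using u' u that by auto
qed

end

section \<open>Hulls\<close>

text \<open>Only positivity of the height has to be added: multiplied by the exponential of its
  integrated decay rate, the height is the constant \<open>Im z\<close>. The time \<open>r\<close>
  stays below \<open>T\<close> because the flow may end on the driver at \<open>T\<close>.\<close>

lemma flow_traj:
  assumes flow: "loewner_flow lam z T u" and z: "0 < Im z" and r: "0 \<le> r" "r < T"
    and cont: "continuous_on {0..T} lam"
  shows "traj lam 0 r u"
proof -
  have ne: "u s - lam s \<noteq> 0" if "s \<in> {0..r}" for s
    using flow that r by (auto simp: loewner_flow_def)
  have der: "(u has_vector_derivative 2 / (u s - lam s)) (at s within {0..r})" if s: "s \<in> {0..r}" for s
    by (rule has_vector_derivative_within_subset[of _ _ _ "{0..T}"])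
      (use flow s r in \<open>auto simp: loewner_flow_def\<close>)
  have uc: "continuous_on {0..r} u" by (rule continuous_on_vector_derivative[OF der])
  have lc: "continuous_on {0..r} lam" by (rule continuous_on_subset[OF cont]) (use r in auto)
  define k where "k = (\<lambda>s. 2 / (cmod (u s - lam s))\<^sup>2)"
  have kc: "continuous_on {0..r} k" unfolding k_def
    using ne by (intro continuous_intros uc lc) auto
  define Q where "Q = (\<lambda>s. Im (u s) * exp (integral {0..s} k))"
  have const: "\<exists>c. \<forall>s\<in>{0..r}. Q s = c"
  proof (rule has_vector_derivative_zero_constant)
    fix s assume s: "s \<in> {0..r}"
    have "((\<lambda>s. integral {0..s} k) has_real_derivative k s) (at s within {0..r})"
      unfolding has_real_derivative_iff_has_vector_derivative
      by (rule integral_has_vector_derivative[OF kc s])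
    moreover have "((\<lambda>s. Im (u s)) has_real_derivative - k s * Im (u s)) (at s within {0..r})"
      using has_vector_derivative_Im[OF der[OF s]]
      unfolding has_real_derivative_iff_has_vector_derivative Im_two_divide by (simp add: k_def)
    moreover have "((\<lambda>s. Y s * exp (J s)) has_real_derivative 0) (at s within {0..r})"
      if "(J has_real_derivative k s) (at s within {0..r})"
        "(Y has_real_derivative - k s * Y s) (at s within {0..r})" for J Y
      using that by (auto intro!: derivative_eq_intros)
    ultimately show "(Q has_vector_derivative 0) (at s within {0..r})"
      unfolding Q_def has_real_derivative_iff_has_vector_derivative[symmetric] by blast
  qed (simp, blast)
  have "0 < Im (u s)" if s: "s \<in> {0..r}" for s
  proof -
    have "Q s = Q 0" using const s r by auto
    moreover have "Q 0 = Im z" using flow by (simp add: Q_def loewner_flow_def)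
    ultimately have "0 < Im (u s) * exp (integral {0..s} k)" using z by (simp add: Q_def)
    then show ?thesis by (simp add: zero_less_mult_iff)
  qed
  then show ?thesis unfolding traj_def using der by blast
qed

context loewner_driver
begin

text \<open>Before \<open>T\<close> this is uniqueness of trajectories; at \<open>T\<close> itself,
  where \<open>loewner_flow\<close> demands no equation, it follows from continuity.\<close>

lemma flow_eq_traj:
  assumes flow: "loewner_flow lam z T u" and T: "0 \<le> T" "T \<le> t" and t: "t \<le> 1"
    and v: "traj lam 0 t v" "v 0 = z" and s: "s \<in> {0..T}"
  shows "u s = v s"
proof -
  have z: "0 < Im z" using trajD(1)[OF v(1), of 0] v(2) T by auto
  have eq: "u r = v r" if r: "0 \<le> r" "r < T" for r
  proof -
    have c: "continuous_on {0..T} lam" using T t by (intro cont_sub) auto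
    have "u 0 = v 0" using flow v(2) by (simp add: loewner_flow_def)
    then show ?thesis
      using traj_unique_forward[OF flow_traj[OF flow z r c] traj_subset[OF v(1), of 0 r] cont_sub, of r] r T t
      by auto
  qed
  show ?thesis
  proof (cases "T = 0")
    case True
    then show ?thesis using s flow v(2) by (simp add: loewner_flow_def)
  next
    case False
    have c: "continuous_on {0..T} (\<lambda>s. u s - v s)"
      using flow traj_cont[OF traj_subset[OF v(1), of 0 T]] T
      by (intro continuous_intros) (auto simp: loewner_flow_def)
    have "closed {s \<in> {0..T}. u s - v s = 0}"
      by (rule continuous_closed_preimage_constant[OF c]) auto
    then have "closure {0..<T} \<subseteq> {s \<in> {0..T}. u s - v s = 0}"
      by (intro closure_minimal) (auto simp: eq)
    then show ?thesis using s False T by (auto simp: subset_iff)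
  qed
qed

lemma traj_is_flow: "traj lam 0 t v \<Longrightarrow> loewner_flow lam (v 0) t v"
  using traj_cont trajD by (auto simp: loewner_flow_def)

lemma loewner_map_eq:
  assumes "traj lam 0 t v" "0 \<le> t" "t \<le> 1"
  shows "loewner_map lam t (v 0) = v t"
  unfolding loewner_map_def
proof (rule the_equality)
  show "\<exists>u. loewner_flow lam (v 0) t u \<and> v t = u t" using traj_is_flow[OF assms(1)] by blast
  fix w assume "\<exists>u. loewner_flow lam (v 0) t u \<and> w = u t"
  then obtain u where "loewner_flow lam (v 0) t u" "w = u t" by blast
  then show "w = v t" using flow_eq_traj[OF _ assms(2) order_refl assms(3,1) refl, of u t] assms by simp
qed

lemma traj_extend:
  assumes "traj lam 0 t v" "0 \<le> t" "t < 1"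
  obtains t' v' where "t < t'" "t' \<le> 1" "traj lam 0 t' v'" "v' 0 = v 0"
proof -
  define \<eta> where "\<eta> = Im (v t) / 2"
  have \<eta>: "0 < \<eta>" using trajD(1)[OF assms(1), of t] assms by (simp add: \<eta>_def)
  define t' where "t' = min 1 (t + \<eta>\<^sup>2 / 4)"
  have "t' \<le> t + \<eta>\<^sup>2 / 4" unfolding t'_def by (rule min.cobounded2)
  moreover have "t < t'" using assms \<eta> by (simp add: t'_def)
  moreover have "t' \<le> 1" by (simp add: t'_def)
  ultimately have t': "t < t'" "t' \<le> 1" "t' - t \<le> \<eta>\<^sup>2 / 4" by simp_all
  have c: "continuous_on {t..t'} lam" using t' assms by (intro cont_sub) auto
  have "2 * \<eta> \<le> Im (v t)" by (simp add: \<eta>_def)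
  then obtain x where x: "traj lam t t' x" "x t = v t"
    by (rule traj_ex_forward[OF less_imp_le[OF t'(1)] c \<eta> _ t'(3)])
  obtain v' where "traj lam 0 t' v'" "v' 0 = v 0"
    using traj_join[OF assms(1) x] t' assms by auto
  then show thesis by (rule that[OF t'(1,2)])
qed

lemma traj_no_hit:
  assumes "traj lam 0 t v" "t \<le> 1" "loewner_flow lam (v 0) s u" "0 \<le> s" "s \<le> t"
  shows "u s \<noteq> of_real (lam s)"
proof -
  have "u s = v s" by (rule flow_eq_traj[OF assms(3-5,2,1)]) (use assms in auto)
  then show ?thesis using trajD(3)[OF assms(1), of s] assms by auto
qed

text \<open>Hulls are defined by a weak inequality, so a strict one is needed here; it comes from a
  trajectory on a slightly longer interval. For \<open>t = 1\<close> no hitting time is left in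
  [0,1], and the infimum of the empty set is infinite.\<close>

lemma traj_not_swallowed:
  assumes "traj lam 0 t v" "0 \<le> t" "t \<le> 1"
  shows "ereal t < swallowing_time lam (v 0)"
proof (cases "t = 1")
  case True
  have *: "{ereal s | s. s \<in> {0..1} \<and> (\<exists>u. loewner_flow lam (v 0) s u \<and> u s = of_real (lam s))} = {}"
    using traj_no_hit[OF assms(1,3)] True by auto
  show ?thesis unfolding swallowing_time_def * by (simp add: top_ereal_def)
next
  case False
  then obtain t' v' where t': "t < t'" "t' \<le> 1" and v': "traj lam 0 t' v'" "v' 0 = v 0"
    using traj_extend[OF assms(1,2)] assms by auto
  have "ereal t' \<le> swallowing_time lam (v 0)" unfolding swallowing_time_def
  proof (rule Inf_greatest)
    fix x assume "x \<in> {ereal s | s. s \<in> {0..1} \<and> (\<exists>u. loewner_flow lam (v 0) s u \<and> u s = of_real (lam s))}"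
    then obtain s u where s: "x = ereal s" "s \<in> {0..1}" "loewner_flow lam (v 0) s u" "u s = of_real (lam s)"
      by blast
    then have "\<not> s \<le> t'" using traj_no_hit[OF v'(1) t'(2), of s u] v'(2) by auto
    then show "ereal t' \<le> x" using s by simp
  qed
  moreover have "ereal t < ereal t'" using t' by simp
  ultimately show ?thesis by (rule less_le_trans[rotated])
qed

text \<open>Otherwise let T be the supremum of the existence times. It is not attained, and by
  \<open>traj_ex_escape\<close> the trajectory cannot be away from the driver shortly before T, so
  it tends to lam(T). With this end value it becomes a flow that hits the driver at T \<le>
  t.\<close>

lemma unswallowed_traj:
  assumes z: "0 < Im z" and t: "0 \<le> t" "t \<le> 1" and uns: "ereal t < swallowing_time lam z"
  shows "\<exists>v. traj lam 0 t v \<and> v 0 = z"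
proof (rule ccontr)
  assume no: "\<nexists>v. traj lam 0 t v \<and> v 0 = z"
  define S where "S = {r \<in> {0..t}. \<exists>v. traj lam 0 r v \<and> v 0 = z}"
  have "traj lam 0 0 (\<lambda>_. z)"
    using z by (auto simp: traj_def has_vector_derivative_def has_derivative_within_singleton_iff bounded_linear_scaleR_left)
  then have S0: "0 \<in> S" using t by (auto simp: S_def)
  have bdd: "bdd_above S" by (auto simp: S_def intro: bdd_aboveI[of _ t])
  define T where "T = Sup S"
  have "0 \<le> T" unfolding T_def by (rule cSup_upper[OF S0 bdd])
  moreover have "T \<le> t" unfolding T_def by (rule cSup_least) (use S0 in blast, simp add: S_def)
  ultimately have T: "0 \<le> T" "T \<le> t" .
  have down: "r \<in> S" if down_prems: "r' \<in> S" "0 \<le> r" "r \<le> r'" for r r'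
  proof -
    obtain v where v: "traj lam 0 r' v" "v 0 = z" and r': "r' \<le> t" using down_prems(1) by (auto simp: S_def)
    have "traj lam 0 r v" by (rule traj_subset[OF v(1) order_refl down_prems(3)])
    then show ?thesis using v(2) r' down_prems by (auto simp: S_def)
  qed
  have TS: "T \<notin> S"
  proof
    assume "T \<in> S"
    then obtain v where v: "traj lam 0 T v" "v 0 = z" by (auto simp: S_def)
    then have "T \<noteq> t" using no by auto
    then obtain t' v' where t': "T < t'" "t' \<le> 1" and v': "traj lam 0 t' v'" "v' 0 = z"
      using traj_extend[OF v(1)] T t v(2) by auto
    have "traj lam 0 (min t' t) v'" by (rule traj_subset[OF v'(1)]) auto
    then have "min t' t \<in> S" using v'(2) t' t T by (auto simp: S_def)
    then have "min t' t \<le> T" unfolding T_def by (rule cSup_upper[OF _ bdd])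
    then show False using t' T \<open>T \<noteq> t\<close> by simp
  qed
  have below: "r \<in> S" if r: "0 \<le> r" "r < T" for r
  proof -
    obtain r' where "r' \<in> S" "r < r'" using less_cSupD[of S r] S0 r unfolding T_def by blast
    then show ?thesis using down r by simp
  qed
  then have "\<forall>r. 0 \<le> r \<and> r < T \<longrightarrow> (\<exists>v. traj lam 0 r v \<and> v 0 = z)" by (auto simp: S_def)
  then obtain V where V: "\<And>r. 0 \<le> r \<Longrightarrow> r < T \<Longrightarrow> traj lam 0 r (V r)" "\<And>r. 0 \<le> r \<Longrightarrow> r < T \<Longrightarrow> V r 0 = z"
    by metis
  have Tpos: "0 < T" using S0 TS T by (cases "T = 0") auto
  have Vs: "V r s = V s s" if "0 \<le> s" "s \<le> r" "r < T" for r s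
  proof (rule traj_unique_forward[where u = "V r" and v = "V s" and a = 0 and b = s and lam = lam])
    show "traj lam 0 s (V r)" by (rule traj_subset[OF V(1)[of r]]) (use that in auto)
    show "traj lam 0 s (V s)" by (rule V(1)) (use that in auto)
    show "continuous_on {0..s} lam" by (rule cont_sub) (use that T t in auto)
    have "V r 0 = z" "V s 0 = z" using that by (auto intro!: V(2))
    then show "V r 0 = V s 0" by simp
  qed (use that in auto)
  \<comment> \<open>By uniqueness the trajectories \<open>V r\<close> agree where they overlap, so
    the diagonal is one trajectory on [0,T); the value at T is the limit still to be proved.\<close>
  define u where "u = (\<lambda>s. if s < T then V s s else of_real (lam T))"
  \<comment> \<open>Otherwise \<open>traj_ex_escape\<close> would continue the trajectory up to
    T.\<close>
  have near: "cmod (V r r - lam r) \<le> 4 * M"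
    if r: "0 \<le> r" "r < T" and M: "0 < M" "\<And>s. s \<in> {r..T} \<Longrightarrow> \<bar>lam s - lam r\<bar> \<le> M" "T - r \<le> M\<^sup>2" for r M
  proof (rule ccontr)
    assume "\<not> cmod (V r r - lam r) \<le> 4 * M"
    then have far: "4 * M < cmod (V r r - lam r)" by simp
    have "0 < Im (V r r)" using trajD(1)[OF V(1)[OF r], of r] r by auto
    then obtain x where x: "traj lam r T x" "x r = V r r"
      using traj_ex_escape[OF r(1) _ _ _ M(1) far M(2,3)] r T t by auto
    then obtain v where "traj lam 0 T v" "v 0 = V r 0"
      using traj_join[OF V(1)[OF r] x] r T t by auto
    then show False using TS V(2)[OF r] T by (auto simp: S_def)
  qed
  have flow: "loewner_flow lam z T u" unfolding loewner_flow_def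
  proof (intro conjI ballI)
    show "u 0 = z" using Tpos V(2)[of 0] by (simp add: u_def)
    have der: "u s \<noteq> of_real (lam s) \<and> (u has_vector_derivative 2 / (u s - lam s)) (at s within {0..T})"
      if s: "s \<in> {0..<T}" for s
    proof -
      obtain r where r: "s < r" "r < T" using s dense by auto
      have d: "u s = V r s" using Vs[of s r] s r by (simp add: u_def)
      note Vr = trajD[OF V(1)[of r], of s]
      have "(V r has_vector_derivative 2 / (V r s - lam s)) (at s within {0..r})"
        using Vr(2) s r by simp
      then have "(u has_vector_derivative 2 / (V r s - lam s)) (at s within {0..r})"
      proof (rule has_vector_derivative_transform[rotated 2])
        show "s \<in> {0..r}" using s r by simp
        fix x assume x: "x \<in> {0..r}"
        have "V r x = V x x" by (rule Vs) (use x r in auto)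
        then show "u x = V r x" using x r by (simp add: u_def)
      qed
      moreover have "at s within {0..r} = at s within {0..T}"
        by (rule at_within_nhd[of s "{..<r}"]) (use s r in auto)
      ultimately show ?thesis using Vr(3) s r d by auto
    qed
    then show "u s \<noteq> of_real (lam s)"
      "(u has_vector_derivative 2 / (u s - lam s)) (at s within {0..T})" if "s \<in> {0..<T}" for s
      using that by auto
    show "continuous_on {0..T} u" unfolding continuous_on_eq_continuous_within
    proof
      fix s assume s: "s \<in> {0..T}"
      show "continuous (at s within {0..T}) u"
      proof (cases "s < T")
        case True
        then show ?thesis using der[of s] s by (auto intro: has_vector_derivative_continuous)
      next
        case False
        then have sT: "s = T" using s by simp
        show ?thesis unfolding continuous_within_eps_delta
        proof (intro allI impI)
          fix e :: real assume e: "0 < e"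
          \<comment> \<open>The fact \<open>near\<close> with radius \<open>2 * \<epsilon>\<close>
            costs 8 \<epsilon> and the driver one more, so 9 \<epsilon> in all.\<close>
          define \<epsilon> where "\<epsilon> = e / 10"
          have \<epsilon>: "0 < \<epsilon>" using e by (simp add: \<epsilon>_def)
          have "continuous_on {0..T} lam" using T t by (intro cont_sub) auto
          then obtain d where d: "0 < d" "\<And>r. r \<in> {0..T} \<Longrightarrow> dist r T < d \<Longrightarrow> dist (lam r) (lam T) < \<epsilon>"
            using T \<epsilon> unfolding continuous_on_iff by (metis atLeastAtMost_iff order_refl)
          show "\<exists>d>0. \<forall>x'\<in>{0..T}. dist x' s < d \<longrightarrow> dist (u x') (u s) < e"
          proof (intro exI[of _ "min d (\<epsilon>\<^sup>2)"] conjI ballI impI)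
            show "0 < min d (\<epsilon>\<^sup>2)" using d \<epsilon> by simp
            fix r assume r: "r \<in> {0..T}" "dist r s < min d (\<epsilon>\<^sup>2)"
            show "dist (u r) (u s) < e"
            proof (cases "r < T")
              case True
              have "cmod (V r r - lam r) \<le> 4 * (2 * \<epsilon>)"
              proof (rule near)
                fix q assume q: "q \<in> {r..T}"
                have "dist (lam q) (lam T) < \<epsilon>"
                  by (rule d(2)) (use q r sT in \<open>auto simp: dist_real_def\<close>)
                moreover have "dist (lam r) (lam T) < \<epsilon>"
                  by (rule d(2)) (use q r sT in \<open>auto simp: dist_real_def\<close>)
                ultimately show "\<bar>lam q - lam r\<bar> \<le> 2 * \<epsilon>" unfolding dist_real_def by linarith
              next
                have "0 \<le> \<epsilon>\<^sup>2" by simp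
                then show "T - r \<le> (2 * \<epsilon>)\<^sup>2" using r sT True by (simp add: dist_real_def power_mult_distrib)
              qed (use r True \<epsilon> in auto)
              moreover have "cmod (of_real (lam r) - of_real (lam T) :: complex) < \<epsilon>"
                using d(2)[OF r(1)] r sT unfolding of_real_diff[symmetric] norm_of_real by (simp add: dist_real_def)
              ultimately have "cmod (V r r - lam T) < 9 * \<epsilon>"
                using norm_triangle_ineq[of "V r r - lam r" "of_real (lam r) - of_real (lam T)"] by simp
              then show ?thesis using True sT \<epsilon> by (simp add: u_def dist_norm \<epsilon>_def)
            qed (use r e sT in \<open>simp add: u_def\<close>)
          qed
        qed
      qed
    qed
  qed
  have "u T = of_real (lam T)" by (simp add: u_def)
  then have "swallowing_time lam z \<le> ereal T" unfolding swallowing_time_def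
    using flow T t by (intro Inf_lower) auto
  also have "\<dots> \<le> ereal t" using T by simp
  finally show False using uns by simp
qed

text \<open>The inclusions are \<open>unswallowed_traj\<close> and
  \<open>traj_not_swallowed\<close>. Afterwards the domains are handled as ranges of univalent maps
  instead of through swallowing times.\<close>

lemma loewner_domain_eq:
  assumes "0 \<le> t" "t \<le> 1"
  shows "loewner_domain lam t = bflow lam 0 t ` upper_half_plane"
proof
  show "loewner_domain lam t \<subseteq> bflow lam 0 t ` upper_half_plane"
  proof
    fix z assume "z \<in> loewner_domain lam t"
    then have "0 < Im z" "ereal t < swallowing_time lam z"
      by (auto simp: loewner_domain_def loewner_hull_def)
    then obtain v where v: "traj lam 0 t v" "v 0 = z" using unswallowed_traj assms by blast
    then have "z = bflow lam 0 t (v t)" "v t \<in> upper_half_plane"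
      using bflow_eq[OF v(1)] trajD(1)[OF v(1), of t] assms by auto
    then show "z \<in> bflow lam 0 t ` upper_half_plane" by blast
  qed
  show "bflow lam 0 t ` upper_half_plane \<subseteq> loewner_domain lam t"
  proof clarify
    fix w assume w: "0 < Im w"
    then obtain v where v: "traj lam 0 t v" "v t = w" "v 0 = bflow lam 0 t w"
      using bflow_ex[of 0 t w] assms by auto
    have "0 < Im (v 0)" using trajD(1)[OF v(1), of 0] assms by auto
    then show "bflow lam 0 t w \<in> loewner_domain lam t"
      using traj_not_swallowed[OF v(1) assms] v(3) by (auto simp: loewner_domain_def loewner_hull_def)
  qed
qed

lemma loewner_map_bflow:
  assumes "0 \<le> t" "t \<le> 1" "0 < Im w"
  shows "loewner_map lam t (bflow lam 0 t w) = w"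
proof -
  obtain v where v: "traj lam 0 t v" "v t = w" "v 0 = bflow lam 0 t w"
    using bflow_ex[of 0 t w] assms by auto
  show ?thesis using loewner_map_eq[OF v(1) assms(1,2)] v(2,3) by simp
qed

lemma loewner_fhat_eq:
  assumes "0 \<le> t" "t \<le> 1" "0 < Im z"
  shows "loewner_fhat lam t z = bflow lam 0 t (of_real (lam t) + z)"
  unfolding loewner_fhat_def
proof (rule inv_into_f_eq)
  show "inj_on (loewner_map lam t) (loewner_domain lam t)"
    unfolding loewner_domain_eq[OF assms(1,2)]
    by (rule inj_onI) (auto simp: loewner_map_bflow[OF assms(1,2)])
  show "bflow lam 0 t (of_real (lam t) + z) \<in> loewner_domain lam t"
    unfolding loewner_domain_eq[OF assms(1,2)] using assms(3) by auto
  show "loewner_map lam t (bflow lam 0 t (of_real (lam t) + z)) = of_real (lam t) + z"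
    by (rule loewner_map_bflow[OF assms(1,2)]) (use assms(3) in simp)
qed

lemma deriv_loewner_fhat:
  assumes "0 \<le> t" "t \<le> 1" "0 < y"
  shows "deriv (loewner_fhat lam t) (\<i> * of_real y) = deriv (bflow lam 0 t) (Complex (lam t) y)"
proof -
  have c: "of_real (lam t) + \<i> * of_real y = Complex (lam t) y" by (simp add: Complex_eq)
  have "(bflow lam 0 t has_field_derivative deriv (bflow lam 0 t) (Complex (lam t) y))
      (at (of_real (lam t) + \<i> * of_real y))"
    unfolding c using holomorphic_derivI[OF bflow_holomorphic open_upper_half_plane, of 0 t "Complex (lam t) y"] assms by simp
  then have "((\<lambda>z. bflow lam 0 t (of_real (lam t) + z)) has_field_derivative
      deriv (bflow lam 0 t) (Complex (lam t) y) * 1) (at (\<i> * of_real y))"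
    by (rule DERIV_chain2) (auto intro!: derivative_eq_intros)
  then have "(loewner_fhat lam t has_field_derivative deriv (bflow lam 0 t) (Complex (lam t) y) * 1) (at (\<i> * of_real y))"
    by (rule has_field_derivative_transform_within_open[OF _ open_upper_half_plane])
      (use assms in \<open>auto simp: loewner_fhat_eq\<close>)
  then show ?thesis by (simp add: DERIV_imp_deriv)
qed

end

text \<open>A Julia--Wolff type estimate, from the maximum principle for \<open>exp (\<i>(g(w) - w))\<close>.\<close>

lemma Im_ge_of_hydrodynamic:
  assumes hol: "g holomorphic_on {w. h < Im w}" and pos: "\<And>w. h < Im w \<Longrightarrow> 0 < Im (g w)"
    and far: "\<And>e. 0 < e \<Longrightarrow> \<exists>\<rho>. \<forall>w. h < Im w \<and> \<rho> \<le> cmod (w - p) \<longrightarrow> cmod (g w - w) \<le> e"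
    and h: "0 \<le> h" and w: "h < Im w"
  shows "Im w - h \<le> Im (g w)"
proof (rule field_le_epsilon)
  fix e :: real assume e: "0 < e"
  \<comment> \<open>The line Im = h is raised by \<open>d\<close> because \<open>g\<close> comes
    without boundary values on it. The same margin absorbs |g(w) - w| on the far arc.\<close>
  define d where "d = min e ((Im w - h) / 2)"
  have d: "0 < d" "d \<le> e" "h + d < Im w" using e w unfolding d_def min_def by (auto simp: field_simps)
  obtain \<rho>0 where \<rho>0: "\<And>w. h < Im w \<Longrightarrow> \<rho>0 \<le> cmod (w - p) \<Longrightarrow> cmod (g w - w) \<le> d"
    using far[OF d(1)] by blast
  define \<rho> where "\<rho> = max \<rho>0 (cmod (w - p) + 1)"
  define S where "S = {w. h + d < Im w} \<inter> ball p \<rho>"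
  define E where "E = (\<lambda>w. exp (\<i> * (g w - w)))"
  have normE: "cmod (E w) = exp (Im w - Im (g w))" for w by (simp add: E_def norm_exp_eq_Re)
  have opS: "open S" unfolding S_def by (intro open_Int open_halfspace_Im_gt open_ball)
  have clS: "closure S \<subseteq> {w. h + d \<le> Im w} \<inter> cball p \<rho>"
    by (rule closure_minimal) (auto simp: S_def intro!: closed_Int closed_halfspace_Im_ge)
  have holE: "E holomorphic_on {w. h < Im w}" unfolding E_def by (intro holomorphic_intros hol)
  have "cmod (E w) \<le> exp (h + d)"
  proof (rule maximum_modulus_frontier[of E S])
    show "E holomorphic_on interior S"
      by (rule holomorphic_on_subset[OF holE]) (use interior_subset d in \<open>force simp: S_def\<close>)
    show "continuous_on (closure S) E"
      by (rule holomorphic_on_imp_continuous_on, rule holomorphic_on_subset[OF holE]) (use clS d in force)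
    show "bounded S" unfolding S_def by (intro bounded_Int disjI2 bounded_ball)
    show "w \<in> S" using d by (auto simp: S_def \<rho>_def dist_norm norm_minus_commute)
    fix z assume z: "z \<in> frontier S"
    then have z1: "h + d \<le> Im z" "cmod (z - p) \<le> \<rho>"
      using clS by (auto simp: frontier_def dist_norm norm_minus_commute)
    have "z \<notin> S" using z opS by (simp add: frontier_def interior_open)
    then have "Im z = h + d \<or> cmod (z - p) = \<rho>"
      using z1 by (auto simp: S_def dist_norm norm_minus_commute)
    then show "cmod (E z) \<le> exp (h + d)"
    proof
      assume "Im z = h + d"
      then show ?thesis unfolding normE using pos[of z] d by simp
    next
      assume "cmod (z - p) = \<rho>"
      then have "cmod (g z - z) \<le> d" using \<rho>0[of z] z1 d by (simp add: \<rho>_def)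
      then have "Im z - Im (g z) \<le> d" using abs_Im_le_cmod[of "g z - z"] by simp
      then show ?thesis unfolding normE using h by simp
    qed
  qed
  then have "Im w - Im (g w) \<le> h + d" unfolding normE by simp
  then show "Im w - h \<le> Im (g w) + e" using d by simp
qed

section \<open>A lower bound for the height of a hull\<close>

context loewner_driver
begin

text \<open>If all points above height h = (s - t)/(12 M) were in the range, the forward map would
  be defined on {Im > h}, and by \<open>Im_ge_of_hydrodynamic\<close> no point could sink by more
  than h. The point at height 5M above lam(t) sinks by more.\<close>

lemma hull_tall:
  assumes ts: "0 \<le> t" "t < s" "s \<le> 1" and M: "0 < M"
    and osc: "\<And>r. r \<in> {t..s} \<Longrightarrow> \<bar>lam r - lam t\<bar> \<le> M" and short: "s - t \<le> M\<^sup>2"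
  obtains w where "(s - t) / (12 * M) < Im w" "w \<notin> bflow lam t s ` upper_half_plane"
proof (rule ccontr)
  assume no: "\<not> thesis"
  define h where "h = (s - t) / (12 * M)"
  have h0: "0 < h" using ts M by (simp add: h_def)
  have sub: "{w. h < Im w} \<subseteq> bflow lam t s ` upper_half_plane"
    using that no by (auto simp: h_def)
  have ts': "t \<le> s" using ts by simp
  obtain g where g: "g holomorphic_on (bflow lam t s ` upper_half_plane)"
    "\<And>z. z \<in> upper_half_plane \<Longrightarrow> g (bflow lam t s z) = z"
    using holomorphic_has_inverse[OF bflow_holomorphic[OF ts(1) ts' ts(3)] open_upper_half_plane bflow_inj[OF ts(1) ts' ts(3)]]
    by metis
  have tr: "\<exists>u. traj lam t s u \<and> u t = w \<and> u s = g w" if w: "h < Im w" for w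
  proof -
    obtain z where z: "0 < Im z" "w = bflow lam t s z" using sub w by blast
    obtain u where u: "traj lam t s u" "u s = z" "u t = bflow lam t s z"
      by (rule bflow_ex[OF ts(1) ts' ts(3) z(1)])
    show ?thesis using u z g(2)[of z] by auto
  qed
  have c: "continuous_on {t..s} lam" by (rule cont_sub[OF ts(1,3)])
  have key: "Im w - h \<le> Im (g w)" if w: "h < Im w" for w
  proof (rule Im_ge_of_hydrodynamic[where p = "of_real (lam t)", OF holomorphic_on_subset[OF g(1) sub]])
    fix w assume w: "h < Im w"
    obtain u where u: "traj lam t s u" "u t = w" "u s = g w" using tr[OF w] by blast
    show "0 < Im (g w)" using trajD(1)[OF u(1), of s] u(3) ts by simp
  next
    fix e :: real assume e: "0 < e"
    show "\<exists>\<rho>. \<forall>w. h < Im w \<and> \<rho> \<le> cmod (w - lam t) \<longrightarrow> cmod (g w - w) \<le> e"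
    \<comment> \<open>The factor 5 exceeds the 4 required by \<open>traj_escape\<close>; the entry
      1/e makes the displacement (s - t)/M' at most e, because s - t \<le> 1.\<close>
    proof (intro exI[of _ "5 * max M (1 / e)"] allI impI)
      fix w assume w: "h < Im w \<and> 5 * max M (1 / e) \<le> cmod (w - lam t)"
      define M' where "M' = max M (1 / e)"
      have M': "0 < M'" "M \<le> M'" "1 / e \<le> M'" using M by (auto simp: M'_def)
      obtain u where u: "traj lam t s u" "u t = w" "u s = g w" using tr w by blast
      have "cmod (u s - u t) \<le> (s - t) / M'"
      proof (rule traj_escape(2)[OF u(1) c M'(1)])
        show "4 * M' < cmod (u t - lam t)" using w M' unfolding u(2) M'_def by linarith
        show "\<bar>lam r - lam t\<bar> \<le> M'" if "r \<in> {t..s}" for r using osc[OF that] M' by simp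
        have "M\<^sup>2 \<le> M'\<^sup>2" using M M' by (intro power_mono) auto
        then show "s - t \<le> M'\<^sup>2" using short by simp
      qed (use ts in auto)
      also have "\<dots> \<le> 1 / M'" using ts M' by (intro divide_right_mono) auto
      also have "\<dots> \<le> e" using M' e by (simp add: field_simps)
      finally show "cmod (g w - w) \<le> e" using u by simp
    qed
  qed (use h0 w in auto)
  \<comment> \<open>From height 5M, with point and driver each moving by at most M, the height stays
    at least 4M and the distance to the driver at most 7M. The sinking rate is then at least 8/(49
    M), more than 1/(12 M).\<close>
  define w0 where "w0 = Complex (lam t) (5 * M)"
  have "s - t \<le> M * M" using short by (simp add: power2_eq_square)
  also have "\<dots> < 5 * M * (12 * M)" using M by simp
  finally have hw: "h < Im w0" using M by (simp add: h_def w0_def pos_divide_less_eq)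
  obtain u where u: "traj lam t s u" "u t = w0" "u s = g w0" using tr[OF hw] by blast
  have w0: "w0 - lam t = \<i> * of_real (5 * M)" by (simp add: w0_def complex_eq_iff)
  have far: "4 * M < cmod (u t - lam t)" unfolding u(2) w0 using M by (simp add: norm_mult)
  have M1: "(r - t) / M \<le> M" if "r \<in> {t..s}" for r
    using short that M by (simp add: pos_divide_le_eq power2_eq_square)
  have mv: "cmod (u r - u t) \<le> M" if r: "r \<in> {t..s}" for r
    using traj_escape(2)[OF u(1) c M far osc short r] M1[OF r] by simp
  have "Im (u s) + 8 / (49 * M) * s \<le> Im (u t) + 8 / (49 * M) * t"
  proof -
    have "- (Im (u t) + 8 / (49 * M) * t) \<le> - (Im (u s) + 8 / (49 * M) * s)"
    proof (rule has_vector_derivative_nonneg_mono[where g = "\<lambda>s. - (Im (u s) + 8 / (49 * M) * s)"])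
      fix r assume r: "r \<in> {t..s}"
      let ?z = "u r - lam r"
      have d: "((\<lambda>s. Im (u s)) has_real_derivative Im (2 / ?z)) (at r within {t..s})"
        unfolding has_real_derivative_iff_has_vector_derivative
        by (rule has_vector_derivative_Im[OF trajD(2)[OF u(1) r]])
      have "((\<lambda>s. - (Im (u s) + 8 / (49 * M) * s)) has_real_derivative - (Im (2 / ?z) + 8 / (49 * M))) (at r within {t..s})"
        by (rule derivative_eq_intros d refl)+ simp
      then show "((\<lambda>s. - (Im (u s) + 8 / (49 * M) * s)) has_vector_derivative - (Im (2 / ?z) + 8 / (49 * M))) (at r within {t..s})"
        unfolding has_real_derivative_iff_has_vector_derivative .
      have "\<bar>Im (u r - u t)\<bar> \<le> M" using mv[OF r] abs_Im_le_cmod order_trans by blast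
      then have im: "4 * M \<le> Im ?z" unfolding minus_complex.sel u(2) w0_def by simp
      have "cmod (of_real (lam r) - of_real (lam t) :: complex) \<le> M"
        using osc[OF r] by (metis norm_of_real of_real_diff)
      moreover have "cmod (w0 - lam t) = 5 * M" unfolding w0 using M by (simp add: norm_mult)
      moreover have "?z = (u r - u t) - (of_real (lam r) - of_real (lam t)) + (w0 - lam t)"
        using u(2) by simp
      then have "cmod ?z \<le> cmod (u r - u t) + cmod (of_real (lam r) - of_real (lam t) :: complex) + cmod (w0 - lam t)"
        by (metis add_right_mono norm_triangle_ineq norm_triangle_ineq4 order_trans)
      ultimately have "cmod ?z \<le> 7 * M" using mv[OF r] by linarith
      then have "(cmod ?z)\<^sup>2 \<le> (7 * M)\<^sup>2" by (intro power_mono) auto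
      then have z: "(cmod ?z)\<^sup>2 \<le> 49 * M\<^sup>2" by (simp add: power_mult_distrib)
      have "8 / (49 * M) = 8 * M / (49 * M\<^sup>2)" using M by (simp add: power2_eq_square)
      also have "\<dots> \<le> 2 * Im ?z / (cmod ?z)\<^sup>2"
        by (rule frac_le) (use im M z trajD(3)[OF u(1) r] in auto)
      finally show "0 \<le> - (Im (2 / ?z) + 8 / (49 * M))" unfolding Im_two_divide by simp
    qed (use ts in simp)
    then show ?thesis by simp
  qed
  moreover have "Im (u t) - h \<le> Im (u s)" using key[OF hw] u by simp
  ultimately have "8 / (49 * M) * (s - t) \<le> h" unfolding right_diff_distrib by linarith
  moreover have "h = 1 / (12 * M) * (s - t)" by (simp add: h_def)
  ultimately have "8 / (49 * M) \<le> 1 / (12 * M)" using ts by (metis diff_gt_0_iff_gt mult_le_cancel_right_pos)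
  then show False using M by (simp add: field_simps)
qed

end

section \<open>The tip of the curve\<close>

context loewner_driver
begin

text \<open>The hull grown during \<open>[t, t+e]\<close>, mapped down by \<open>g\<^sub>t\<close>, has a boundary point \<open>w\<close> that is
  neither too far from \<open>lam t\<close> nor too low; its preimage lies on the part \<open>\<gamma> (t, t+e]\<close> of the curve.\<close>

lemma curve_point_near_tip:
  assumes gen: "generated_by_curve lam \<gamma>" and t: "0 \<le> t" "0 < e" "t + e \<le> 1" and M: "0 < M"
    and osc: "\<And>r. r \<in> {t..t + e} \<Longrightarrow> \<bar>lam r - lam t\<bar> \<le> M" and short: "e \<le> M\<^sup>2"
  obtains r w where "r \<in> {t..t + e}" "\<gamma> r = bflow lam 0 t w" "e / (12 * M) < Im w"
    "cmod (w - lam t) \<le> 4 * M"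
proof -
  define s where "s = t + e"
  have s: "t < s" "t \<le> s" "s \<le> 1" "s - t = e" "0 \<le> s" "t \<le> 1" using t by (auto simp: s_def)
  define D where "D = bflow lam t s ` upper_half_plane"
  have osc': "\<bar>lam r - lam t\<bar> \<le> M" if "r \<in> {t..s}" for r using osc that by (simp add: s_def)
  obtain w0 where w0: "e / (12 * M) < Im w0" "w0 \<notin> D"
    using hull_tall[OF t(1) s(1,3) M osc'] short unfolding s(4) D_def by blast
  have Im0: "0 < e / (12 * M)" using t M by simp
  have inD: "w \<in> D" if w: "0 < Im w" "4 * M < cmod (w - lam t)" for w
  proof -
    obtain u where u: "traj lam t s u" "u t = w"
      using traj_ex_escape[OF t(1) s(2,3) w(1) M w(2) osc'] short s(4) by auto
    have "w = bflow lam t s (u s)" using bflow_eq[OF u(1) t(1) s(2,3)] u(2) by simp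
    moreover have "0 < Im (u s)" using trajD(1)[OF u(1), of s] s by simp
    ultimately show ?thesis unfolding D_def by blast
  qed
  \<comment> \<open>This point is high enough to lie in \<open>D\<close> by \<open>inD\<close>, so
    the vertical segment from \<open>w0\<close> meets the boundary of \<open>D\<close>, at a point
    no lower than \<open>w0\<close>.\<close>
  define w1 where "w1 = w0 + \<i> * of_real (5 * M)"
  have Im1: "Im w1 = Im w0 + 5 * M" by (simp add: w1_def)
  have "4 * M < Im (w1 - lam t)" using Im1 Im0 w0(1) M by simp
  then have "4 * M < cmod (w1 - lam t)"
    using abs_Im_le_cmod[of "w1 - lam t"] by linarith
  then have w1: "w1 \<in> D" using inD[of w1] Im1 Im0 w0(1) M by simp
  have "closed_segment w0 w1 \<inter> frontier D \<noteq> {}"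
    by (rule connected_Int_frontier) (use w0 w1 in \<open>auto simp: connected_segment\<close>)
  then obtain w where w: "w \<in> closed_segment w0 w1" "w \<in> frontier D" by blast
  have opD: "open D" unfolding D_def
    by (rule open_mapping_thm3[OF bflow_holomorphic open_upper_half_plane bflow_inj]) (use t s in auto)
  have wD: "w \<notin> D" "w \<in> closure D" using w(2) opD by (auto simp: frontier_def interior_open)
  obtain p where p: "0 \<le> p" "w = (1 - p) *\<^sub>R w0 + p *\<^sub>R w1" using w(1) by (auto simp: closed_segment_def)
  have "Im w = Im w0 + p * (5 * M)" unfolding p(2) using Im1 by (simp add: algebra_simps)
  then have Imw: "e / (12 * M) < Im w" using w0(1) mult_nonneg_nonneg[OF p(1), of "5 * M"] M by linarith
  then have Imw0: "0 < Im w" using Im0 by simp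
  have near: "cmod (w - lam t) \<le> 4 * M" using inD[OF Imw0] wD(1) by force
  have posD: "0 < Im x" if "x \<in> D" for x using that bflow_Im_pos[OF t(1) s(2,3)] by (auto simp: D_def)
  have dom_t: "loewner_domain lam t = bflow lam 0 t ` upper_half_plane"
    and dom_s: "loewner_domain lam s = bflow lam 0 t ` D"
  proof -
    show "loewner_domain lam t = bflow lam 0 t ` upper_half_plane" by (rule loewner_domain_eq[OF t(1) s(6)])
    have "bflow lam 0 s x = bflow lam 0 t (bflow lam t s x)" if "0 < Im x" for x
      using bflow_comp[of 0 t s x] t s that by simp
    then show "loewner_domain lam s = bflow lam 0 t ` D"
      unfolding loewner_domain_eq[OF s(5,3)] D_def image_image by (intro image_cong) auto
  qed
  define z where "z = bflow lam 0 t w"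
  have z_t: "z \<in> loewner_domain lam t" unfolding dom_t z_def using Imw0 by auto
  have inj: "inj_on (bflow lam 0 t) upper_half_plane" by (rule bflow_inj) (use t s in auto)
  have z_s: "z \<notin> loewner_domain lam s"
  proof
    assume "z \<in> loewner_domain lam s"
    then obtain x where "x \<in> D" "bflow lam 0 t w = bflow lam 0 t x" by (auto simp: dom_s z_def)
    then show False using inj_onD[OF inj, of w x] Imw0 posD wD(1) by auto
  qed
  have z_cl: "z \<in> closure (loewner_domain lam s)"
  proof -
    obtain x where x: "\<And>m. x m \<in> D" "x \<longlonglongrightarrow> w" using wD(2) by (auto simp: closure_sequential)
    have "continuous_on upper_half_plane (bflow lam 0 t)"
      by (intro holomorphic_on_imp_continuous_on bflow_holomorphic) (use t s in auto)
    then have "isCont (bflow lam 0 t) w"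
      using continuous_on_eq_continuous_at[OF open_upper_half_plane, of "bflow lam 0 t"] Imw0 by blast
    then have "(\<lambda>m. bflow lam 0 t (x m)) \<longlonglongrightarrow> z" unfolding z_def using x(2) by (rule isCont_tendsto_compose)
    moreover have "\<forall>m. bflow lam 0 t (x m) \<in> bflow lam 0 t ` D" using x(1) by simp
    ultimately show ?thesis unfolding closure_sequential dom_s
      by (intro exI[of _ "\<lambda>m. bflow lam 0 t (x m)"] conjI)
  qed
  have gc: "continuous_on {0..1} \<gamma>" using gen by (simp add: generated_by_curve_def)
  have comp: "loewner_domain lam r \<in> components (upper_half_plane - \<gamma> ` {0..r})" if "0 \<le> r" "r \<le> 1" for r
    using gen that by (simp add: generated_by_curve_def)
  have z0: "0 < Im z" unfolding z_def by (rule bflow_Im_pos) (use t s Imw0 in auto)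
  \<comment> \<open>A ball about z that avoids the curve up to time s and meets the component H_s
    lies inside it, although z does not. Since z belongs to H_t, it is not on the curve up to time t
    either, so its parameter lies beyond t.\<close>
  have "z \<in> \<gamma> ` {0..s}"
  proof (rule ccontr)
    assume no: "z \<notin> \<gamma> ` {0..s}"
    have "compact (\<gamma> ` {0..s})"
      by (intro compact_continuous_image continuous_on_subset[OF gc]) (use s in auto)
    then have "open (upper_half_plane - \<gamma> ` {0..s})" using open_upper_half_plane by (intro open_Diff compact_imp_closed)
    then obtain d where d: "0 < d" "ball z d \<subseteq> upper_half_plane - \<gamma> ` {0..s}"
      using no z0 open_contains_ball by (metis DiffI mem_Collect_eq)
    obtain x where "x \<in> loewner_domain lam s" "dist x z < d"
      using z_cl d(1) by (auto simp: closure_approachable)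
    then have "loewner_domain lam s \<inter> ball z d \<noteq> {}" by (auto simp: dist_commute)
    then have "ball z d \<subseteq> loewner_domain lam s"
      by (intro components_maximal[OF comp _ d(2)]) (use s in auto)
    then show False using z_s centre_in_ball[of z d] d(1) by blast
  qed
  then obtain r where r: "r \<in> {0..s}" "z = \<gamma> r" by blast
  have "loewner_domain lam t \<subseteq> upper_half_plane - \<gamma> ` {0..t}"
    by (rule in_components_subset[OF comp]) (use t s in auto)
  then have "z \<notin> \<gamma> ` {0..t}" using z_t by blast
  then have "r \<in> {t..t + e}" using r by (auto simp: s_def)
  then show thesis using that[of r w] r(2) Imw near by (simp add: z_def)
qed

lemma small_osc:
  assumes t: "0 \<le> t" "t < 1" and M: "0 < M"
  obtains e where "0 < e" "t + e \<le> 1" "e \<le> M" "\<And>r. r \<in> {t..t + e} \<Longrightarrow> \<bar>lam r - lam t\<bar> \<le> M"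
proof -
  obtain d where d: "0 < d" "\<And>r. r \<in> {0..1} \<Longrightarrow> dist r t < d \<Longrightarrow> dist (lam r) (lam t) < M"
    using cont t M unfolding continuous_on_iff by (metis atLeastAtMost_iff less_imp_le)
  define e where "e = min (d / 2) (min M (1 - t))"
  have e: "0 < e" "t + e \<le> 1" "e \<le> M" "e < d" using d t M by (auto simp: e_def min_def)
  show thesis
  proof (rule that[OF e(1-3)])
    fix r assume r: "r \<in> {t..t + e}"
    have "dist (lam r) (lam t) < M" by (rule d(2)) (use r t e in \<open>auto simp: dist_real_def\<close>)
    then show "\<bar>lam r - lam t\<bar> \<le> M" by (simp add: dist_real_def)
  qed
qed

text \<open>The scale M is taken so small that the parameter found by
  \<open>curve_point_near_tip\<close> is close to t, and continuity of \<gamma> replaces \<gamma>(r)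
  by \<gamma>(t). Of the height bound only positivity is kept.\<close>

lemma curve_point_approx:
  assumes gen: "generated_by_curve lam \<gamma>" and t: "0 \<le> t" "t < 1" and \<eta>: "0 < \<eta>"
  obtains w where "0 < Im w" "cmod (w - lam t) < \<eta>" "cmod (\<gamma> t - bflow lam 0 t w) < \<eta>"
proof -
  have gc: "continuous_on {0..1} \<gamma>" using gen by (simp add: generated_by_curve_def)
  obtain d where d: "0 < d" "\<And>r. r \<in> {0..1} \<Longrightarrow> dist r t < d \<Longrightarrow> dist (\<gamma> r) (\<gamma> t) < \<eta>"
    using gc t \<eta> unfolding continuous_on_iff by (metis atLeastAtMost_iff less_imp_le)
  define M where "M = min (\<eta> / 5) (min 1 (d / 2))"
  have M: "0 < M" "M \<le> \<eta> / 5" "M \<le> d / 2" "M \<le> 1" using \<eta> d by (auto simp: M_def)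
  obtain e0 where e0: "0 < e0" "t + e0 \<le> 1" "e0 \<le> M" "\<And>r. r \<in> {t..t + e0} \<Longrightarrow> \<bar>lam r - lam t\<bar> \<le> M"
    using small_osc[OF t M(1)] by blast
  define e where "e = min e0 (M\<^sup>2)"
  have e: "0 < e" "e \<le> e0" "e \<le> M\<^sup>2" using e0 M by (auto simp: e_def)
  have te: "t + e \<le> 1" using e e0 by simp
  have osc: "\<bar>lam r - lam t\<bar> \<le> M" if "r \<in> {t..t + e}" for r using e0(4)[of r] that e by simp
  obtain r w where rw: "r \<in> {t..t + e}" "\<gamma> r = bflow lam 0 t w" "e / (12 * M) < Im w"
    "cmod (w - lam t) \<le> 4 * M"
    using curve_point_near_tip[OF gen t(1) e(1) te M(1) osc e(3)] by blast
  show thesis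
  proof (rule that[of w])
    have "0 < e / (12 * M)" using e M by simp
    then show "0 < Im w" using rw(3) by simp
    show "cmod (w - lam t) < \<eta>" using rw(4) M \<eta> by simp
    have "dist (\<gamma> r) (\<gamma> t) < \<eta>"
      by (rule d(2)) (use rw(1) t te e e0 M d in \<open>auto simp: dist_real_def\<close>)
    then show "cmod (\<gamma> t - bflow lam 0 t w) < \<eta>" using rw(2) by (simp add: dist_norm norm_minus_commute)
  qed
qed

text \<open>A bound for the inverse map on a half-disc about lam(t), however small, passes to the
  tip by \<open>curve_point_approx\<close>. This takes the place of a radial limit.\<close>

lemma curve_point_bound:
  assumes gen: "generated_by_curve lam \<gamma>" and t: "0 \<le> t" "t < 1" and \<delta>: "0 < \<delta>"
    and bd: "\<And>w. 0 < Im w \<Longrightarrow> cmod (w - lam t) < \<delta> \<Longrightarrow> cmod (bflow lam 0 t w - z) \<le> B"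
  shows "cmod (\<gamma> t - z) \<le> B"
proof (rule field_le_epsilon)
  fix e :: real assume e: "0 < e"
  obtain w where w: "0 < Im w" "cmod (w - lam t) < min \<delta> e" "cmod (\<gamma> t - bflow lam 0 t w) < min \<delta> e"
    using curve_point_approx[OF gen t, of "min \<delta> e"] \<delta> e by auto
  then have "cmod (bflow lam 0 t w - z) \<le> B" by (intro bd) auto
  then show "cmod (\<gamma> t - z) \<le> B + e"
    using norm_triangle_ineq[of "\<gamma> t - bflow lam 0 t w" "bflow lam 0 t w - z"] w(3) by simp
qed

text \<open>Meant for the first interval of the partition, where no earlier node is available: both
  curves are still close to their common starting point.\<close>

lemma curve_point_early:
  assumes gen: "generated_by_curve lam \<gamma>" and t: "0 \<le> t" "t < 1" and M: "0 < M"
    and osc: "\<And>r. r \<in> {0..t} \<Longrightarrow> \<bar>lam r - lam 0\<bar> \<le> M" and short: "t \<le> M\<^sup>2"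
  shows "cmod (\<gamma> t - lam 0) \<le> 5 * M"
proof (rule curve_point_bound[OF gen t M])
  fix w assume w: "0 < Im w" "cmod (w - lam t) < M"
  obtain u where u: "traj lam 0 t u" "u t = w" "u 0 = bflow lam 0 t w"
    using bflow_ex[of 0 t w] t w by auto
  have "cmod (u 0 - lam 0) \<le> cmod (u t - lam t) + 4 * M"
    by (rule traj_displacement[OF u(1) cont_sub M osc]) (use t short in auto)
  then show "cmod (bflow lam 0 t w - lam 0) \<le> 5 * M" using u w(2) by simp
qed

end

section \<open>Square-root driving functions\<close>

text \<open>For a Lipschitz driving function, \<open>z = u - lam\<close> satisfies \<open>(z\<^sup>2)' = 4 - 2z lam'\<close>, so that
  backwards in time \<open>z\<^sup>2\<close> moves to the left at a speed close to \<open>4\<close>.\<close>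

lemma traj_height_of_lipschitz:
  assumes u: "traj lam a b u" and ab: "a < b"
    and der: "\<And>s. s \<in> {a..b} \<Longrightarrow> (lam has_real_derivative lam' s) (at s within {a..b})"
    and bd: "\<And>s. s \<in> {a..b} \<Longrightarrow> \<bar>lam' s\<bar> \<le> \<Lambda>" and \<Lambda>: "\<Lambda>\<^sup>2 * (b - a) \<le> 1 / 100"
    and start: "(cmod (u b - lam b))\<^sup>2 \<le> b - a"
  shows "sqrt (b - a) \<le> Im (u a)"
proof -
  define T where "T = sqrt (b - a)"
  have T: "0 < T" "T\<^sup>2 = b - a" using ab by (auto simp: T_def)
  have \<Lambda>0: "0 \<le> \<Lambda>" using bd[of a] ab by force
  have \<Lambda>T: "\<Lambda> * T \<le> 1 / 10"
  proof (rule power2_le_imp_le)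
    show "(\<Lambda> * T)\<^sup>2 \<le> (1/10)\<^sup>2" using \<Lambda> unfolding power_mult_distrib T(2) by (simp add: power2_eq_square)
  qed simp
  define z where "z = (\<lambda>s. u s - lam s)"
  have lc: "continuous_on {a..b} lam"
    by (rule continuous_on_vector_derivative[where f' = lam'])
      (use der in \<open>simp add: has_real_derivative_iff_has_vector_derivative\<close>)
  have zc: "continuous_on {a..b} z" unfolding z_def by (rule traj_quotient_cont[OF u lc])
  have zd: "((\<lambda>s. z s * z s) has_vector_derivative 4 - 2 * z s * of_real (lam' s)) (at s within {a..b})"
    if s: "s \<in> {a..b}" for s
  proof -
    have "((\<lambda>s. complex_of_real (lam s)) has_vector_derivative of_real (lam' s)) (at s within {a..b})"
      using der[OF s] has_vector_derivative_of_real has_real_derivative_iff_has_vector_derivative by blast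
    then have "(z has_vector_derivative 2 / z s - lam' s) (at s within {a..b})"
      unfolding z_def by (intro has_vector_derivative_diff trajD(2)[OF u s])
    from has_vector_derivative_mult[OF this this]
    have "((\<lambda>s. z s * z s) has_vector_derivative
      z s * (2 / z s - lam' s) + (2 / z s - lam' s) * z s) (at s within {a..b})" .
    moreover have "z s * (2 / z s - lam' s) + (2 / z s - lam' s) * z s
       = 4 - 2 * z s * of_real (lam' s)"
    proof -
      have "Z * (2 / Z - L) + (2 / Z - L) * Z = 4 - 2 * Z * L" if "Z \<noteq> 0" for Z L :: complex
        using that by (simp add: algebra_simps)
      then show ?thesis using trajD(3)[OF u s] by (simp add: z_def)
    qed
    ultimately show ?thesis by simp
  qed
  have zd': "((\<lambda>s. z s * z s - of_real (4 * s)) has_vector_derivative - 2 * z s * of_real (lam' s)) (at s within {a..b})"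
    if s: "s \<in> {a..b}" for s
  proof -
    have "((\<lambda>s. complex_of_real (4 * s)) has_vector_derivative of_real 4) (at s within {a..b})"
      by (rule has_vector_derivative_of_real) (auto intro!: derivative_eq_intros)
    from has_vector_derivative_diff[OF zd[OF s] this] show ?thesis by simp
  qed
  obtain m where m: "m \<in> {a..b}" "\<And>s. s \<in> {a..b} \<Longrightarrow> cmod (z s) \<le> cmod (z m)"
    using continuous_attains_sup[of "{a..b}" "\<lambda>s. cmod (z s)"] ab
      continuous_on_norm[OF zc] by auto
  define M where "M = cmod (z m)"
  have bdz: "cmod (- 2 * z s * of_real (lam' s)) \<le> 2 * M * \<Lambda>" if "s \<in> {a..b}" for s
    using m(2)[OF that] bd[OF that] by (simp add: norm_mult M_def mult_mono)
  have diff: "cmod ((z s * z s - of_real (4 * s)) - (z b * z b - of_real (4 * b))) \<le> 2 * M * \<Lambda> * (b - s)"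
    if s: "s \<in> {a..b}" for s
    using has_vector_derivative_bound[OF zd' bdz s, of b] ab s by auto
  have start': "cmod (z b * z b) \<le> T\<^sup>2" using start T by (simp add: z_def norm_mult power2_eq_square)
  \<comment> \<open>At the maximum M of |z|, the start contributes T^2 to |z|^2, the drift 4 T^2 and
    the driver at most M T / 5. So M^2 \<le> 5 T^2 + M T / 5, which is impossible for M >
    3T.\<close>
  have "M \<le> 3 * T"
  proof (rule ccontr)
    assume big: "\<not> M \<le> 3 * T"
    have "cmod (z m * z m) \<le> cmod ((z m * z m - of_real (4 * m)) - (z b * z b - of_real (4 * b)))
        + cmod (z b * z b) + cmod (of_real (4 * (b - m)) :: complex)"
      using norm_triangle_ineq4[of "((z m * z m - of_real (4 * m)) - (z b * z b - of_real (4 * b))) + z b * z b" "of_real (4 * (b - m))"]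
        norm_triangle_ineq[of "((z m * z m - of_real (4 * m)) - (z b * z b - of_real (4 * b)))" "z b * z b"]
      by (simp add: algebra_simps)
    moreover have "cmod (of_real (4 * (b - m)) :: complex) \<le> 4 * T\<^sup>2"
      using m(1) T unfolding norm_of_real by simp
    moreover have "2 * M * \<Lambda> * (b - m) \<le> 2 * M * \<Lambda> * T\<^sup>2"
      using m(1) T \<Lambda>0 by (intro mult_left_mono) (auto simp: M_def)
    moreover have "2 * M * \<Lambda> * T\<^sup>2 = 2 * M * T * (\<Lambda> * T)" by (simp add: power2_eq_square)
    moreover have "2 * M * T * (\<Lambda> * T) \<le> 2 * M * T * (1 / 10)"
      using \<Lambda>T T by (intro mult_left_mono) (auto simp: M_def)
    moreover have "cmod (z m * z m) = M * M" "2 * M * T * (1 / 10) = M * T / 5" by (simp_all add: M_def norm_mult)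
    ultimately have "M * M \<le> 5 * T\<^sup>2 + M * T / 5"
      using diff[OF m(1)] start' by linarith
    moreover have "3 * T * (M - T / 5) \<le> M * (M - T / 5)"
      using big T by (intro mult_right_mono) auto
    moreover have "3 * T * (3 * T - T / 5) \<le> 3 * T * (M - T / 5)"
      using big T by (intro mult_left_mono) auto
    ultimately have "8.4 * (T * T) \<le> 5 * (T * T)" by (simp add: algebra_simps power2_eq_square)
    then show False using T(1) by simp
  qed
  then have "2 * M * \<Lambda> * (b - a) \<le> 2 * (3 * T) * \<Lambda> * (b - a)"
    using \<Lambda>0 ab by (intro mult_right_mono mult_left_mono) auto
  also have "\<dots> = 6 * (\<Lambda> * T) * (b - a)" by simp
  also have "\<dots> \<le> 6 * (1 / 10) * (b - a)" using \<Lambda>T ab by (intro mult_right_mono mult_left_mono) auto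
  finally have "cmod ((z a * z a - of_real (4 * a)) - (z b * z b - of_real (4 * b))) \<le> 6 / 10 * (b - a)"
    using diff[of a] ab by simp
  then have "\<bar>Re ((z a * z a - of_real (4 * a)) - (z b * z b - of_real (4 * b)))\<bar> \<le> 6 / 10 * (b - a)"
    using abs_Re_le_cmod order_trans by blast
  then have re: "\<bar>(Re (z a * z a) - 4 * a) - (Re (z b * z b) - 4 * b)\<bar> \<le> 6 / 10 * (b - a)"
    unfolding minus_complex.sel Re_complex_of_real .
  \<comment> \<open>The real part of z^2 starts at most at b - a and moves left by at least (4 -
    6/10)(b - a), which puts it below -(b - a); hence (Im z)^2 is at least b - a.\<close>
  have "Re (z b * z b) \<le> b - a" using start' T complex_Re_le_cmod[of "z b * z b"] by simp
  moreover have "x \<le> - (b - a)"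
    if "\<bar>(x - 4 * a) - (x' - 4 * b)\<bar> \<le> 6 / 10 * (b - a)" "x' \<le> b - a" for x x' :: real
    using that ab by argo
  ultimately have "Re (z a * z a) \<le> - (b - a)" using re by blast
  moreover have "Re (z a * z a) = (Re (z a))\<^sup>2 - (Im (u a))\<^sup>2" by (simp add: z_def power2_eq_square)
  ultimately have "(Re (z a))\<^sup>2 - (Im (u a))\<^sup>2 \<le> - (b - a)" by (simp only:)
  then have "b - a \<le> (Im (u a))\<^sup>2" using zero_le_power2[of "Re (z a)"] by linarith
  then show ?thesis using trajD(1)[OF u, of a] ab by (intro real_le_lsqrt) auto
qed

text \<open>The number P, later 1 + \<phi>(n), bounds the coefficients of the square roots. Being at
  least 1, its lower powers are absorbed by higher ones.\<close>

locale sqrt_driver = loewner_driver lam for lam :: "real \<Rightarrow> real" +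
  fixes n :: nat and P :: real
  assumes n: "1 \<le> n" and P: "1 \<le> P"
    and slope: "\<And>k. k < n \<Longrightarrow> \<bar>lam (real (k + 1) / real n) - lam (real k / real n)\<bar> \<le> P / sqrt (real n)"
begin

abbreviation mu :: "real \<Rightarrow> real" where "mu \<equiv> sqrt_interp lam n"
definition node :: "nat \<Rightarrow> real" where "node k = real k / real n"

definition piece_coeff :: "nat \<Rightarrow> real" where "piece_coeff k = sqrt (real n) * (lam (node (Suc k)) - lam (node k))"

lemma n_pos: "0 < real n" using n by simp

lemma node_Suc: "node (Suc k) = node k + 1 / real n"
  by (simp add: node_def add_divide_distrib)

lemma node_mono: "node k \<le> node (Suc k)"
  unfolding node_Suc using n_pos by simp

lemma mu_eq:
  assumes "k < n" "s \<in> {node k..node (Suc k)}"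
  shows "mu s = piece_coeff k * sqrt (s - node k) + lam (node k)"
  using sqrt_interp_piece[OF assms(1), of s lam] assms(2) by (simp add: piece_coeff_def node_def)

lemma piece_coeff_bound: assumes "k < n" shows "\<bar>piece_coeff k\<bar> \<le> P"
proof -
  have "\<bar>piece_coeff k\<bar> = sqrt (real n) * \<bar>lam (node (Suc k)) - lam (node k)\<bar>" by (simp add: piece_coeff_def abs_mult)
  also have "\<dots> \<le> sqrt (real n) * (P / sqrt (real n))"
    using slope[OF assms] by (intro mult_left_mono) (simp_all add: node_def)
  also have "\<dots> = P" using n_pos by simp
  finally show ?thesis .
qed

lemma mu_node: assumes "k \<le> n" shows "mu (node k) = lam (node k)"
proof (cases "k < n")
  case True
  then show ?thesis using mu_eq[OF True, of "node k"] node_mono by simp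
next
  case False
  then obtain j where j: "k = Suc j" "j < n" using assms n by (cases k) auto
  have "mu (node k) = piece_coeff j * sqrt (1 / real n) + lam (node j)"
    using mu_eq[OF j(2), of "node k"] node_mono[of j] node_Suc[of j] unfolding j(1) by simp
  also have "piece_coeff j * sqrt (1 / real n) = lam (node k) - lam (node j)"
    using n_pos by (simp add: piece_coeff_def j(1) real_sqrt_divide)
  finally show ?thesis by simp
qed

lemma mu_osc:
  assumes "k < n" "s \<in> {node k..node (Suc k)}"
  shows "\<bar>mu s - mu (node k)\<bar> \<le> P * sqrt (s - node k)"
proof -
  have "mu s - mu (node k) = piece_coeff k * sqrt (s - node k)"
    using mu_eq[OF assms] mu_node[of k] assms by simp
  then show ?thesis using piece_coeff_bound[OF assms(1)] assms(2) by (simp add: abs_mult mult_right_mono)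
qed

lemma mu_osc':
  assumes "k < n" "s \<in> {node k..node (Suc k)}"
  shows "\<bar>mu s - mu (node k)\<bar> \<le> P / sqrt (real n)"
proof -
  have "sqrt (s - node k) \<le> sqrt (1 / real n)" using assms(2) unfolding node_Suc by simp
  then have "P * sqrt (s - node k) \<le> P * sqrt (1 / real n)" using P by (intro mult_left_mono) auto
  then show ?thesis using mu_osc[OF assms] by (simp add: real_sqrt_divide)
qed

lemma piece_ex:
  assumes "s \<in> {0..1}"
  obtains k where "k < n" "s \<in> {node k..node (Suc k)}"
proof (cases "s = 1")
  case True
  then have "s \<in> {node (n - 1)..node (Suc (n - 1))}" using n n_pos by (simp add: node_def divide_le_eq)
  then show thesis using that[of "n - 1"] n by simp
next
  case False
  define k where "k = nat \<lfloor>real n * s\<rfloor>"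
  have "0 \<le> real n * s" "real n * s < real n" using assms False n_pos by auto
  then have k: "real k \<le> real n * s" "real n * s < real k + 1" "k < n"
    unfolding k_def by (auto simp: nat_less_iff floor_less_iff of_nat_nat)
  then have "s \<in> {node k..node (Suc k)}" using n_pos by (simp add: node_def divide_le_eq le_divide_eq mult.commute)
  then show thesis using that k(3) by blast
qed

lemma mu_cont: "continuous_on {0..1} mu"
proof -
  have "continuous_on {node k..node (Suc k)} mu" if "k < n" for k
  proof -
    have "continuous_on {node k..node (Suc k)} (\<lambda>s. piece_coeff k * sqrt (s - node k) + lam (node k))"
      by (intro continuous_intros)
    then show ?thesis by (rule continuous_on_eq) (use mu_eq[OF that] in simp)
  qed
  then have "continuous_on (\<Union>k\<in>{..<n}. {node k..node (Suc k)}) mu"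
    by (intro continuous_on_closed_Union) auto
  moreover have "{0..1} \<subseteq> (\<Union>k\<in>{..<n}. {node k..node (Suc k)})"
    using piece_ex by blast
  ultimately show ?thesis by (rule continuous_on_subset)
qed

sublocale interp: loewner_driver mu by unfold_locales (rule mu_cont)

lemma node_le_1: "k \<le> n \<Longrightarrow> node k \<le> 1" using n_pos by (simp add: node_def divide_le_eq)

lemma node_nonneg: "0 \<le> node k" by (simp add: node_def)

text \<open>The square root is steep only near its node. On the last part of length T = \<sigma>/(50
  P^2) the slope is at most P / (2 sqrt(\<sigma>/2)), whose square times T is exactly the 1/100 of
  \<open>traj_height_of_lipschitz\<close>. The height gained is sqrt T, and 50 < 64 gives sqrt
  \<sigma> / (8 P).\<close>

lemma piece_height:
  assumes k: "k < n" and \<sigma>: "0 < \<sigma>" "\<sigma> \<le> 1 / real n" and u: "traj mu (node k) (node k + \<sigma>) u"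
    and start: "cmod (u (node k + \<sigma>) - mu (node k + \<sigma>)) \<le> sqrt \<sigma> / (8 * P)"
  shows "sqrt \<sigma> / (8 * P) \<le> Im (u (node k))"
proof -
  define T where "T = \<sigma> / (50 * P\<^sup>2)"
  define b where "b = node k + \<sigma>"
  define a where "a = b - T"
  have P2: "1 \<le> P\<^sup>2" using P by simp
  have "\<sigma> / (50 * P\<^sup>2) \<le> \<sigma> / 2" using \<sigma> P2 by (intro divide_left_mono) auto
  then have T: "0 < T" "T \<le> \<sigma> / 2" unfolding T_def using \<sigma> P by auto
  have ab: "a < b" "node k + \<sigma> / 2 \<le> a" "b - a = T" using T by (auto simp: a_def b_def)
  have b1: "b \<le> node (Suc k)" using \<sigma> unfolding b_def node_Suc by simp
  define lam' where "lam' = (\<lambda>s. piece_coeff k / (2 * sqrt (s - node k)))"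
  have lower: "sqrt \<sigma> / (8 * P) \<le> sqrt T"
  proof (rule real_le_rsqrt)
    have "\<sigma> / (64 * P\<^sup>2) \<le> \<sigma> / (50 * P\<^sup>2)" using \<sigma> P2 by (intro divide_left_mono) auto
    then show "(sqrt \<sigma> / (8 * P))\<^sup>2 \<le> T" using \<sigma> by (simp add: T_def power_divide power_mult_distrib)
  qed
  have "sqrt (b - a) \<le> Im (u a)"
  proof (rule traj_height_of_lipschitz[where lam' = lam' and \<Lambda> = "P / (2 * sqrt (\<sigma> / 2))"])
    show "traj mu a b u" using traj_subset[OF u] ab \<sigma> by (auto simp: b_def)
    fix s assume s: "s \<in> {a..b}"
    have sk: "\<sigma> / 2 \<le> s - node k" using s ab by simp
    have "((\<lambda>s. piece_coeff k * sqrt (s - node k) + lam (node k)) has_real_derivative lam' s) (at s within {a..b})"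
      unfolding lam'_def using sk \<sigma> by (auto intro!: derivative_eq_intros simp: field_simps)
    then show "(mu has_real_derivative lam' s) (at s within {a..b})"
    proof (rule has_field_derivative_transform_within[OF _ zero_less_one s])
      fix r assume "r \<in> {a..b}"
      then have "r \<in> {node k..node (Suc k)}" using ab b1 \<sigma> by auto
      then show "piece_coeff k * sqrt (r - node k) + lam (node k) = mu r" by (rule mu_eq[OF k, symmetric])
    qed
    have "\<bar>lam' s\<bar> = \<bar>piece_coeff k\<bar> / (2 * sqrt (s - node k))" using sk \<sigma> by (simp add: lam'_def abs_mult)
    also have "\<dots> \<le> P / (2 * sqrt (\<sigma> / 2))"
      using sk \<sigma> piece_coeff_bound[OF k] by (intro frac_le) auto
    finally show "\<bar>lam' s\<bar> \<le> P / (2 * sqrt (\<sigma> / 2))" .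
  next
    have "(P / (2 * sqrt (\<sigma> / 2)))\<^sup>2 = P\<^sup>2 / (2 * \<sigma>)" using \<sigma> by (simp add: power_divide power_mult_distrib)
    then show "(P / (2 * sqrt (\<sigma> / 2)))\<^sup>2 * (b - a) \<le> 1 / 100"
      unfolding ab(3) T_def using \<sigma> P by simp
    have "(cmod (u b - mu b))\<^sup>2 \<le> (sqrt T)\<^sup>2"
      using start lower unfolding b_def by (intro power_mono) auto
    then show "(cmod (u b - mu b))\<^sup>2 \<le> b - a" using T ab by simp
  qed (use ab in auto)
  moreover have "Im (u a) \<le> Im (u (node k))"
    by (rule traj_Im_antimono[OF traj_subset[OF u]]) (use ab \<sigma> T in \<open>auto simp: b_def a_def\<close>)
  ultimately show ?thesis using lower ab by simp
qed

text \<open>Let \<sigma> be the time spent in the current piece. If it is tiny, this piece moves the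
  tip by at most y/(8P) from the driver, and the complete piece before it lifts it to y/(8P).
  Otherwise the current piece alone lifts it to sqrt \<sigma> / (8P), at least y/(512 P^3) with 512
  = 8 * 64, and heights do not decrease backwards.\<close>

lemma tip_position:
  assumes k: "Suc k < n" and t: "t \<in> {node (Suc k)..node (Suc (Suc k))}"
  obtains \<delta> where "0 < \<delta>"
    "\<And>w. \<lbrakk>0 < Im w; cmod (w - mu t) < \<delta>\<rbrakk> \<Longrightarrow>
      1 / sqrt (real n) / (512 * P ^ 3) \<le> Im (bflow mu (node k) t w) \<and>
      cmod (bflow mu (node k) t w - mu (node k)) \<le> 9 * P * (1 / sqrt (real n))"
proof -
  define y where "y = 1 / sqrt (real n)"
  have y: "0 < y" "y\<^sup>2 = 1 / real n" using n_pos by (auto simp: y_def power_divide)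
  have sy: "sqrt (1 / real n) = y" by (simp add: y_def real_sqrt_divide)
  define \<sigma> where "\<sigma> = t - node (Suc k)"
  have nk2: "node (Suc (Suc k)) = node (Suc k) + 1 / real n" using node_Suc[of "Suc k"] by simp
  have \<sigma>: "0 \<le> \<sigma>" "\<sigma> \<le> 1 / real n" using t nk2 by (auto simp: \<sigma>_def)
  have t_eq: "t = node (Suc k) + \<sigma>" by (simp add: \<sigma>_def)
  have times: "0 \<le> node k" "node k \<le> node (Suc k)" "node (Suc k) \<le> t" "t \<le> 1"
    using t node_le_1[of "Suc (Suc k)"] k node_mono[of k] node_nonneg[of k] by auto
  \<comment> \<open>In the first case the start may use up half of y/(8P); the displacement 4M with
    M = y/(64 P) takes the other half. In the second case it is the start condition of
    \<open>piece_height\<close>.\<close>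
  define \<delta> where "\<delta> = (if 64 * P\<^sup>2 * sqrt \<sigma> \<le> y then y / (16 * P) else sqrt \<sigma> / (8 * P))"
  have ss: "sqrt \<sigma> \<le> y" using \<sigma> sy real_sqrt_le_mono by metis
  have \<delta>: "0 < \<delta>" "\<delta> \<le> y"
  proof -
    show "0 < \<delta>"
    proof (cases "64 * P\<^sup>2 * sqrt \<sigma> \<le> y")
      case False
      then have "sqrt \<sigma> \<noteq> 0" using y by auto
      then show ?thesis using False P \<sigma> by (simp add: \<delta>_def)
    qed (use P y in \<open>simp add: \<delta>_def\<close>)
    have "y * 1 \<le> y * (16 * P)" "y * 1 \<le> y * (8 * P)"
      by (intro mult_left_mono; use P y in simp)+
    then have "y \<le> y * (16 * P)" "sqrt \<sigma> \<le> y * (8 * P)" using ss by auto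
    then show "\<delta> \<le> y" unfolding \<delta>_def using P by (simp add: pos_divide_le_eq)
  qed
  show thesis
  proof (rule that[OF \<delta>(1)])
    fix w :: complex assume w: "0 < Im w" "cmod (w - mu t) < \<delta>"
    obtain u where u: "traj mu (node k) t u" "u t = w" "u (node k) = bflow mu (node k) t w"
      using interp.bflow_ex[of "node k" t w] times w by auto
    have u1: "traj mu (node (Suc k)) t u" and u0: "traj mu (node k) (node (Suc k)) u"
      using traj_subset[OF u(1)] times by auto
    have osc1: "\<bar>mu s - mu (node (Suc k))\<bar> \<le> P * sqrt \<sigma>" if s: "s \<in> {node (Suc k)..t}" for s
    proof -
      have "\<bar>mu s - mu (node (Suc k))\<bar> \<le> P * sqrt (s - node (Suc k))"
        using mu_osc[of "Suc k" s] k s t by auto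
      also have "\<dots> \<le> P * sqrt \<sigma>" using s P by (intro mult_left_mono) (auto simp: \<sigma>_def)
      finally show ?thesis .
    qed
    have c1: "continuous_on {node (Suc k)..t} mu" using times by (intro interp.cont_sub) auto
    have c0: "continuous_on {node k..t} mu" using times by (intro interp.cont_sub) auto
    have mono: "Im (u (node (Suc k))) \<le> Im (u (node k))" by (rule traj_Im_antimono[OF u0 times(2)])
    have P3: "8 * P \<le> 512 * P ^ 3"
    proof -
      have "P * 1 \<le> P * P\<^sup>2" using P by (intro mult_left_mono) auto
      then show ?thesis using P by (simp add: power3_eq_cube power2_eq_square)
    qed
    have "y / (512 * P ^ 3) \<le> Im (u (node k))"
    proof (cases "64 * P\<^sup>2 * sqrt \<sigma> \<le> y")
      case True
      define M where "M = y / (64 * P)"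
      have M: "0 < M" using y P by (simp add: M_def)
      have "P * sqrt \<sigma> \<le> M" using True P by (simp add: M_def le_divide_eq power2_eq_square mult_ac)
      moreover have "1 * sqrt \<sigma> \<le> P * sqrt \<sigma>" using P \<sigma> by (intro mult_right_mono) auto
      ultimately have "sqrt \<sigma> \<le> M" by simp
      then have "\<sigma> \<le> M\<^sup>2" using \<sigma> by (metis real_sqrt_le_iff real_sqrt_abs abs_of_pos M)
      have "cmod (u (node (Suc k)) - mu (node (Suc k))) \<le> cmod (u t - mu t) + 4 * M"
        by (rule traj_displacement[OF u1 c1 M])
          (use osc1 \<open>P * sqrt \<sigma> \<le> M\<close> \<open>\<sigma> \<le> M\<^sup>2\<close> times order_trans in \<open>auto simp: \<sigma>_def\<close>)
      also have "\<dots> \<le> y / (16 * P) + y / (16 * P)"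
        using w(2) u(2) True by (simp add: \<delta>_def M_def)
      also have "\<dots> = y / (8 * P)" by simp
      finally have "y / (8 * P) \<le> Im (u (node k))"
        using piece_height[of k "1 / real n" u] k n_pos u0 unfolding node_Suc[symmetric] sy by simp
      moreover have "y / (512 * P ^ 3) \<le> y / (8 * P)" using P3 P y by (intro divide_left_mono) auto
      ultimately show ?thesis by simp
    next
      case False
      then have \<sigma>0: "0 < \<sigma>" using \<sigma> y by (cases "\<sigma> = 0") auto
      have "sqrt \<sigma> / (8 * P) \<le> Im (u (node (Suc k)))"
        by (rule piece_height[of "Suc k" \<sigma> u])
          (use k \<sigma>0 \<sigma> u1 w(2) u(2) False in \<open>auto simp: t_eq[symmetric] \<delta>_def\<close>)
      moreover have "y / (512 * P ^ 3) \<le> sqrt \<sigma> / (8 * P)"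
      proof -
        have "y * (8 * P) \<le> 64 * P\<^sup>2 * sqrt \<sigma> * (8 * P)" using False P by (intro mult_right_mono) auto
        also have "\<dots> = sqrt \<sigma> * (512 * P ^ 3)" by (simp add: power2_eq_square power3_eq_cube)
        finally show ?thesis using P by (simp add: divide_le_eq le_divide_eq mult_ac)
      qed
      ultimately show ?thesis using mono by simp
    qed
    moreover have "cmod (u (node k) - mu (node k)) \<le> 9 * P * y"
    proof -
      have "cmod (u (node k) - mu (node k)) \<le> cmod (u t - mu t) + 4 * (2 * P * y)"
      proof (rule traj_displacement[OF u(1) c0])
        fix s assume s: "s \<in> {node k..t}"
        have o1: "\<bar>mu s - mu (node (Suc k))\<bar> \<le> P * y" if "node (Suc k) \<le> s"
          using mu_osc'[of "Suc k" s] k that s t by (simp add: y_def)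
        have o2: "\<bar>mu r - mu (node k)\<bar> \<le> P * y" if "r \<in> {node k..node (Suc k)}" for r
          using mu_osc'[of k r] k that by (simp add: y_def)
        have "0 \<le> P * y" using P y by simp
        then show "\<bar>mu s - mu (node k)\<bar> \<le> 2 * P * y"
          using o1 o2[of s] o2[of "node (Suc k)"] s times(2) by (cases "node (Suc k) \<le> s") auto
      next
        have "t - node k \<le> 2 * y\<^sup>2" using \<sigma> node_Suc[of k] t_eq y by simp
        also have "\<dots> \<le> (2 * P * y)\<^sup>2"
        proof -
          have "1 * y\<^sup>2 \<le> P\<^sup>2 * y\<^sup>2" using P by (intro mult_right_mono) auto
          moreover have "0 \<le> P\<^sup>2 * y\<^sup>2" "(2 * P * y)\<^sup>2 = 4 * (P\<^sup>2 * y\<^sup>2)" by (simp_all add: power_mult_distrib)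
          ultimately show ?thesis by linarith
        qed
        finally show "t - node k \<le> (2 * P * y)\<^sup>2" .
      qed (use P y times in auto)
      also have "\<dots> \<le> y + 8 * P * y" using w(2) \<delta>(2) u(2) by simp
      also have "\<dots> \<le> 9 * P * y" using P y by simp
      finally show ?thesis .
    qed
    ultimately show "1 / sqrt (real n) / (512 * P ^ 3) \<le> Im (bflow mu (node k) t w) \<and>
      cmod (bflow mu (node k) t w - mu (node k)) \<le> 9 * P * (1 / sqrt (real n))"
      unfolding u(3) y_def by simp
  qed
qed

end

section \<open>Comparison of two flows\<close>

text \<open>Integrated along a trajectory, the right-hand side becomes a quarter of the logarithm of
  the modulus of the derivative plus a quarter of the logarithmic change of height.\<close>

lemma Re_two_divide_sq:
  fixes z :: complex
  assumes "z \<noteq> 0"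
  shows "(Re (2 / (z * z)) + 2 / (cmod z)\<^sup>2) / 4 = (Re z)\<^sup>2 / (cmod z)^4"
proof -
  have n: "(cmod z)\<^sup>2 = (Re z)\<^sup>2 + (Im z)\<^sup>2" by (rule cmod_power2)
  have n0: "(cmod z)\<^sup>2 \<noteq> 0" using assms by simp
  have "cmod (z * z) ^ 2 = ((cmod z)\<^sup>2)\<^sup>2" by (simp add: norm_mult power2_eq_square)
  then have "Re (2 / (z * z)) = 2 * ((Re z)\<^sup>2 - (Im z)\<^sup>2) / ((cmod z)\<^sup>2)\<^sup>2"
    by (simp add: Re_divide' power2_eq_square)
  moreover have "2 / (cmod z)\<^sup>2 = 2 * ((Re z)\<^sup>2 + (Im z)\<^sup>2) / ((cmod z)\<^sup>2)\<^sup>2"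
    using n0 unfolding n[symmetric] by (simp add: power2_eq_square)
  ultimately have "Re (2 / (z * z)) + 2 / (cmod z)\<^sup>2 = 4 * (Re z)\<^sup>2 / ((cmod z)\<^sup>2)\<^sup>2"
    by (simp only: add_divide_distrib[symmetric]) simp
  then show ?thesis by simp
qed

text \<open>The product of the imaginary parts enters with a negative sign and is dropped. What
  remains is 2pq with p = Re z / |z|^2 and q = Re w / |w|^2, to which the weighted AM-GM inequality
  applies.\<close>

lemma Re_two_divide_mult_le:
  fixes z w :: complex
  assumes "z \<noteq> 0" "w \<noteq> 0" "0 < Im z" "0 < Im w" "0 < a"
  shows "Re (2 / (z * w)) \<le> a * ((Re z)\<^sup>2 / (cmod z)^4) + (Re w)\<^sup>2 / (cmod w)^4 / a"
proof -
  define p where "p = Re z / (cmod z)\<^sup>2"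
  define q where "q = Re w / (cmod w)\<^sup>2"
  have "Re (2 / (z * w)) = 2 * (Re z * Re w - Im z * Im w) / ((cmod z)\<^sup>2 * (cmod w)\<^sup>2)"
    by (simp add: Re_divide' norm_mult power_mult_distrib)
  also have "\<dots> \<le> 2 * (Re z * Re w) / ((cmod z)\<^sup>2 * (cmod w)\<^sup>2)"
    using assms by (intro divide_right_mono) auto
  also have "\<dots> = 2 * p * q" by (simp add: p_def q_def)
  also have "\<dots> \<le> a * p\<^sup>2 + q\<^sup>2 / a"
  proof -
    have "0 \<le> (a * p - q)\<^sup>2 / a" using assms by simp
    also have "\<dots> = a * p\<^sup>2 + q\<^sup>2 / a - 2 * p * q"
      using assms by (simp add: field_simps power2_eq_square)
    finally show ?thesis by simp
  qed
  finally show ?thesis by (simp add: p_def q_def power_divide)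
qed

text \<open>The factor \<open>exp (Re \<integral> \<psi>)\<close> by which the distance of two flows can grow is split by
  the weighted AM-GM inequality into two parts, each controlled by the derivative and the height
  of one of the flows.\<close>

lemma traj_compare:
  assumes u: "traj lam 0 t u" and v: "traj mu 0 t v"
    and cl: "continuous_on {0..t} lam" and cm: "continuous_on {0..t} mu"
    and end_eq: "u t = v t" and t: "0 \<le> t" and \<epsilon>: "0 \<le> \<epsilon>"
    and close: "\<And>s. s \<in> {0..t} \<Longrightarrow> \<bar>lam s - mu s\<bar> \<le> \<epsilon>" and a: "0 < a"
  defines "p \<equiv> ln (Im (u 0)) - ln (Im (u t))" and "q \<equiv> ln (Im (v 0)) - ln (Im (v t))"
    and "A \<equiv> Re (integral {0..t} (\<lambda>s. 2 / ((u s - lam s) * (u s - lam s))))"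
    and "B \<equiv> Re (integral {0..t} (\<lambda>s. 2 / ((v s - mu s) * (v s - mu s))))"
  shows "cmod (u 0 - v 0) \<le> \<epsilon> * ((p + q) / 2) * exp (a * (A + p) / 4 + (B + q) / (4 * a))"
proof -
  define z where "z = (\<lambda>s. u s - lam s)"
  define w where "w = (\<lambda>s. v s - mu s)"
  have zc: "continuous_on {0..t} z" and wc: "continuous_on {0..t} w"
    unfolding z_def w_def by (intro traj_quotient_cont u v cl cm)+
  have znz: "z s \<noteq> 0" "0 < Im (z s)" if "s \<in> {0..t}" for s using trajD[OF u that] by (auto simp: z_def)
  have wnz: "w s \<noteq> 0" "0 < Im (w s)" if "s \<in> {0..t}" for s using trajD[OF v that] by (auto simp: w_def)
  define \<psi> where "\<psi> = (\<lambda>s. 2 / (z s * w s))"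
  have \<psi>c: "continuous_on {0..t} \<psi>" unfolding \<psi>_def using znz wnz by (intro continuous_intros zc wc) auto
  define \<kappa> where "\<kappa> = (\<lambda>s. a * ((Re (z s))\<^sup>2 / (cmod (z s))^4) + (Re (w s))\<^sup>2 / (cmod (w s))^4 / a)"
  define E where "E = a * (A + p) / 4 + (B + q) / (4 * a)"
  have half: "((\<lambda>s. (Re (z s))\<^sup>2 / (cmod (z s))^4) has_integral
      (Re (integral {0..t} (\<lambda>s. 2 / (z s * z s))) + r) / 4) {0..t}"
    if "continuous_on {0..t} z" "\<And>s. s \<in> {0..t} \<Longrightarrow> z s \<noteq> 0"
      "((\<lambda>s. 2 / (cmod (z s))\<^sup>2) has_integral r) {0..t}" for z :: "real \<Rightarrow> complex" and r
  proof -
    have "(\<lambda>s. 2 / (z s * z s)) integrable_on {0..t}"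
      using that by (intro integrable_continuous_interval continuous_intros) auto
    from has_integral_linear[OF integrable_integral[OF this] bounded_linear_Re]
    have "((\<lambda>s. Re (2 / (z s * z s))) has_integral Re (integral {0..t} (\<lambda>s. 2 / (z s * z s)))) {0..t}"
      by (simp add: o_def)
    from has_integral_divide[OF has_integral_add[OF this that(3)], of 4]
    show ?thesis
    proof (rule has_integral_eq[rotated])
      fix s assume "s \<in> {0..t}"
      then show "(Re (2 / (z s * z s)) + 2 / (cmod (z s))\<^sup>2) / 4 = (Re (z s))\<^sup>2 / (cmod (z s))^4"
        by (intro Re_two_divide_sq that(2))
    qed
  qed
  have pz: "((\<lambda>s. 2 / (cmod (z s))\<^sup>2) has_integral p) {0..t}"
    and qw: "((\<lambda>s. 2 / (cmod (w s))\<^sup>2) has_integral q) {0..t}"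
    unfolding p_def q_def z_def w_def by (rule traj_ln_Im[OF u t], rule traj_ln_Im[OF v t])
  have A: "A = Re (integral {0..t} (\<lambda>s. 2 / (z s * z s)))"
    and B: "B = Re (integral {0..t} (\<lambda>s. 2 / (w s * w s)))"
    unfolding A_def B_def z_def w_def by (rule refl)+
  have "(\<kappa> has_integral a * ((A + p) / 4) + (B + q) / 4 / a) {0..t}"
    unfolding \<kappa>_def A B
    by (intro has_integral_add has_integral_mult_right has_integral_divide
      half[OF zc znz(1) pz] half[OF wc wnz(1) qw])
  then have \<kappa>: "(\<kappa> has_integral E) {0..t}" by (simp add: E_def)
  have \<kappa>0: "0 \<le> \<kappa> s" for s using a by (simp add: \<kappa>_def)
  \<comment> \<open>The bound is needed at all intermediate times. Since \<kappa> is nonnegative,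
    its integral over [0,s] is at most the one over [0,t].\<close>
  have ReP: "Re (integral {0..s} \<psi>) \<le> E" if s: "s \<in> {0..t}" for s
  proof -
    have "\<psi> integrable_on {0..s}"
      by (intro integrable_continuous_interval continuous_on_subset[OF \<psi>c]) (use s in auto)
    from has_integral_linear[OF integrable_integral[OF this] bounded_linear_Re]
    have i: "((\<lambda>s. Re (\<psi> s)) has_integral Re (integral {0..s} \<psi>)) {0..s}" by (simp add: o_def)
    have \<kappa>s: "\<kappa> integrable_on {0..s}"
      by (rule integrable_on_subinterval[OF has_integral_integrable[OF \<kappa>]]) (use s in auto)
    have "Re (integral {0..s} \<psi>) \<le> integral {0..s} \<kappa>"
    proof (rule has_integral_le[OF i integrable_integral[OF \<kappa>s]])
      fix r assume "r \<in> {0..s}"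
      then have r: "r \<in> {0..t}" using s by auto
      show "Re (\<psi> r) \<le> \<kappa> r" unfolding \<psi>_def \<kappa>_def
        by (rule Re_two_divide_mult_le) (use znz[OF r] wnz[OF r] a in auto)
    qed
    also have "\<dots> \<le> E"
      by (rule has_integral_subset_le[OF _ integrable_integral[OF \<kappa>s] \<kappa>]) (use s \<kappa>0 in auto)
    finally show ?thesis .
  qed
  \<comment> \<open>Variation of constants for (u - v)' = - \<psi> (u - v) + \<psi> (lam - mu), with
    integrating factor exp of the integral of \<psi>.\<close>
  define Q where "Q = (\<lambda>s. (u s - v s) * exp (integral {0..s} \<psi>))"
  define Q' where "Q' = (\<lambda>s. exp (integral {0..s} \<psi>) * \<psi> s * of_real (lam s - mu s))"
  have "(Q' has_integral (Q t - Q 0)) {0..t}"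
  proof (rule fundamental_theorem_of_calculus[OF t])
    fix s assume s: "s \<in> {0..t}"
    note e = has_vector_derivative_exp_integral[OF \<psi>c s]
    have "(Q has_vector_derivative (u s - v s) * (\<psi> s * exp (integral {0..s} \<psi>)) +
       (2 / (u s - lam s) - 2 / (v s - mu s)) * exp (integral {0..s} \<psi>))
       (at s within {0..t})"
      unfolding Q_def
      by (intro has_vector_derivative_mult has_vector_derivative_diff e trajD(2)[OF u s] trajD(2)[OF v s])
    moreover have "2 / (u s - lam s) - 2 / (v s - mu s) = - \<psi> s * (z s - w s)"
      unfolding \<psi>_def z_def w_def using two_divide_diff[OF trajD(3)[OF u s] trajD(3)[OF v s]] by simp
    moreover have "z s - w s = (u s - v s) - of_real (lam s - mu s)" by (simp add: z_def w_def)
    ultimately show "(Q has_vector_derivative Q' s) (at s within {0..t})"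
      unfolding Q'_def by (simp add: algebra_simps)
  qed
  then have Q': "Q' integrable_on {0..t}" "integral {0..t} Q' = Q t - Q 0"
    by (auto simp: integral_unique)
  \<comment> \<open>|\<psi>| is at most the mean of the kernels 2/|z|^2 and 2/|w|^2, whose integrals
    are p and q. Integrating |\<psi>| thus costs only the logarithmic factor (p + q)/2.\<close>
  define G where "G = (\<lambda>s. \<epsilon> * exp E * ((2 / (cmod (z s))\<^sup>2 + 2 / (cmod (w s))\<^sup>2) / 2))"
  have G: "(G has_integral \<epsilon> * exp E * ((p + q) / 2)) {0..t}" unfolding G_def
    by (intro has_integral_mult_right has_integral_divide has_integral_add pz qw)
  have "cmod (integral {0..t} Q') \<le> integral {0..t} G"
  proof (rule integral_norm_bound_integral[OF Q'(1) has_integral_integrable[OF G]])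
    fix s assume s: "s \<in> {0..t}"
    have "cmod (\<psi> s) \<le> (2 / (cmod (z s))\<^sup>2 + 2 / (cmod (w s))\<^sup>2) / 2"
    proof -
      have "0 \<le> (1 / cmod (z s) - 1 / cmod (w s))\<^sup>2" by simp
      then show ?thesis
        by (simp add: \<psi>_def norm_mult norm_divide power2_diff power_divide)
    qed
    then have "exp (Re (integral {0..s} \<psi>)) * cmod (\<psi> s) * \<bar>lam s - mu s\<bar>
        \<le> exp E * ((2 / (cmod (z s))\<^sup>2 + 2 / (cmod (w s))\<^sup>2) / 2) * \<epsilon>"
      using ReP[OF s] close[OF s] by (intro mult_mono) auto
    then show "cmod (Q' s) \<le> G s" unfolding Q'_def G_def norm_mult norm_exp_eq_Re norm_of_real
      by (simp only: mult_ac)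
  qed
  also have "\<dots> = \<epsilon> * exp E * ((p + q) / 2)" using G by (rule integral_unique)
  finally have "cmod (Q t - Q 0) \<le> \<epsilon> * ((p + q) / 2) * exp E" unfolding Q'(2) by (simp only: mult_ac)
  moreover have "Q t = 0" "Q 0 = u 0 - v 0" using end_eq by (auto simp: Q_def)
  ultimately show ?thesis unfolding E_def by (simp add: norm_minus_commute)
qed

section \<open>The rate of convergence\<close>

lemma subpowerD:
  assumes "subpower \<phi>"
  shows "0 \<le> x \<Longrightarrow> 0 \<le> \<phi> x" "0 \<le> x \<Longrightarrow> x \<le> y \<Longrightarrow> \<phi> x \<le> \<phi> y"
    "0 < \<nu> \<Longrightarrow> ((\<lambda>x. x powr (- \<nu>) * \<phi> x) \<longlongrightarrow> 0) at_top"
  using assms by (auto simp: subpower_def mono_on_def)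

lemma subpowerI:
  assumes "\<And>x. 0 \<le> x \<Longrightarrow> 0 \<le> \<phi> x" "\<And>x y. 0 \<le> x \<Longrightarrow> x \<le> y \<Longrightarrow> \<phi> x \<le> \<phi> y"
    "\<And>\<nu>. 0 < \<nu> \<Longrightarrow> ((\<lambda>x. x powr (- \<nu>) * \<phi> x) \<longlongrightarrow> 0) at_top"
  shows "subpower \<phi>"
  using assms by (auto simp: subpower_def mono_on_def)

lemma tendsto_neg_powr_at_top:
  assumes "0 < (\<nu>::real)" shows "((\<lambda>x. x powr (- \<nu>)) \<longlongrightarrow> 0) at_top"
  using assms by (intro tendsto_neg_powr filterlim_ident) auto

lemma subpower_const:
  assumes "0 \<le> c" shows "subpower (\<lambda>_. c)"
proof (rule subpowerI)
  fix \<nu> :: real assume "0 < \<nu>"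
  from tendsto_mult_right[OF tendsto_neg_powr_at_top[OF this], of c]
  show "((\<lambda>x. x powr (- \<nu>) * c) \<longlongrightarrow> 0) at_top" by simp
qed (use assms in auto)

lemma subpower_add:
  assumes "subpower \<phi>" "subpower \<psi>" shows "subpower (\<lambda>x. \<phi> x + \<psi> x)"
proof (rule subpowerI)
  fix \<nu> :: real assume "0 < \<nu>"
  from tendsto_add[OF subpowerD(3)[OF assms(1) this] subpowerD(3)[OF assms(2) this]]
  show "((\<lambda>x. x powr (- \<nu>) * (\<phi> x + \<psi> x)) \<longlongrightarrow> 0) at_top" by (simp add: distrib_left)
next
  fix x y :: real assume "0 \<le> x" "x \<le> y"
  then show "\<phi> x + \<psi> x \<le> \<phi> y + \<psi> y" by (intro add_mono subpowerD(2)[OF assms(1)] subpowerD(2)[OF assms(2)])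
qed (use subpowerD(1)[OF assms(1)] subpowerD(1)[OF assms(2)] in auto)

lemma subpower_mult:
  assumes "subpower \<phi>" "subpower \<psi>" shows "subpower (\<lambda>x. \<phi> x * \<psi> x)"
proof (rule subpowerI)
  fix \<nu> :: real assume "0 < \<nu>"
  then have "0 < \<nu> / 2" by simp
  from tendsto_mult[OF subpowerD(3)[OF assms(1) this] subpowerD(3)[OF assms(2) this]]
  have "((\<lambda>x. (x powr (- (\<nu> / 2)) * \<phi> x) * (x powr (- (\<nu> / 2)) * \<psi> x)) \<longlongrightarrow> 0) at_top" by simp
  moreover have "(x powr (- (\<nu> / 2)) * \<phi> x) * (x powr (- (\<nu> / 2)) * \<psi> x) = x powr (- \<nu>) * (\<phi> x * \<psi> x)" for x
  proof -
    have "x powr (- (\<nu> / 2)) * x powr (- (\<nu> / 2)) = x powr (- \<nu>)" unfolding powr_add[symmetric] by simp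
    then have "(x powr (- (\<nu> / 2)) * x powr (- (\<nu> / 2))) * (\<phi> x * \<psi> x) = x powr (- \<nu>) * (\<phi> x * \<psi> x)"
      by (simp only:)
    then show ?thesis by (simp only: mult_ac)
  qed
  ultimately show "((\<lambda>x. x powr (- \<nu>) * (\<phi> x * \<psi> x)) \<longlongrightarrow> 0) at_top" by simp
next
  fix x y :: real assume xy: "0 \<le> x" "x \<le> y"
  show "\<phi> x * \<psi> x \<le> \<phi> y * \<psi> y"
    using xy by (intro mult_mono subpowerD(2)[OF assms(1)] subpowerD(2)[OF assms(2)]
      subpowerD(1)[OF assms(1)] subpowerD(1)[OF assms(2)]) auto
qed (use subpowerD(1)[OF assms(1)] subpowerD(1)[OF assms(2)] in auto)

lemma subpower_power:
  assumes "subpower \<phi>" shows "subpower (\<lambda>x. \<phi> x ^ N)"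
  by (induction N) (auto intro: subpower_const subpower_mult assms)

text \<open>The shift by 1 keeps the function nonnegative on the whole half-line. For the decay, ln
  x is bounded by a multiple of x^(\<nu>/2).\<close>

lemma subpower_ln: "subpower (\<lambda>x. ln (1 + x))"
proof (rule subpowerI)
  fix \<nu> :: real assume \<nu>: "0 < \<nu>"
  have "((\<lambda>x. x powr (- \<nu>) * ln 2 + x powr (- (\<nu> / 2)) * (2 / \<nu>)) \<longlongrightarrow> 0 * ln 2 + 0 * (2 / \<nu>)) at_top"
    using \<nu> by (intro tendsto_intros tendsto_neg_powr_at_top) auto
  then have lim: "((\<lambda>x. x powr (- \<nu>) * ln 2 + x powr (- (\<nu> / 2)) * (2 / \<nu>)) \<longlongrightarrow> 0) at_top" by simp
  show "((\<lambda>x. x powr (- \<nu>) * ln (1 + x)) \<longlongrightarrow> 0) at_top"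
  proof (rule Lim_null_comparison[OF _ lim])
    show "\<forall>\<^sub>F x in at_top. norm (x powr (- \<nu>) * ln (1 + x)) \<le> x powr (- \<nu>) * ln 2 + x powr (- (\<nu> / 2)) * (2 / \<nu>)"
      using eventually_ge_at_top[of 1]
    proof eventually_elim
      case (elim x)
      have "ln (1 + x) \<le> ln (2 * x)" using elim by simp
      also have "\<dots> = ln 2 + ln x" using elim by (simp add: ln_mult)
      also have "ln x \<le> x powr (\<nu> / 2) / (\<nu> / 2)" using elim \<nu> by (intro ln_powr_bound) auto
      finally have "x powr (- \<nu>) * ln (1 + x) \<le> x powr (- \<nu>) * (ln 2 + x powr (\<nu> / 2) / (\<nu> / 2))"
        by (intro mult_left_mono) auto
      also have "\<dots> = x powr (- \<nu>) * ln 2 + (x powr (- \<nu>) * x powr (\<nu> / 2)) * (2 / \<nu>)"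
        by (simp add: distrib_left)
      also have "x powr (- \<nu>) * x powr (\<nu> / 2) = x powr (- (\<nu> / 2))" unfolding powr_add[symmetric] by simp
      finally show ?case using elim by simp
    qed
  qed
qed auto

text \<open>A real \<open>Sup\<close> bounds the members of its set only if the set is bounded
  above, which compactness of [0,1] provides.\<close>

lemma weakly_holder_halfD:
  assumes hol: "weakly_holder_half \<phi> lam" and cont: "continuous_on {0..1} lam"
    and st: "s \<in> {0..1}" "t \<in> {0..1}" "\<bar>t - s\<bar> \<le> \<delta>" and \<delta>: "0 < \<delta>"
  shows "\<bar>lam t - lam s\<bar> \<le> sqrt \<delta> * \<phi> (1 / \<delta>)"
proof -
  let ?S = "{\<bar>lam t - lam s\<bar> | s t. s \<in> {0..1} \<and> t \<in> {0..1} \<and> \<bar>t - s\<bar> \<le> \<delta>}"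
  have "bounded (lam ` {0..1})" by (intro compact_imp_bounded compact_continuous_image cont) simp
  then obtain B where "\<forall>x\<in>lam ` {0..1}. norm x \<le> B" unfolding bounded_iff by blast
  then have B: "\<bar>lam r\<bar> \<le> B" if "r \<in> {0..1}" for r using that by simp
  have "bdd_above ?S"
  proof (rule bdd_aboveI)
    fix x assume "x \<in> ?S"
    then obtain s t where "x = \<bar>lam t - lam s\<bar>" "s \<in> {0..1}" "t \<in> {0..1}" by blast
    then show "x \<le> 2 * B" using B[of s] B[of t] by linarith
  qed
  then have "\<bar>lam t - lam s\<bar> \<le> Sup ?S" by (rule cSup_upper[rotated]) (use st in blast)
  also have "\<dots> \<le> sqrt \<delta> * \<phi> (1 / \<delta>)" using hol \<delta> by (simp add: weakly_holder_half_def)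
  finally show ?thesis .
qed

section \<open>Radial estimates for a single chain\<close>

context loewner_driver
begin

lemma bflow_distortion:
  assumes box: "distortion_bound C N" and t: "0 \<le> t" "t \<le> 1" and y: "0 < y" and R: "1 \<le> R"
    and v: "cmod (v - of_real a) \<le> R * y" "y / R \<le> Im v"
  shows "cmod (deriv (bflow lam 0 t) v) \<le> C * R ^ N * cmod (deriv (bflow lam 0 t) (Complex a y))"
    "cmod (bflow lam 0 t v - bflow lam 0 t (Complex a y))
      \<le> C * R ^ N * y * cmod (deriv (bflow lam 0 t) (Complex a y))"
proof -
  have "\<bar>Re v - a\<bar> \<le> R * y" "Im v \<le> R * y"
    using v(1) abs_Re_le_cmod[of "v - of_real a"] abs_Im_le_cmod[of "v - of_real a"] by auto
  moreover have "bflow lam 0 t holomorphic_on upper_half_plane" "inj_on (bflow lam 0 t) upper_half_plane"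
    using t by (auto intro: bflow_holomorphic bflow_inj)
  ultimately show "cmod (deriv (bflow lam 0 t) v) \<le> C * R ^ N * cmod (deriv (bflow lam 0 t) (Complex a y))"
    "cmod (bflow lam 0 t v - bflow lam 0 t (Complex a y))
      \<le> C * R ^ N * y * cmod (deriv (bflow lam 0 t) (Complex a y))"
    using box y R v(2) unfolding distortion_bound_def by blast+
qed

text \<open>The derivative bound is integrated along a vertical segment; \<beta> < 1 makes the
  resulting bound independent of the lower end.\<close>

lemma bflow_vertical:
  assumes t: "0 \<le> t" "t \<le> 1" and c: "0 < c\<^sub>0" and \<beta>: "\<beta> < 1"
    and der: "\<And>y. 0 < y \<Longrightarrow> y \<le> y\<^sub>0 \<Longrightarrow>
      cmod (deriv (bflow lam 0 t) (Complex (lam t) y)) \<le> c\<^sub>0 * y powr (- \<beta>)"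
    and y: "0 < y'" "y' \<le> y" "y \<le> y\<^sub>0"
  shows "cmod (bflow lam 0 t (Complex (lam t) y) - bflow lam 0 t (Complex (lam t) y'))
    \<le> c\<^sub>0 / (1 - \<beta>) * y powr (1 - \<beta>)"
proof (cases "y' = y")
  case True
  then show ?thesis using c \<beta> by simp
next
  case False
  define F where "F = (\<lambda>s. bflow lam 0 t (Complex (lam t) s))"
  define F' where "F' = (\<lambda>s. \<i> * deriv (bflow lam 0 t) (Complex (lam t) s))"
  have dF: "(F has_vector_derivative F' s) (at s)" if s: "0 < s" for s
  proof -
    have d: "(bflow lam 0 t has_field_derivative deriv (bflow lam 0 t) (Complex (lam t) s)) (at (Complex (lam t) s))"
      by (rule holomorphic_derivI[OF bflow_holomorphic open_upper_half_plane]) (use t s in auto)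
    have "((\<lambda>s. Complex (lam t) s) has_vector_derivative \<i>) (at s)"
      unfolding Complex_eq by (auto intro!: derivative_eq_intros)
    from field_vector_diff_chain_at[OF this d] show ?thesis by (simp add: o_def F_def F'_def)
  qed
  have "cmod (F y - F y') \<le> c\<^sub>0 / (1 - \<beta>) * y powr (1 - \<beta>) - c\<^sub>0 / (1 - \<beta>) * y' powr (1 - \<beta>)"
  proof (rule differentiable_bound_general[of y' y F "\<lambda>s. c\<^sub>0 / (1 - \<beta>) * s powr (1 - \<beta>)" F' "\<lambda>s. c\<^sub>0 * s powr (- \<beta>)"])
    show "continuous_on {y'..y} F"
    proof (rule continuous_on_vector_derivative[OF has_vector_derivative_at_within])
      fix s assume "s \<in> {y'..y}"
      then show "(F has_vector_derivative F' s) (at s)" using dF y by simp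
    qed
    show "continuous_on {y'..y} (\<lambda>s. c\<^sub>0 / (1 - \<beta>) * s powr (1 - \<beta>))"
      using y by (intro continuous_intros) auto
    fix s assume s: "y' < s" "s < y"
    show "(F has_vector_derivative F' s) (at s)" using dF s y by simp
    have "((\<lambda>s. c\<^sub>0 / (1 - \<beta>) * s powr (1 - \<beta>)) has_real_derivative
        c\<^sub>0 / (1 - \<beta>) * ((1 - \<beta>) * s powr (1 - \<beta> - 1))) (at s)"
      by (intro DERIV_cmult has_real_derivative_powr) (use s y in simp)
    then show "((\<lambda>s. c\<^sub>0 / (1 - \<beta>) * s powr (1 - \<beta>)) has_vector_derivative c\<^sub>0 * s powr (- \<beta>)) (at s)"
      unfolding has_real_derivative_iff_has_vector_derivative using \<beta> by simp
    show "cmod (F' s) \<le> c\<^sub>0 * s powr (- \<beta>)" using der[of s] s y by (simp add: F'_def norm_mult)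
  qed (use y False in simp)
  moreover have "0 \<le> c\<^sub>0 / (1 - \<beta>) * y' powr (1 - \<beta>)" using c \<beta> by simp
  ultimately show ?thesis unfolding F_def by linarith
qed

text \<open>With e = h^2, \<open>curve_point_near_tip\<close> gives a curve point \<gamma>(r) whose
  image under g_t agrees with lam(t) + ih up to the ratio 12 (1 + \<phi>(1/e)). By distortion its
  distance from the value at lam(t) + ih is h^(1-\<beta>) times a subpower factor, which tends to 0.
  The heights from h to y are covered by \<open>bflow_vertical\<close>.\<close>

lemma curve_point_radial:
  assumes box: "distortion_bound C N" and sp: "subpower \<phi>" and hol: "weakly_holder_half \<phi> lam"
    and t: "0 \<le> t" "t < 1" and c: "0 < c\<^sub>0" and \<beta>: "0 < \<beta>" "\<beta> < 1"
    and der: "\<And>y. 0 < y \<Longrightarrow> y \<le> y\<^sub>0 \<Longrightarrow>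
      cmod (deriv (bflow lam 0 t) (Complex (lam t) y)) \<le> c\<^sub>0 * y powr (- \<beta>)"
    and gen: "generated_by_curve lam \<gamma>" and y: "0 < y" "y \<le> y\<^sub>0"
  shows "cmod (\<gamma> t - bflow lam 0 t (Complex (lam t) y)) \<le> c\<^sub>0 / (1 - \<beta>) * y powr (1 - \<beta>)"
proof (rule field_le_epsilon)
  fix \<eta> :: real assume \<eta>: "0 < \<eta>"
  define F where "F = (\<lambda>s. bflow lam 0 t (Complex (lam t) s))"
  have C: "1 \<le> C" using box by (simp add: distortion_bound_def)
  \<comment> \<open>The distortion error as a function of x = 1/e, where h^(1-\<beta>) =
    x^(-(1-\<beta>)/2).\<close>
  define G where "G = (\<lambda>x. C * c\<^sub>0 * (x powr (- ((1 - \<beta>) / 2)) * (12 * (1 + \<phi> x)) ^ N))"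
  have "subpower (\<lambda>x. (12 * (1 + \<phi> x)) ^ N)"
    by (intro subpower_power subpower_mult subpower_const subpower_add sp) auto
  from tendsto_mult_right_zero[OF subpowerD(3)[OF this, of "(1 - \<beta>) / 2"], of "C * c\<^sub>0"]
  have "(G \<longlongrightarrow> 0) at_top" unfolding G_def using \<beta> by simp
  then have evG: "\<forall>\<^sub>F x in at_top. G x < \<eta> / 2" by (rule order_tendstoD) (use \<eta> in simp)
  have gc: "continuous_on {0..1} \<gamma>" using gen by (simp add: generated_by_curve_def)
  obtain d where d: "0 < d" "\<And>r. r \<in> {0..1} \<Longrightarrow> dist r t < d \<Longrightarrow> dist (\<gamma> r) (\<gamma> t) < \<eta> / 2"
    using gc t half_gt_zero[OF \<eta>] unfolding continuous_on_iff by (metis atLeastAtMost_iff less_imp_le)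
  \<comment> \<open>The entries ensure in turn that t + e stays in [0,1], that \<gamma>(r) is near
    \<gamma>(t), and that h \<le> y.\<close>
  define x0 where "x0 = max (1 / (1 - t)) (max (2 / d) (1 / y\<^sup>2))"
  obtain x where x: "x0 \<le> x" "G x < \<eta> / 2"
    using eventually_happens'[OF trivial_limit_at_top_linorder eventually_conj[OF evG eventually_ge_at_top[of x0]]] by auto
  have x_ge: "1 / (1 - t) \<le> x" "2 / d \<le> x" "1 / y\<^sup>2 \<le> x" using x(1) by (auto simp: x0_def)
  have "0 < 1 / y\<^sup>2" using y by simp
  then have x_pos: "0 < x" using x_ge(3) by linarith
  define e where "e = 1 / x"
  have e: "0 < e" "1 / e = x" using x_pos by (auto simp: e_def)
  from x_ge have e_le: "t + e \<le> 1" "e \<le> d / 2" "e \<le> y\<^sup>2"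
    using t d(1) y x_pos unfolding e_def by (auto simp: field_simps)
  define \<Phi> where "\<Phi> = 1 + \<phi> x"
  have \<phi>0: "0 \<le> \<phi> x" using subpowerD(1)[OF sp] x_pos by simp
  then have \<Phi>: "1 \<le> \<Phi>" by (simp add: \<Phi>_def)
  define h where "h = sqrt e"
  have h: "0 < h" "h\<^sup>2 = e" "h \<le> y" using e(1) real_sqrt_le_mono[OF e_le(3)] y by (auto simp: h_def)
  define M where "M = h * \<Phi>"
  have M: "0 < M" using h \<Phi> by (simp add: M_def)
  have osc: "\<bar>lam r - lam t\<bar> \<le> M" if r: "r \<in> {t..t + e}" for r
  proof -
    have "\<bar>lam r - lam t\<bar> \<le> sqrt e * \<phi> (1 / e)"
      by (rule weakly_holder_halfD[OF hol cont]) (use r t e e_le in auto)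
    also have "\<dots> \<le> M" unfolding M_def h_def e(2) \<Phi>_def using e(1) by (intro mult_left_mono) auto
    finally show ?thesis .
  qed
  have "h * 1 \<le> M" unfolding M_def using h \<Phi> by (intro mult_left_mono) auto
  then have "h\<^sup>2 \<le> M\<^sup>2" using h by (intro power_mono) auto
  then have short: "e \<le> M\<^sup>2" using h(2) by simp
  obtain r w where rw: "r \<in> {t..t + e}" "\<gamma> r = bflow lam 0 t w" "e / (12 * M) < Im w"
    "cmod (w - lam t) \<le> 4 * M"
    using curve_point_near_tip[OF gen t(1) e(1) e_le(1) M osc short] by blast
  have t1: "t \<le> 1" using t by simp
  have "cmod (bflow lam 0 t w - F h)
      \<le> C * (12 * \<Phi>) ^ N * h * cmod (deriv (bflow lam 0 t) (Complex (lam t) h))" unfolding F_def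
  proof (rule bflow_distortion(2)[OF box t(1) t1 h(1)])
    show "1 \<le> 12 * \<Phi>" using \<Phi> by simp
    show "cmod (w - lam t) \<le> 12 * \<Phi> * h" using rw(4) M unfolding M_def by (simp add: mult_ac)
    have "h / (12 * \<Phi>) = e / (12 * M)" unfolding M_def h(2)[symmetric] using h(1) by (simp add: power2_eq_square)
    then show "h / (12 * \<Phi>) \<le> Im w" using rw(3) by simp
  qed
  also have "\<dots> \<le> C * (12 * \<Phi>) ^ N * h * (c\<^sub>0 * h powr (- \<beta>))"
    using der[OF h(1)] h y C \<Phi> by (intro mult_left_mono) auto
  also have "\<dots> = C * c\<^sub>0 * ((h * h powr (- \<beta>)) * (12 * \<Phi>) ^ N)" by simp
  also have "h * h powr (- \<beta>) = x powr (- ((1 - \<beta>) / 2))"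
  proof -
    have "h = x powr (- (1 / 2))"
      using x_pos by (simp add: h_def e_def powr_minus powr_half_sqrt real_sqrt_divide inverse_eq_divide)
    then have "h powr (1 - \<beta>) = x powr (- ((1 - \<beta>) / 2))" by (simp add: powr_powr)
    moreover have "h * h powr (- \<beta>) = h powr (1 + - \<beta>)" using h(1) by (intro powr_mult_base) simp
    ultimately show ?thesis by simp
  qed
  finally have "cmod (bflow lam 0 t w - F h) < \<eta> / 2" using x(2) unfolding G_def \<Phi>_def by simp
  moreover have "dist (\<gamma> r) (\<gamma> t) < \<eta> / 2"
    by (rule d(2)) (use rw(1) t e_le d(1) e in \<open>auto simp: dist_real_def\<close>)
  moreover have "cmod (F y - F h) \<le> c\<^sub>0 / (1 - \<beta>) * y powr (1 - \<beta>)"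
    unfolding F_def by (rule bflow_vertical[OF t(1) t1 c \<beta>(2) der h(1,3) y(2)])
  moreover have "cmod (\<gamma> t - F y) \<le> cmod (\<gamma> t - \<gamma> r) + cmod (\<gamma> r - F h) + cmod (F h - F y)"
    using norm_triangle_ineq[of "\<gamma> t - \<gamma> r + (\<gamma> r - F h)" "F h - F y"]
      norm_triangle_ineq[of "\<gamma> t - \<gamma> r" "\<gamma> r - F h"] by simp
  moreover have "cmod (\<gamma> t - \<gamma> r) = dist (\<gamma> r) (\<gamma> t)" "cmod (F h - F y) = cmod (F y - F h)"
    by (simp_all add: dist_norm norm_minus_commute)
  ultimately have "cmod (\<gamma> t - F y) \<le> c\<^sub>0 / (1 - \<beta>) * y powr (1 - \<beta>) + \<eta>"
    unfolding rw(2)[symmetric] by linarith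
  then show "cmod (\<gamma> t - bflow lam 0 t (Complex (lam t) y)) \<le> c\<^sub>0 / (1 - \<beta>) * y powr (1 - \<beta>) + \<eta>"
    by (simp only: F_def)
qed

end

text \<open>The weight \<open>a = 1/x\<close> balances the derivative bound \<open>y\<^sup>-\<^sup>\<beta>\<close> for one
  flow against the trivial bound \<open>1/y\<close> for the other; this is where the exponent \<open>x\<close> comes from.\<close>

lemma bflow_compare:
  assumes lam: "loewner_driver lam" and mu: "loewner_driver mu" and s: "0 \<le> s" "s \<le> 1"
    and close: "\<And>r. r \<in> {0..s} \<Longrightarrow> \<bar>lam r - mu r\<bar> \<le> \<epsilon>" and \<epsilon>: "0 \<le> \<epsilon>"
    and y: "0 < y" "y \<le> 1" and w: "y / 2 \<le> Im w" "Im w \<le> 3 * y / 2"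
    and c: "1 \<le> c" and \<beta>: "0 < \<beta>"
    and der: "cmod (deriv (bflow lam 0 s) w) \<le> c * y powr (- \<beta>)"
  defines "x \<equiv> sqrt ((1 + \<beta>) / 2)"
  shows "cmod (bflow lam 0 s w - bflow mu 0 s w)
    \<le> \<epsilon> * (ln 6 - ln y) * exp (ln (6 * c) / (4 * x) + x * ln 6 / 2) * y powr (- x)"
proof -
  interpret lam: loewner_driver lam by fact
  interpret mu: loewner_driver mu by fact
  have w0: "0 < Im w" using y w by linarith
  obtain u where u: "traj lam 0 s u" "u s = w" "u 0 = bflow lam 0 s w"
    using lam.bflow_ex[of 0 s w] s w0 by auto
  obtain v where v: "traj mu 0 s v" "v s = w" "v 0 = bflow mu 0 s w"
    using mu.bflow_ex[of 0 s w] s w0 by auto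
  have x: "0 < x" "x\<^sup>2 = (1 + \<beta>) / 2" unfolding x_def using \<beta> by auto
  \<comment> \<open>Over a time of at most 1, a height of at most 3/2 grows to at most sqrt(9/4 + 4)
    < 3. Against the initial height of at least y/2 this is a ratio of at most 6/y.\<close>
  define \<Lambda> where "\<Lambda> = ln 6 - ln y"
  have height: "0 \<le> ln (Im (u 0)) - ln (Im (u s)) \<and> ln (Im (u 0)) - ln (Im (u s)) \<le> \<Lambda>"
    if u: "traj lam 0 s u" "u s = w" for lam u
  proof -
    have u0: "Im w \<le> Im (u 0)" using traj_Im_antimono[OF u(1) s(1)] u(2) by simp
    have "(Im w)\<^sup>2 \<le> (3 / 2)\<^sup>2" using w w0 y by (intro power_mono) auto
    then have "(Im (u 0))\<^sup>2 \<le> 3\<^sup>2" using traj_Im_sq[OF u(1) s(1)] u(2) s by (simp add: power2_eq_square)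
    then have "Im (u 0) \<le> 3" by (rule power2_le_imp_le) simp
    then have "ln (Im (u 0)) \<le> ln 3" using u0 w0 by simp
    moreover have "ln (y / 2) \<le> ln (Im w)" using w y by simp
    moreover have "ln (y / 2) = ln y - ln 2" using y by (simp add: ln_div)
    moreover have "ln 6 = ln 2 + ln (3::real)" using ln_mult[of 2 "3::real"] by simp
    moreover have "ln (Im w) \<le> ln (Im (u 0))" using u0 w0 by simp
    ultimately show ?thesis unfolding u(2) \<Lambda>_def by simp
  qed
  define p where "p = ln (Im (u 0)) - ln (Im (u s))"
  define q where "q = ln (Im (v 0)) - ln (Im (v s))"
  define A where "A = Re (integral {0..s} (\<lambda>r. 2 / ((u r - lam r) * (u r - lam r))))"
  define B where "B = Re (integral {0..s} (\<lambda>r. 2 / ((v r - mu r) * (v r - mu r))))"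
  have p: "0 \<le> p" "p \<le> \<Lambda>" and q: "0 \<le> q" "q \<le> \<Lambda>"
    using height[OF u(1,2)] height[OF v(1,2)] by (auto simp: p_def q_def)
  have lc: "continuous_on {0..s} lam" "continuous_on {0..s} mu"
    using s by (auto intro: lam.cont_sub mu.cont_sub)
  have A: "A \<le> ln c - \<beta> * ln y"
  proof -
    have "exp A = cmod (deriv (bflow lam 0 s) w)"
      unfolding A_def u(2)[symmetric] lam.bflow_deriv[OF order_refl s u(1)] by (simp add: norm_exp_eq_Re)
    also have "\<dots> \<le> c * y powr (- \<beta>)" by (rule der)
    also have "\<dots> = exp (ln c - \<beta> * ln y)" using c y by (simp add: powr_def exp_diff exp_minus field_simps)
    finally show ?thesis by simp
  qed
  \<comment> \<open>The trivial bound: the logarithm of the derivative is at most the logarithmic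
    change of height.\<close>
  have B: "B \<le> q"
  proof -
    have iq: "((\<lambda>r. 2 / (cmod (v r - mu r))\<^sup>2) has_integral q) {0..s}"
      unfolding q_def by (rule traj_ln_Im[OF v(1) s(1)])
    have "B \<le> cmod (integral {0..s} (\<lambda>r. 2 / ((v r - mu r) * (v r - mu r))))"
      unfolding B_def by (rule complex_Re_le_cmod)
    also have "\<dots> \<le> integral {0..s} (\<lambda>r. 2 / (cmod (v r - mu r))\<^sup>2)"
      by (intro integral_norm_bound_integral integrable_continuous_interval traj_kernel_cont[OF v(1) v(1) lc(2,2)]
          has_integral_integrable[OF iq]) (simp add: norm_divide norm_mult power2_eq_square)
    also have "\<dots> = q" by (rule integral_unique[OF iq])
    finally show ?thesis .
  qed
  have "cmod (u 0 - v 0) \<le> \<epsilon> * ((p + q) / 2) * exp (1 / x * (A + p) / 4 + (B + q) / (4 * (1 / x)))"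
    unfolding p_def q_def A_def B_def
    by (rule traj_compare[OF u(1) v(1) lc _ s(1) \<epsilon> close]) (use u v x in auto)
  also have "\<dots> \<le> \<epsilon> * \<Lambda> * exp (ln (6 * c) / (4 * x) + x * ln 6 / 2 + x * (- ln y))"
  proof (intro mult_mono)
    \<comment> \<open>Here 1 + \<beta> = 2 x^2. With a = 1/x each of the two parts contributes
      (x/2)(- ln y) up to constants; this choice minimises a (1 + \<beta>)/4 + 1/(2a).\<close>
    have "A + p \<le> ln (6 * c) - (1 + \<beta>) * ln y"
      using A p(2) c unfolding \<Lambda>_def by (simp add: ln_mult algebra_simps)
    also have "\<dots> = ln (6 * c) + 2 * x\<^sup>2 * (- ln y)" unfolding x(2) by simp
    finally have "1 / x * (A + p) / 4 \<le> 1 / x * (ln (6 * c) + 2 * x\<^sup>2 * (- ln y)) / 4"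
      using x(1) by (intro divide_right_mono mult_left_mono) auto
    also have "\<dots> = ln (6 * c) / (4 * x) + x * (- ln y) / 2"
      using x(1) by (simp add: field_simps power2_eq_square)
    finally have 1: "1 / x * (A + p) / 4 \<le> ln (6 * c) / (4 * x) + x * (- ln y) / 2" .
    have "(B + q) / (4 * (1 / x)) = x * (B + q) / 4" by simp
    also have "\<dots> \<le> x * (2 * \<Lambda>) / 4" using B q x(1) by (intro divide_right_mono mult_left_mono) auto
    also have "\<dots> = x * ln 6 / 2 + x * (- ln y) / 2" by (simp add: \<Lambda>_def algebra_simps diff_divide_distrib)
    finally have 2: "(B + q) / (4 * (1 / x)) \<le> x * ln 6 / 2 + x * (- ln y) / 2" .
    show "exp (1 / x * (A + p) / 4 + (B + q) / (4 * (1 / x)))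
        \<le> exp (ln (6 * c) / (4 * x) + x * ln 6 / 2 + x * (- ln y))" using 1 2 by simp
  qed (use p q \<epsilon> in auto)
  also have "\<dots> = \<epsilon> * \<Lambda> * exp (ln (6 * c) / (4 * x) + x * ln 6 / 2) * y powr (- x)"
  proof -
    have "exp (X + x * (- ln y)) = exp X * y powr (- x)" for X
      unfolding exp_add powr_def using y by simp
    then show ?thesis by (simp only: mult.assoc)
  qed
  finally show ?thesis unfolding u(3) v(3) \<Lambda>_def .
qed

text \<open>The constants K and m are fixed before the driver, y_0, the curves and n, which makes
  the subpower function of the theorem uniform. The time 1 is excluded because the tip lemmas need
  room after t.\<close>

lemma curve_rate:
  assumes sp: "subpower \<phi>" and c: "0 < c\<^sub>0" and \<beta>: "0 < \<beta>" "\<beta> < 1"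
  obtains K :: real and m :: nat where "0 \<le> K"
    "\<And>lam y\<^sub>0 \<gamma> \<gamma>' n t. \<lbrakk>continuous_on {0..1} lam; weakly_holder_half \<phi> lam;
       \<And>y t. 0 < y \<Longrightarrow> y \<le> y\<^sub>0 \<Longrightarrow> t \<in> {0..1} \<Longrightarrow>
         cmod (deriv (loewner_fhat lam t) (\<i> * of_real y)) \<le> c\<^sub>0 * y powr (- \<beta>);
       generated_by_curve lam \<gamma>; generated_by_curve (sqrt_interp lam n) \<gamma>';
       1 \<le> n; 1 / sqrt (real n) \<le> y\<^sub>0; 0 \<le> t; t < 1\<rbrakk>
     \<Longrightarrow> cmod (\<gamma>' t - \<gamma> t) \<le> K * (1 + \<phi> (real n)) ^ m * (1 + ln (1 + real n)) *
          (1 / sqrt (real n)) powr (1 - sqrt ((1 + \<beta>) / 2))"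
proof -
  obtain C :: real and N :: nat where box: "distortion_bound C N" using distortion_bound_ex by blast
  have C: "1 \<le> C" using box by (simp add: distortion_bound_def)
  define x where "x = sqrt ((1 + \<beta>) / 2)"
  \<comment> \<open>The last inequality lets the distortion errors of order y^(1-\<beta>) be
    absorbed into the main error y^(1-x).\<close>
  have x: "0 < x" "x < 1" "\<beta> \<le> x"
  proof -
    show "0 < x" "x < 1" using \<beta> unfolding x_def by (auto intro: real_less_lsqrt simp: real_sqrt_lt_1_iff)
    have "\<beta>\<^sup>2 \<le> (1 + \<beta>) / 2"
    proof -
      have "\<beta>\<^sup>2 \<le> \<beta>" using \<beta> by (simp add: power2_eq_square mult_left_le)
      also have "\<dots> \<le> (1 + \<beta>) / 2" using \<beta> by simp
      finally show ?thesis .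
    qed
    then show "\<beta> \<le> x" unfolding x_def by (rule real_le_rsqrt)
  qed
  \<comment> \<open>Distortion with ratio 2 carries the derivative bound from the centre to the disc
    of radius y/2; the summand 1 secures the hypothesis \<open>1 \<le> c\<close> of
    \<open>bflow_compare\<close>.\<close>
  define c1 where "c1 = C * 2 ^ N * c\<^sub>0 + 1"
  have c1: "1 \<le> c1" using C c by (simp add: c1_def)
  define K1 where "K1 = exp (ln (6 * c1) / (4 * x) + x * ln 6 / 2)"
  have K1: "0 < K1" by (simp add: K1_def)
  \<comment> \<open>The constants of \<open>step_a\<close> to \<open>step_d\<close>, and 10 for
    times up to 1/n.\<close>
  define K where "K = C * 512 ^ N * (c\<^sub>0 + 20 * K1) + 10 * K1 + C * 512 ^ N * c\<^sub>0 + c\<^sub>0 / (1 - \<beta>) + 10"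
  have pos: "0 \<le> C * 512 ^ N * (c\<^sub>0 + 20 * K1)" "0 \<le> C * 512 ^ N * c\<^sub>0" "0 \<le> c\<^sub>0 / (1 - \<beta>)"
    using C c K1 \<beta> by auto
  show thesis
  proof (rule that[of K "3 * N + 1"])
    show "0 \<le> K" using pos K1 by (simp add: K_def)
    fix lam y\<^sub>0 \<gamma> \<gamma>' and n :: nat and t :: real
    assume cont: "continuous_on {0..1} lam" and hol: "weakly_holder_half \<phi> lam"
      and der: "\<And>y t. 0 < y \<Longrightarrow> y \<le> y\<^sub>0 \<Longrightarrow> t \<in> {0..1} \<Longrightarrow>
         cmod (deriv (loewner_fhat lam t) (\<i> * of_real y)) \<le> c\<^sub>0 * y powr (- \<beta>)"
      and gen: "generated_by_curve lam \<gamma>" and gen': "generated_by_curve (sqrt_interp lam n) \<gamma>'"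
      and n: "1 \<le> n" and yy: "1 / sqrt (real n) \<le> y\<^sub>0" and t: "0 \<le> t" "t < 1"
    interpret loewner_driver lam by unfold_locales (rule cont)
    have der': "cmod (deriv (bflow lam 0 t) (Complex (lam t) y)) \<le> c\<^sub>0 * y powr (- \<beta>)"
      if "0 < y" "y \<le> y\<^sub>0" "0 \<le> t" "t \<le> 1" for y t
      using der[OF that(1,2), of t] deriv_loewner_fhat[OF that(3,4,1)] that by simp
    define y where "y = 1 / sqrt (real n)"
    have y: "0 < y" "y \<le> 1" "y\<^sup>2 = 1 / real n" "y \<le> y\<^sub>0"
      using n yy by (auto simp: y_def power_divide)
    have sqy: "sqrt (1 / real n) = y" by (simp add: y_def real_sqrt_divide)
    define P where "P = 1 + \<phi> (real n)"
    have \<phi>n: "0 \<le> \<phi> (real n)" by (rule subpowerD(1)[OF sp]) simp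
    have P: "1 \<le> P" using \<phi>n by (simp add: P_def)
    define L where "L = 1 + ln (1 + real n)"
    have L: "1 \<le> L" by (simp add: L_def)
    define q where "q = y powr (1 - x)"
    have q: "y \<le> q" "y powr (1 - \<beta>) \<le> q" "0 < q"
    proof -
      have "y powr 1 \<le> q" unfolding q_def using x y by (intro powr_mono') auto
      then show "y \<le> q" using y by simp
      show "y powr (1 - \<beta>) \<le> q" unfolding q_def using x y by (intro powr_mono') auto
      show "0 < q" using y by (simp add: q_def)
    qed
    define W where "W = P ^ (3 * N + 1) * L * q"
    have PLW: "P ^ j * L * q \<le> W" if "j \<le> 3 * N + 1" for j
      unfolding W_def using that P L q by (intro mult_right_mono power_increasing) auto
    have PW: "P ^ j * q \<le> W" if "j \<le> 3 * N + 1" for j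
    proof -
      have "P ^ j * 1 * q \<le> P ^ j * L * q" using P L q by (intro mult_right_mono mult_left_mono) auto
      then show ?thesis using PLW[OF that] by simp
    qed
    have W0: "0 \<le> W" using P L q by (simp add: W_def)
    have holder1: "\<bar>lam a - lam b\<bar> \<le> P * y" if "a \<in> {0..1}" "b \<in> {0..1}" "\<bar>a - b\<bar> \<le> 1 / real n" for a b
    proof -
      have "\<bar>lam a - lam b\<bar> \<le> sqrt (1 / real n) * \<phi> (1 / (1 / real n))"
        by (rule weakly_holder_halfD[OF hol cont]) (use that n in auto)
      also have "\<dots> = y * \<phi> (real n)" by (simp add: sqy)
      also have "\<dots> \<le> y * P" using y by (intro mult_left_mono) (auto simp: P_def)
      finally show ?thesis by (simp add: mult.commute)
    qed
    have holder2: "\<bar>lam a - lam b\<bar> \<le> 2 * P * y" if "a \<in> {0..1}" "b \<in> {0..1}" "\<bar>a - b\<bar> \<le> 2 / real n" for a b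
    proof -
      have "\<bar>lam a - lam b\<bar> \<le> sqrt (2 / real n) * \<phi> (1 / (2 / real n))"
        by (rule weakly_holder_halfD[OF hol cont]) (use that n in auto)
      also have "\<dots> \<le> (2 * y) * P"
      proof (intro mult_mono)
        have "sqrt (2 / real n) \<le> sqrt (4 * (1 / real n))" by (intro real_sqrt_le_mono) (simp add: divide_right_mono)
        also have "\<dots> = 2 * y" unfolding real_sqrt_mult sqy by simp
        finally show "sqrt (2 / real n) \<le> 2 * y" .
        \<comment> \<open>Over two steps the argument of \<phi> is n/2, and monotonicity brings it
          back to n.\<close>
        have "\<phi> (1 / (2 / real n)) \<le> \<phi> (real n)" by (rule subpowerD(2)[OF sp]) auto
        then show "\<phi> (1 / (2 / real n)) \<le> P" by (simp add: P_def)
        show "0 \<le> \<phi> (1 / (2 / real n))" by (rule subpowerD(1)[OF sp]) simp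
      qed (use y in simp)
      finally show ?thesis by (simp add: mult_ac)
    qed
    interpret sqrt_driver lam n P
    proof
      show "1 \<le> n" "1 \<le> P" by fact+
      fix k assume k: "k < n"
      have "\<bar>lam (real (k + 1) / real n) - lam (real k / real n)\<bar> \<le> P * y"
        by (rule holder1) (use k n in \<open>auto simp: divide_le_eq diff_divide_distrib[symmetric]\<close>)
      then show "\<bar>lam (real (k + 1) / real n) - lam (real k / real n)\<bar> \<le> P / sqrt (real n)"
        by (simp add: y_def)
    qed
    have PPy: "P / sqrt (real n) = P * y" by (simp add: y_def)
    have close: "\<bar>lam r - mu r\<bar> \<le> 2 * P * y" if r: "r \<in> {0..1}" for r
    proof -
      obtain k where k: "k < n" "r \<in> {node k..node (Suc k)}" using piece_ex[OF r] by blast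
      have "\<bar>mu r - mu (node k)\<bar> \<le> P * y" using mu_osc'[OF k] PPy by simp
      moreover have "mu (node k) = lam (node k)" by (rule mu_node) (use k in simp)
      moreover have "\<bar>lam r - lam (node k)\<bar> \<le> P * y"
        by (rule holder1) (use k r node_le_1[of k] node_nonneg[of k] node_Suc[of k] in auto)
      ultimately show ?thesis by linarith
    qed
    have yP2: "y\<^sup>2 \<le> (P * y)\<^sup>2"
    proof -
      have "1 * y \<le> P * y" using P y by (intro mult_right_mono) auto
      then show ?thesis using y by (intro power_mono) auto
    qed
    have Py0: "0 < P * y" using P y by simp
    have "cmod (\<gamma>' t - \<gamma> t) \<le> K * W"
    proof (cases "t \<le> 1 / real n")
      case True
      have tP: "t \<le> (P * y)\<^sup>2" using True yP2 y(3) by simp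
      have "cmod (\<gamma> t - lam 0) \<le> 5 * (P * y)"
        by (rule curve_point_early[OF gen t Py0 _ tP]) (use holder1 True t in auto)
      moreover have "cmod (\<gamma>' t - mu 0) \<le> 5 * (P * y)"
      proof (rule interp.curve_point_early[OF gen' t Py0 _ tP])
        fix r assume "r \<in> {0..t}"
        then show "\<bar>mu r - mu 0\<bar> \<le> P * y"
          using mu_osc'[of 0 r] n True PPy by (simp add: node_def)
      qed
      moreover have "mu 0 = lam 0" using mu_node[of 0] by (simp add: node_def)
      ultimately have "cmod (\<gamma>' t - \<gamma> t) \<le> 10 * (P * y)"
        using norm_triangle_ineq4[of "\<gamma>' t - lam 0" "\<gamma> t - lam 0"] by simp
      also have "\<dots> \<le> 10 * (P ^ 1 * q)" using P q(1) by simp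
      also have "\<dots> \<le> 10 * W" using PW[of 1] by simp
      also have "\<dots> \<le> K * W" using pos K1 W0 unfolding K_def by (intro mult_right_mono) auto
      finally show ?thesis .
    next
      case False
      obtain j where j: "j < n" "t \<in> {node j..node (Suc j)}" using piece_ex[of t] t by auto
      have "j \<noteq> 0"
      proof
        assume "j = 0"
        then show False using j(2) False by (simp add: node_def)
      qed
      then obtain k where jk: "j = Suc k" using not0_implies_Suc by blast
      have k: "Suc k < n" "t \<in> {node (Suc k)..node (Suc (Suc k))}" using j jk by auto
      define s where "s = node k"
      have s: "0 \<le> s" "s \<le> t" "s \<le> 1" "t \<le> s + 2 / real n" "t \<le> 1"
        using node_nonneg[of k] node_Suc[of k] node_Suc[of "Suc k"] k(2) node_mono[of k] t
        unfolding s_def by (auto simp: add_divide_distrib)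
      have mus: "mu s = lam s" unfolding s_def by (rule mu_node) (use k in simp)
      \<comment> \<open>This ratio covers both the height y/(512 P^3) and the distance 9 P y of
        \<open>tip_position\<close>. Its N-th power is the source of P^(3N); one further factor P
        comes from the distance of the drivers.\<close>
      define R where "R = 512 * P ^ 3"
      have P13: "P \<le> P ^ 3" using power_increasing[of 1 3 P] P by simp
      have R: "1 \<le> R" "9 * P \<le> R" using P P13 by (auto simp: R_def)
      have RN: "R ^ N = 512 ^ N * P ^ (3 * N)" by (simp add: R_def power_mult_distrib power_mult)
      define f where "f = bflow lam 0 s"
      define g where "g = bflow mu 0 s"
      define w0 where "w0 = Complex (lam s) y"
      have hf: "f holomorphic_on upper_half_plane" and hg: "g holomorphic_on upper_half_plane"
        unfolding f_def g_def using s by (auto intro: bflow_holomorphic interp.bflow_holomorphic)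
      define E where "E = 10 * K1 * P * L * q"
      have yq: "y * y powr (- x) = q" unfolding q_def using powr_mult_base[of y "- x"] y by simp
      have yb: "y * (c\<^sub>0 * y powr (- \<beta>)) \<le> c\<^sub>0 * q"
      proof -
        have "y * y powr (- \<beta>) = y powr (1 - \<beta>)" using powr_mult_base[of y "- \<beta>"] y by simp
        then show ?thesis using q(2) c by (metis mult.left_commute mult_le_cancel_left_pos)
      qed
      have derf: "cmod (deriv f w0) \<le> c\<^sub>0 * y powr (- \<beta>)"
        unfolding f_def w0_def using der'[OF y(1,4) s(1,3)] .
      have near: "cmod (f w - g w) \<le> E" if w: "cmod (w - w0) \<le> y / 2" for w
      proof -
        have im: "\<bar>Im w - y\<bar> \<le> y / 2" using abs_Im_le_cmod[of "w - w0"] w by (simp add: w0_def)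
        have "w - lam s = (w - w0) + \<i> * of_real y" by (simp add: w0_def complex_eq_iff)
        moreover have "cmod (w - w0 + \<i> * of_real y) \<le> cmod (w - w0) + y"
          using norm_triangle_ineq[of "w - w0" "\<i> * of_real y"] y by (simp add: norm_mult)
        ultimately have "cmod (w - lam s) \<le> cmod (w - w0) + y" by (simp only:)
        then have w2: "cmod (w - lam s) \<le> 2 * y" using w y(1) by linarith
        have imw: "y / 2 \<le> Im w" "Im w \<le> 3 * y / 2" using im unfolding abs_le_iff by linarith+
        have "cmod (deriv f w) \<le> C * 2 ^ N * cmod (deriv f w0)"
          unfolding f_def w0_def
          by (rule bflow_distortion(1)[OF box s(1,3) y(1) _ w2 imw(1)]) simp
        also have "\<dots> \<le> C * 2 ^ N * (c\<^sub>0 * y powr (- \<beta>))" using derf C by (intro mult_left_mono) auto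
        also have "\<dots> \<le> c1 * y powr (- \<beta>)" unfolding c1_def by (simp add: distrib_right)
        finally have derfw: "cmod (deriv f w) \<le> c1 * y powr (- \<beta>)" .
        \<comment> \<open>The main error: the distance 2 P y of the drivers times y^(-x) gives
          y^(1-x), and the logarithm goes into \<open>L\<close>.\<close>
        have "cmod (f w - g w) \<le> (2 * P * y) * (ln 6 - ln y) *
            exp (ln (6 * c1) / (4 * x) + x * ln 6 / 2) * y powr (- x)"
          unfolding f_def g_def x_def
        proof (rule bflow_compare[OF loewner_driver_axioms interp.loewner_driver_axioms s(1,3) _ _ y(1,2) imw c1 \<beta>(1)])
          show "\<bar>lam r - mu r\<bar> \<le> 2 * P * y" if "r \<in> {0..s}" for r
            by (rule close) (use that s in auto)
          show "0 \<le> 2 * P * y" using Py0 by simp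
          show "cmod (deriv (bflow lam 0 s) w) \<le> c1 * y powr (- \<beta>)"
            using derfw unfolding f_def .
        qed
        also have "\<dots> = 2 * P * (ln 6 - ln y) * K1 * q" unfolding K1_def[symmetric] yq[symmetric] by simp
        also have "\<dots> \<le> 2 * P * (5 * L) * K1 * q"
        proof (intro mult_right_mono mult_left_mono)
          have "ln 6 \<le> (5::real)" using ln_le_minus_one[of "6::real"] by simp
          moreover have "- ln y = ln (real n) / 2" using n by (simp add: y_def ln_div ln_sqrt)
          moreover have "0 \<le> ln (real n)" "ln (real n) \<le> ln (1 + real n)" using n by auto
          moreover have "l - l' \<le> 5 * (1 + b)" if "l \<le> 5" "- l' = a / 2" "0 \<le> a" "a \<le> b" for l l' a b :: real
            using that by (simp add: field_simps)
          ultimately show "ln 6 - ln y \<le> 5 * L" unfolding L_def by blast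
        qed (use P K1 q in auto)
        also have "\<dots> = E" by (simp add: E_def)
        finally show ?thesis .
      qed
      have inH: "w \<in> upper_half_plane" if "w \<in> cball w0 (y / 2)" for w
      proof -
        have "\<bar>Im w - y\<bar> \<le> y / 2"
          using abs_Im_le_cmod[of "w - w0"] that by (simp add: w0_def dist_norm norm_minus_commute)
        then have "0 < Im w" using y(1) unfolding abs_le_iff by linarith
        then show ?thesis by simp
      qed
      \<comment> \<open>Cauchy's inequality on radius y/2 bounds the difference of the derivatives
        by 2E/y; multiplied by y, this is again of the order of the main error.\<close>
      have derg: "y * cmod (deriv g w0) \<le> (c\<^sub>0 + 20 * K1) * (P * L * q)"
      proof -
        have "cmod ((deriv ^^ 1) (\<lambda>w. f w - g w) w0) \<le> fact 1 * E / (y / 2) ^ 1"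
        proof (rule Cauchy_inequality)
          show "(\<lambda>w. f w - g w) holomorphic_on ball w0 (y / 2)"
            by (intro holomorphic_intros holomorphic_on_subset[OF hf] holomorphic_on_subset[OF hg]) (use inH in auto)
          show "continuous_on (cball w0 (y / 2)) (\<lambda>w. f w - g w)"
            by (intro holomorphic_on_imp_continuous_on holomorphic_intros holomorphic_on_subset[OF hf]
                holomorphic_on_subset[OF hg]) (use inH in auto)
        qed (use y near in \<open>auto simp: norm_minus_commute\<close>)
        moreover have "w0 \<in> upper_half_plane" using y by (simp add: w0_def)
        then have "deriv (\<lambda>w. f w - g w) w0 = deriv f w0 - deriv g w0"
          using holomorphic_on_imp_differentiable_at[OF hf open_upper_half_plane] holomorphic_on_imp_differentiable_at[OF hg open_upper_half_plane]
          by (intro deriv_diff) auto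
        ultimately have "cmod (deriv f w0 - deriv g w0) \<le> 2 * E / y" by (simp add: mult.commute)
        then have "cmod (deriv g w0) \<le> c\<^sub>0 * y powr (- \<beta>) + 2 * E / y"
          using derf norm_triangle_ineq2[of "deriv g w0" "deriv f w0"] by (simp add: norm_minus_commute)
        then have "y * cmod (deriv g w0) \<le> y * (c\<^sub>0 * y powr (- \<beta>) + 2 * E / y)" using y by (intro mult_left_mono) auto
        also have "\<dots> = y * (c\<^sub>0 * y powr (- \<beta>)) + 2 * E" using y by (simp add: distrib_left)
        also have "\<dots> \<le> c\<^sub>0 * q + 2 * E" using yb by simp
        also have "\<dots> \<le> c\<^sub>0 * (P * L * q) + 2 * E"
        proof -
          have "1 * 1 * q \<le> P * L * q" using P L q by (intro mult_mono) auto
          then show ?thesis using c by simp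
        qed
        also have "\<dots> = (c\<^sub>0 + 20 * K1) * (P * L * q)" by (simp add: E_def algebra_simps)
        finally show ?thesis .
      qed
      \<comment> \<open>Points near the tip flow back to time s with hyperbolic distance O(log R)
        from \<open>w0\<close>, where distortion of \<open>g\<close> and \<open>derg\<close>
        apply.\<close>
      have step_a: "cmod (\<gamma>' t - g w0) \<le> C * 512 ^ N * (c\<^sub>0 + 20 * K1) * W"
      proof -
        obtain \<delta> where \<delta>: "0 < \<delta>"
          "\<And>w. \<lbrakk>0 < Im w; cmod (w - mu t) < \<delta>\<rbrakk> \<Longrightarrow>
            1 / sqrt (real n) / (512 * P ^ 3) \<le> Im (bflow mu s t w) \<and>
            cmod (bflow mu s t w - mu s) \<le> 9 * P * (1 / sqrt (real n))"
          using tip_position[OF k] unfolding s_def by blast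
        have "cmod (\<gamma>' t - g w0) \<le> C * R ^ N * y * cmod (deriv g w0)"
        proof (rule interp.curve_point_bound[OF gen' t \<delta>(1)])
          fix w assume w: "0 < Im w" "cmod (w - mu t) < \<delta>"
          define v where "v = bflow mu s t w"
          have v: "y / R \<le> Im v" "cmod (v - lam s) \<le> 9 * P * y"
            using \<delta>(2)[OF w] unfolding v_def R_def y_def mus by auto
          have "9 * P * y \<le> R * y" using R y by (intro mult_right_mono) auto
          then have "cmod (g v - g w0) \<le> C * R ^ N * y * cmod (deriv g w0)"
            unfolding g_def w0_def using v
            by (intro interp.bflow_distortion(2)[OF box s(1,3) y(1) R(1)]) auto
          moreover have "bflow mu 0 t w = g v"
            unfolding g_def v_def by (rule interp.bflow_comp[symmetric]) (use s w t in auto)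
          ultimately show "cmod (bflow mu 0 t w - g w0) \<le> C * R ^ N * y * cmod (deriv g w0)" by simp
        qed
        also have "\<dots> = C * R ^ N * (y * cmod (deriv g w0))" by simp
        also have "\<dots> \<le> C * R ^ N * ((c\<^sub>0 + 20 * K1) * (P * L * q))"
          using derg C R by (intro mult_left_mono) auto
        also have "\<dots> = C * 512 ^ N * (c\<^sub>0 + 20 * K1) * W" unfolding RN W_def by (simp add: mult_ac)
        finally show ?thesis .
      qed
      have step_b: "cmod (g w0 - f w0) \<le> 10 * K1 * W"
      proof -
        have "cmod (g w0 - f w0) \<le> E" using near[of w0] y by (simp add: norm_minus_commute)
        also have "E = 10 * K1 * (P ^ 1 * L * q)" by (simp add: E_def)
        also have "\<dots> \<le> 10 * K1 * W" using K1 PLW[of 1] by (intro mult_left_mono) auto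
        finally show ?thesis .
      qed
      define wt where "wt = Complex (lam t) y"
      \<comment> \<open>One chain at two times: the backward flow takes lam(t) + iy to a point of
        height at least y within R y of lam(s), so distortion at \<open>w0\<close> suffices.\<close>
      have step_c: "cmod (f w0 - bflow lam 0 t wt) \<le> C * 512 ^ N * c\<^sub>0 * W"
      proof -
        have wt: "0 < Im wt" "cmod (wt - lam t) = y"
        proof -
          have "wt - lam t = \<i> * of_real y" by (simp add: wt_def complex_eq_iff)
          then show "cmod (wt - lam t) = y" using y by (simp add: norm_mult)
        qed (use y in \<open>simp add: wt_def\<close>)
        obtain u where u: "traj lam s t u" "u t = wt" "u s = bflow lam s t wt"
          by (rule bflow_ex[OF s(1,2,5) wt(1)])
        have imu: "y \<le> Im (u s)" using traj_Im_antimono[OF u(1) s(2)] u(2) by (simp add: wt_def)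
        have "cmod (u s - lam s) \<le> cmod (u t - lam t) + 4 * (2 * P * y)"
        proof (rule traj_displacement[OF u(1) cont_sub[OF s(1,5)]])
          show "\<bar>lam r - lam s\<bar> \<le> 2 * P * y" if "r \<in> {s..t}" for r
            by (rule holder2) (use that s in auto)
          have "t - s \<le> 2 * y\<^sup>2" using s(4) y(3) by simp
          also have "\<dots> \<le> 4 * (P * y)\<^sup>2" using yP2 zero_le_power2[of "P * y"] by linarith
          also have "\<dots> = (2 * P * y)\<^sup>2" by (simp add: power_mult_distrib)
          finally show "t - s \<le> (2 * P * y)\<^sup>2" .
        qed (use Py0 s in auto)
        also have "\<dots> = y + 8 * (P * y)" using wt(2) u(2) by simp
        also have "\<dots> \<le> R * y"
        proof -
          have "1 * y \<le> P * y" "9 * P * y \<le> R * y" using P R y by (intro mult_right_mono; simp)+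
          then show ?thesis by simp
        qed
        finally have far: "cmod (u s - lam s) \<le> R * y" .
        have "y / R \<le> y" using R y by (simp add: divide_le_eq)
        then have "cmod (f (u s) - f w0) \<le> C * R ^ N * y * cmod (deriv f w0)"
          unfolding f_def w0_def
          by (intro bflow_distortion(2)[OF box s(1,3) y(1) R(1) far]) (use imu in auto)
        also have "\<dots> \<le> C * R ^ N * y * (c\<^sub>0 * y powr (- \<beta>))"
          using derf C R y by (intro mult_left_mono) auto
        also have "\<dots> = C * R ^ N * (y * (c\<^sub>0 * y powr (- \<beta>)))" by simp
        also have "\<dots> \<le> C * R ^ N * (c\<^sub>0 * q)" using yb C R by (intro mult_left_mono) auto
        also have "\<dots> = C * 512 ^ N * c\<^sub>0 * (P ^ (3 * N) * q)" unfolding RN by (simp add: mult_ac)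
        also have "\<dots> \<le> C * 512 ^ N * c\<^sub>0 * W" using PW[of "3 * N"] pos(2) by (intro mult_left_mono) auto
        finally have "cmod (f (u s) - f w0) \<le> C * 512 ^ N * c\<^sub>0 * W" .
        moreover have "f (u s) = bflow lam 0 t wt"
          unfolding f_def u(3) by (rule bflow_comp) (use s wt in auto)
        ultimately show ?thesis by (simp add: norm_minus_commute)
      qed
      have step_d: "cmod (\<gamma> t - bflow lam 0 t wt) \<le> c\<^sub>0 / (1 - \<beta>) * W"
      proof -
        have "cmod (\<gamma> t - bflow lam 0 t wt) \<le> c\<^sub>0 / (1 - \<beta>) * y powr (1 - \<beta>)" unfolding wt_def
          by (rule curve_point_radial[OF box sp hol t c \<beta> der' gen y(1,4)]) (use t in auto)
        also have "\<dots> \<le> c\<^sub>0 / (1 - \<beta>) * W"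
          using q(2) PW[of 0] pos(3) by (intro mult_left_mono) auto
        finally show ?thesis .
      qed
      have "cmod (\<gamma>' t - \<gamma> t) \<le> cmod (\<gamma>' t - g w0) + cmod (g w0 - f w0)
          + cmod (f w0 - bflow lam 0 t wt) + cmod (\<gamma> t - bflow lam 0 t wt)"
        using norm_triangle_ineq4[of "\<gamma>' t - g w0 + (g w0 - f w0) + (f w0 - bflow lam 0 t wt)" "\<gamma> t - bflow lam 0 t wt"]
          norm_triangle_ineq[of "\<gamma>' t - g w0 + (g w0 - f w0)" "f w0 - bflow lam 0 t wt"]
          norm_triangle_ineq[of "\<gamma>' t - g w0" "g w0 - f w0"] by simp
      also have "\<dots> \<le> C * 512 ^ N * (c\<^sub>0 + 20 * K1) * W + 10 * K1 * W + C * 512 ^ N * c\<^sub>0 * W + c\<^sub>0 / (1 - \<beta>) * W"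
        by (intro add_mono step_a step_b step_c step_d)
      also have "\<dots> \<le> K * W" unfolding K_def distrib_right using W0 by simp
      finally show ?thesis .
    qed
    then show "cmod (\<gamma>' t - \<gamma> t) \<le> K * (1 + \<phi> (real n)) ^ (3 * N + 1) * (1 + ln (1 + real n)) *
          (1 / sqrt (real n)) powr (1 - sqrt ((1 + \<beta>) / 2))"
      unfolding W_def P_def L_def q_def y_def x_def by (simp only: mult.assoc)
  qed
qed

theorem theorem2p2:
  fixes \<phi> :: "real \<Rightarrow> real" and c\<^sub>0 \<beta> :: real
  assumes "subpower \<phi>" and "0 < c\<^sub>0" and "0 < \<beta>" and "\<beta> < 1"
  shows "\<exists>\<phi>' :: real \<Rightarrow> real. subpower \<phi>' \<and>
    (\<forall>(lam :: real \<Rightarrow> real) (y\<^sub>0 :: real) (\<gamma> :: real \<Rightarrow> complex) (\<gamma>\<^sub>n :: nat \<Rightarrow> real \<Rightarrow> complex).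
       continuous_on {0..1} lam \<longrightarrow>
       weakly_holder_half \<phi> lam \<longrightarrow>
       0 < y\<^sub>0 \<longrightarrow>
       (\<forall>y t. 0 < y \<and> y \<le> y\<^sub>0 \<and> t \<in> {0..1} \<longrightarrow>
          cmod (deriv (loewner_fhat lam t) (\<i> * of_real y)) \<le> c\<^sub>0 * y powr (- \<beta>)) \<longrightarrow>
       generated_by_curve lam \<gamma> \<longrightarrow>
       (\<forall>n\<ge>1. generated_by_curve (sqrt_interp lam n) (\<gamma>\<^sub>n n)) \<longrightarrow>
       (\<forall>n::nat. \<forall>t\<in>{0..1}. real n \<ge> 1 / y\<^sub>0\<^sup>2 \<longrightarrow>
          cmod (\<gamma>\<^sub>n n t - \<gamma> t)
            \<le> \<phi>' (real n) / real n powr (1 / 2 * (1 - sqrt ((1 + \<beta>) / 2)))))"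
proof (rule curve_rate[OF assms])
  fix K :: real and m :: nat
  assume K: "0 \<le> K"
    "\<And>lam y\<^sub>0 \<gamma> \<gamma>' n t. \<lbrakk>continuous_on {0..1} lam; weakly_holder_half \<phi> lam;
       \<And>y t. 0 < y \<Longrightarrow> y \<le> y\<^sub>0 \<Longrightarrow> t \<in> {0..1} \<Longrightarrow>
         cmod (deriv (loewner_fhat lam t) (\<i> * of_real y)) \<le> c\<^sub>0 * y powr (- \<beta>);
       generated_by_curve lam \<gamma>; generated_by_curve (sqrt_interp lam n) \<gamma>';
       1 \<le> n; 1 / sqrt (real n) \<le> y\<^sub>0; 0 \<le> t; t < 1\<rbrakk>
     \<Longrightarrow> cmod (\<gamma>' t - \<gamma> t) \<le> K * (1 + \<phi> (real n)) ^ m * (1 + ln (1 + real n)) *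
          (1 / sqrt (real n)) powr (1 - sqrt ((1 + \<beta>) / 2))"
  \<comment> \<open>Only \<phi>, \<open>c\<^sub>0\<close> and \<beta> enter, since K and m depend on
    nothing else.\<close>
  define \<phi>' where "\<phi>' = (\<lambda>x. K * (1 + \<phi> x) ^ m * (1 + ln (1 + x)))"
  have "subpower \<phi>'" unfolding \<phi>'_def
    by (intro subpower_mult subpower_power subpower_add subpower_const subpower_ln assms K(1)) auto
  moreover have "cmod (\<gamma>\<^sub>n n t - \<gamma> t) \<le> \<phi>' (real n) / real n powr (1 / 2 * (1 - sqrt ((1 + \<beta>) / 2)))"
    if cont: "continuous_on {0..1} lam" and hol: "weakly_holder_half \<phi> lam" and y0: "0 < y\<^sub>0"
      and der: "\<forall>y t. 0 < y \<and> y \<le> y\<^sub>0 \<and> t \<in> {0..1} \<longrightarrow>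
          cmod (deriv (loewner_fhat lam t) (\<i> * of_real y)) \<le> c\<^sub>0 * y powr (- \<beta>)"
      and gen: "generated_by_curve lam \<gamma>" and gen': "\<forall>n\<ge>1. generated_by_curve (sqrt_interp lam n) (\<gamma>\<^sub>n n)"
      and t: "t \<in> {0..1}" and ny: "1 / y\<^sub>0\<^sup>2 \<le> real n"
    for lam y\<^sub>0 \<gamma> and \<gamma>\<^sub>n :: "nat \<Rightarrow> real \<Rightarrow> complex" and n t
  proof -
    define B where "B = \<phi>' (real n) / real n powr (1 / 2 * (1 - sqrt ((1 + \<beta>) / 2)))"
    have "0 < 1 / y\<^sub>0\<^sup>2" using y0 by simp
    then have "0 < real n" using ny by linarith
    then have n: "1 \<le> n" by simp
    have "1 / real n \<le> y\<^sub>0\<^sup>2" using ny y0 n by (simp add: field_simps)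
    then have "sqrt (1 / real n) \<le> y\<^sub>0" using y0 by (intro real_le_lsqrt) auto
    then have yn: "1 / sqrt (real n) \<le> y\<^sub>0" by (simp add: real_sqrt_divide)
    have powr: "(1 / sqrt (real n)) powr (1 - sqrt ((1 + \<beta>) / 2))
        = 1 / real n powr (1 / 2 * (1 - sqrt ((1 + \<beta>) / 2)))"
      unfolding powr_half_sqrt[symmetric, OF of_nat_0_le_iff] using n by (simp add: powr_divide powr_powr)
    have less: "cmod (\<gamma>\<^sub>n n r - \<gamma> r) \<le> B" if r: "0 \<le> r" "r < 1" for r
    proof -
      have "cmod (\<gamma>\<^sub>n n r - \<gamma> r) \<le> K * (1 + \<phi> (real n)) ^ m * (1 + ln (1 + real n)) *
          (1 / sqrt (real n)) powr (1 - sqrt ((1 + \<beta>) / 2))"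
        by (rule K(2)[OF cont hol _ gen _ n yn r]) (use der gen' n in auto)
      then show ?thesis unfolding powr B_def \<phi>'_def by simp
    qed
    have "continuous_on {0..1} (\<gamma>\<^sub>n n)" "continuous_on {0..1} \<gamma>"
      using gen gen' n by (auto simp: generated_by_curve_def)
    \<comment> \<open>The estimate is closed under limits in r, so it extends from [0,1) to r =
      1.\<close>
    then have "closed {r \<in> {0..1}. cmod (\<gamma>\<^sub>n n r - \<gamma> r) \<le> B}"
      by (intro continuous_on_closed_Collect_le continuous_intros) auto
    then have "closure {0..<1} \<subseteq> {r \<in> {0..1}. cmod (\<gamma>\<^sub>n n r - \<gamma> r) \<le> B}"
      using less by (intro closure_minimal) auto
    then show ?thesis using t unfolding B_def by auto
  qed
  ultimately show ?thesis by (intro exI[of _ \<phi>'] conjI allI impI ballI) simp_all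
qed

end
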